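(* In the Weihrauch degrees, each of $\mathsf{wRSg}$ and $\mathsf{wRSgr}$ is strictly below $\mathsf{RT}^2_2$ (i.e. $\le_\mathrm{W}\mathsf{RT}^2_2$ but $\mathsf{RT}^2_2\not\le_\mathrm{W}$ it); strictly above $\mathsf{COH}$ and strictly above $\mathsf{RT}^1_{<\infty}$; and Weihrauch incomparable with each of $\lim$, $\mathsf{SRT}^2_2$, $\mathsf{SADC}$, and $\mathsf{DNR}$.
   Context: Problems are multi-valued partial functions $\mathcal{F}\colon\subseteq\omega^\omega\rightrightarrows\omega^\omega$ (countable objects coded in $\omega^\omega$ in the standard way). $\mathcal{F}\le_\mathrm{W}\mathcal{G}$ if there are Turing functionals $\Phi,\Psi$ with $\Phi(f)\in\mathrm{dom}(\mathcal{G})$ for all $f\in\mathrm{dom}(\mathcal{F})$ and $\Psi(\langle f,g\rangle)\in\mathcal{F}(f)$ for all $f\in\mathrm{dom}(\mathcal F)$, $g\in\mathcal{G}(\Phi(f))$. Graphs $G=(V,E)$ are simple with $V\subseteq\omega$ infinite, $E\subseteq[V]^2$; $N(v)=\{y:(v,y)\in E\}$. $\mathsf{wRSg}$: input an infinite graph $G=(V,E)$; output an infinite $H\subseteq V$ such that for all $v\in H$, $|H\cap N(v)|=\omega$ or $|H\cap N(v)|\le1$. $\mathsf{wRSgr}$: input an infinite graph; output an infinite $H\subseteq V$ such that for all $v\in H$, $|H\cap N(v)|=\omega$ or $|H\cap N(v)|=0$. $\mathsf{RT}^2_2$: input $c\colon[\omega]^2\to\{0,1\}$; output an infinite $H$ homogeneous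 for $c$ ($c$ constant on $[H]^2$). $\mathsf{SRT}^2_2$: same, restricted to stable $c$ (for each $n$, $\lim_s c(n,s)$ exists). $\mathsf{COH}$: input a sequence $(A_i:i\in\omega)$ of subsets of $\omega$; output an infinite $C$ such that for each $i$, $C\setminus A_i$ or $C\cap A_i$ is finite. $\mathsf{RT}^1_{<\infty}$: input $c\colon\omega\to\omega$ with finite range; output an infinite $H$ on which $c$ is constant. $\lim$: input $f\colon\omega\times\omega\to\omega$ such that $g(n)=\lim_s f(n,s)$ exists for all $n$; output $g$. $\mathsf{DNR}$: input $p\in\omega^\omega$; output $f\in\omega^\omega$ with $f(e)\ne\Phi_e(p)(e)$ whenever $\Phi_e(p)(e)$ converges ($(\Phi_e)$ the standard list of Turing functionals). $\mathsf{SADC}$: input an infinite linear order $(L,<_L)$ with $L\subseteq\omega$ of order type $\omega+\omega^*$; output an infinite $C\subseteq L$ which is an ascending chain ($\{x\in C:x<_L y\}$ finite for every $y\in C$) or a descending chain ($\{x\in C:y<_Lx\}$ finite for every $y\in C$). *)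

theory Defs
  imports
    "HOL-Library.Nat_Bijection"
    "HOL-Library.Indicator_Function"
    "HOL-Library.FuncSet"
    "HOL-Library.Ramsey"
begin

section \<open>Turing functionals\<close>

type_synonym baire = "nat \<Rightarrow> nat"

text \<open>Programs for the partial functions that are recursive in an oracle. All functions are
  unary; several arguments are passed through the pairing bijection \<^const>\<open>prod_encode\<close>, and the
  identity is \<open>PPair PFst PSnd\<close>.\<close>

datatype prog =
    PZero
  | PSuc
  | PFst
  | PSnd
  | POracle
  | PPair prog prog
  | PComp prog prog
  | PRec prog prog
  | PMu prog

text \<open>\<open>PRec f g\<close> is primitive recursion on the second component, with parameter the first one:
  \<open>h \<langle>a, 0\<rangle> = f a\<close> and \<open>h \<langle>a, n + 1\<rangle> = g \<langle>a, \<langle>n, h \<langle>a, n\<rangle>\<rangle>\<rangle>\<close>.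
  \<open>PMu f\<close> is unbounded search: at \<open>x\<close> it returns the least \<open>n\<close> with \<open>f \<langle>x, n\<rangle> = 0\<close>, and diverges
  if there is none or if \<open>f \<langle>x, m\<rangle>\<close> diverges for some earlier \<open>m\<close>.\<close>

primrec run :: "prog \<Rightarrow> baire \<Rightarrow> nat \<rightharpoonup> nat" where
  "run PZero p x = Some 0"
| "run PSuc p x = Some (Suc x)"
| "run PFst p x = Some (fst (prod_decode x))"
| "run PSnd p x = Some (snd (prod_decode x))"
| "run POracle p x = Some (p x)"
| "run (PPair f g) p x =
     Option.bind (run f p x) (\<lambda>a. Option.bind (run g p x) (\<lambda>b. Some (prod_encode (a, b))))"
| "run (PComp f g) p x = Option.bind (run g p x) (run f p)"
| "run (PRec f g) p x =
     (case prod_decode x of (a, n) \<Rightarrow>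
        rec_nat (run f p a)
          (\<lambda>k r. Option.bind r (\<lambda>y. run g p (prod_encode (a, prod_encode (k, y))))) n)"
| "run (PMu f) p x =
     (if \<exists>n. run f p (prod_encode (x, n)) = Some 0 \<and>
             (\<forall>m<n. run f p (prod_encode (x, m)) \<noteq> None)
      then Some (LEAST n. run f p (prod_encode (x, n)) = Some 0)
      else None)"

text \<open>The (bijective) Goedel numbering underlying the standard list of Turing functionals.\<close>

lemma prod_decode_less:
  assumes "n \<noteq> 0"
  shows "fst (prod_decode ((n - 5) div 4)) < n" "snd (prod_decode ((n - 5) div 4)) < n"
    "(n - 5) div 4 < n"
proof -
  show less: "(n - 5) div 4 < n" using assms by linarith
  have "fst (prod_decode m) \<le> m" "snd (prod_decode m) \<le> m" for m
    using le_prod_encode_1[of "fst (prod_decode m)" "snd (prod_decode m)"]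
      le_prod_encode_2[of "snd (prod_decode m)" "fst (prod_decode m)"]
    by simp_all
  then show "fst (prod_decode ((n - 5) div 4)) < n" "snd (prod_decode ((n - 5) div 4)) < n"
    using less le_less_trans by blast+
qed

function prog_of :: "nat \<Rightarrow> prog" where
  "prog_of n =
     (if n = 0 then PZero
      else if n = 1 then PSuc
      else if n = 2 then PFst
      else if n = 3 then PSnd
      else if n = 4 then POracle
      else let m = (n - 5) div 4; a = fst (prod_decode m); b = snd (prod_decode m) in
        (if (n - 5) mod 4 = 0 then PPair (prog_of a) (prog_of b)
         else if (n - 5) mod 4 = 1 then PComp (prog_of a) (prog_of b)
         else if (n - 5) mod 4 = 2 then PRec (prog_of a) (prog_of b)
         else PMu (prog_of m)))"
  by auto
termination
  by (relation "measure id") (simp_all add: prod_decode_less)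

declare prog_of.simps [simp del]

definition Phi :: "nat \<Rightarrow> baire \<Rightarrow> nat \<rightharpoonup> nat" where
  "Phi e p = run (prog_of e) p"

definition functional_value :: "nat \<Rightarrow> baire \<Rightarrow> baire \<Rightarrow> bool" where
  "functional_value e p q \<longleftrightarrow> (\<forall>n. Phi e p n = Some (q n))"

lemma surj_prog_of: "surj prog_of"
proof -
  have div4: "Suc (4 * m) div 4 = m" "Suc (Suc (4 * m)) div 4 = m" "Suc (Suc (4 * m)) mod 4 = 2"
    for m :: nat by presburger+
  have "\<exists>n. prog_of n = q" for q
  proof (induction q)
    case PZero
    have "prog_of 0 = PZero" by (simp add: prog_of.simps)
    then show ?case by blast
  next
    case PSuc
    have "prog_of 1 = PSuc" by (simp add: prog_of.simps)
    then show ?case by blast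
  next
    case PFst
    have "prog_of 2 = PFst" by (simp add: prog_of.simps)
    then show ?case by blast
  next
    case PSnd
    have "prog_of 3 = PSnd" by (simp add: prog_of.simps)
    then show ?case by blast
  next
    case POracle
    have "prog_of 4 = POracle" by (simp add: prog_of.simps)
    then show ?case by blast
  next
    case (PPair f g)
    then obtain a b where "prog_of a = f" "prog_of b = g" by blast
    then have "prog_of (5 + 4 * prod_encode (a, b)) = PPair f g"
      by (subst prog_of.simps) (simp add: Let_def div4)
    then show ?case by blast
  next
    case (PComp f g)
    then obtain a b where "prog_of a = f" "prog_of b = g" by blast
    then have "prog_of (6 + 4 * prod_encode (a, b)) = PComp f g"
      by (subst prog_of.simps) (simp add: Let_def div4)
    then show ?case by blast
  next
    case (PRec f g)
    then obtain a b where "prog_of a = f" "prog_of b = g" by blast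
    then have "prog_of (7 + 4 * prod_encode (a, b)) = PRec f g"
      by (subst prog_of.simps) (simp add: Let_def div4)
    then show ?case by blast
  next
    case (PMu f)
    then obtain a where "prog_of a = f" by blast
    then have "prog_of (8 + 4 * a) = PMu f"
      by (subst prog_of.simps) (simp add: Let_def div4)
    then show ?case by blast
  qed
  then show ?thesis by (metis surjI)
qed


section \<open>Problems and Weihrauch reducibility\<close>

text \<open>A multi-valued partial function on Baire space, as its domain together with the set of
  values at each point of the domain.\<close>

record problem =
  insts :: "baire set"
  sols :: "baire \<Rightarrow> baire set"

definition join :: "baire \<Rightarrow> baire \<Rightarrow> baire" where
  "join f g n = (if even n then f (n div 2) else g (n div 2))"

definition weihrauch_le :: "problem \<Rightarrow> problem \<Rightarrow> bool"  (infix "\<le>\<^sub>W" 50) where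
  "F \<le>\<^sub>W G \<longleftrightarrow>
     (\<exists>a b. \<forall>f\<in>insts F. \<exists>h\<in>insts G. functional_value a f h \<and>
        (\<forall>g\<in>sols G h. \<exists>k\<in>sols F f. functional_value b (join f g) k))"

definition weihrauch_less :: "problem \<Rightarrow> problem \<Rightarrow> bool"  (infix "<\<^sub>W" 50) where
  "F <\<^sub>W G \<longleftrightarrow> F \<le>\<^sub>W G \<and> \<not> G \<le>\<^sub>W F"

definition weihrauch_incomparable :: "problem \<Rightarrow> problem \<Rightarrow> bool"  (infix "\<parallel>\<^sub>W" 50) where
  "F \<parallel>\<^sub>W G \<longleftrightarrow> \<not> F \<le>\<^sub>W G \<and> \<not> G \<le>\<^sub>W F"

text \<open>The problem with mathematical instances \<open>I\<close> and solution sets \<open>S\<close>, where instances are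
  coded by \<open>ci\<close> and solutions by \<open>co\<close>. The codings used below are injective on the
  respective objects (proved at the end where it is not immediate), except that two colourings have
  the same code when they agree on the two-element sets, hence have the same solutions.\<close>

definition coded_problem ::
    "('i \<Rightarrow> baire) \<Rightarrow> ('o \<Rightarrow> baire) \<Rightarrow> 'i set \<Rightarrow> ('i \<Rightarrow> 'o set) \<Rightarrow> problem" where
  "coded_problem ci co I S =
     \<lparr>insts = ci ` I, sols = (\<lambda>p. {co h | h i. i \<in> I \<and> ci i = p \<and> h \<in> S i})\<rparr>"


section \<open>Codings of countable objects\<close>

text \<open>A set of natural numbers is coded by its characteristic function \<^const>\<open>indicator\<close>.
  A function on unordered pairs is coded by a symmetric function on ordered pairs; the value \<open>0\<close>
  on the diagonal is a dummy.\<close>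

definition code_pairfun :: "(nat set \<Rightarrow> nat) \<Rightarrow> baire" where
  "code_pairfun c n = (case prod_decode n of (x, y) \<Rightarrow> if x = y then 0 else c {x, y})"

definition code_relation :: "(nat \<times> nat) set \<Rightarrow> baire" where
  "code_relation R = indicator (prod_encode ` R)"

definition code_sequence :: "(nat \<Rightarrow> nat set) \<Rightarrow> baire" where
  "code_sequence A = code_relation {(i, n). n \<in> A i}"

definition code_graph :: "nat set \<times> nat set set \<Rightarrow> baire" where
  "code_graph = (\<lambda>(V, E). join (indicator V) (code_pairfun (indicator E)))"

definition code_order :: "nat set \<times> (nat \<times> nat) set \<Rightarrow> baire" where
  "code_order = (\<lambda>(L, R). join (indicator L) (code_relation R))"


section \<open>Graph problems\<close>

definition infinite_graphs :: "(nat set \<times> nat set set) set" where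
  "infinite_graphs = {(V, E). infinite V \<and> E \<subseteq> nsets V 2}"

definition nbh :: "nat set set \<Rightarrow> nat \<Rightarrow> nat set" where
  "nbh E v = {y. {v, y} \<in> E}"

definition wRSg :: problem where
  "wRSg = coded_problem code_graph indicator infinite_graphs
     (\<lambda>(V, E). {H. H \<subseteq> V \<and> infinite H \<and>
        (\<forall>v\<in>H. infinite (H \<inter> nbh E v) \<or> (finite (H \<inter> nbh E v) \<and> card (H \<inter> nbh E v) \<le> 1))})"

definition wRSgr :: problem where
  "wRSgr = coded_problem code_graph indicator infinite_graphs
     (\<lambda>(V, E). {H. H \<subseteq> V \<and> infinite H \<and>
        (\<forall>v\<in>H. infinite (H \<inter> nbh E v) \<or> H \<inter> nbh E v = {})})"


section \<open>Colouring problems\<close>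

text \<open>Only the values of \<open>c\<close> on two-element sets matter; they are the only ones that enter the
  code of \<open>c\<close>.\<close>

definition colourings :: "(nat set \<Rightarrow> nat) set" where
  "colourings = nsets UNIV 2 \<rightarrow> {0, 1}"

definition stable :: "(nat set \<Rightarrow> nat) \<Rightarrow> bool" where
  "stable c \<longleftrightarrow> (\<forall>n. \<exists>i. eventually (\<lambda>s. c {n, s} = i) sequentially)"

definition homogeneous_sets :: "(nat set \<Rightarrow> nat) \<Rightarrow> nat set set" where
  "homogeneous_sets c = {H. infinite H \<and> (\<exists>i. \<forall>X\<in>nsets H 2. c X = i)}"

definition RT22 :: problem where
  "RT22 = coded_problem code_pairfun indicator colourings homogeneous_sets"

definition SRT22 :: problem where
  "SRT22 = coded_problem code_pairfun indicator {c \<in> colourings. stable c} homogeneous_sets"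

definition RT1_fin :: problem where
  "RT1_fin = coded_problem id indicator {c. finite (range c)}
     (\<lambda>c. {H. infinite H \<and> (\<exists>i. \<forall>x\<in>H. c x = i)})"


section \<open>Cohesiveness, limits, diagonal non-recursiveness, chains\<close>

definition COH :: problem where
  "COH = coded_problem code_sequence indicator UNIV
     (\<lambda>A. {C. infinite C \<and> (\<forall>i. finite (C - A i) \<or> finite (C \<inter> A i))})"

definition LimP :: problem where
  "LimP = coded_problem (\<lambda>f. f \<circ> prod_decode) id
     {f. \<forall>n. \<exists>l. eventually (\<lambda>s. f (n, s) = l) sequentially}
     (\<lambda>f. {g. \<forall>n. eventually (\<lambda>s. f (n, s) = g n) sequentially})"

definition DNR :: problem where
  "DNR = coded_problem id id UNIV (\<lambda>p. {f. \<forall>e. Phi e p e \<noteq> Some (f e)})"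

text \<open>The strict order \<open>\<omega> + \<omega>\<^sup>*\<close>: a copy of \<open>\<omega>\<close> followed by a reversed copy of \<open>\<omega>\<close>.\<close>

fun omega_omega_star_less :: "nat + nat \<Rightarrow> nat + nat \<Rightarrow> bool" where
  "omega_omega_star_less (Inl m) (Inl n) \<longleftrightarrow> m < n"
| "omega_omega_star_less (Inl m) (Inr n) \<longleftrightarrow> True"
| "omega_omega_star_less (Inr m) (Inl n) \<longleftrightarrow> False"
| "omega_omega_star_less (Inr m) (Inr n) \<longleftrightarrow> n < m"

definition type_omega_omega_star :: "nat set \<Rightarrow> (nat \<times> nat) set \<Rightarrow> bool" where
  "type_omega_omega_star L R \<longleftrightarrow>
     (\<exists>\<phi> :: nat \<Rightarrow> nat + nat. bij_betw \<phi> L UNIV \<and>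
        (\<forall>x\<in>L. \<forall>y\<in>L. (x, y) \<in> R \<longleftrightarrow> omega_omega_star_less (\<phi> x) (\<phi> y)))"

definition SADC_orders :: "(nat set \<times> (nat \<times> nat) set) set" where
  "SADC_orders = {(L, R). infinite L \<and> R \<subseteq> L \<times> L \<and> strict_linear_order_on L R \<and>
     type_omega_omega_star L R}"

definition ascending_chain :: "(nat \<times> nat) set \<Rightarrow> nat set \<Rightarrow> bool" where
  "ascending_chain R C \<longleftrightarrow> (\<forall>y\<in>C. finite {x \<in> C. (x, y) \<in> R})"

definition descending_chain :: "(nat \<times> nat) set \<Rightarrow> nat set \<Rightarrow> bool" where
  "descending_chain R C \<longleftrightarrow> (\<forall>y\<in>C. finite {x \<in> C. (y, x) \<in> R})"

definition SADC :: problem where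
  "SADC = coded_problem code_order indicator SADC_orders
     (\<lambda>(L, R). {C. C \<subseteq> L \<and> infinite C \<and> (ascending_chain R C \<or> descending_chain R C)})"


section \<open>Adequacy of the codings\<close>

lemma join_eq_iff: "join f g = join f' g' \<longleftrightarrow> f = f' \<and> g = g'"
proof
  assume eq: "join f g = join f' g'"
  have "f n = f' n" for n using fun_cong[OF eq, of "2 * n"] by (simp add: join_def)
  moreover have "g n = g' n" for n using fun_cong[OF eq, of "2 * n + 1"] by (simp add: join_def)
  ultimately show "f = f' \<and> g = g'" by blast
qed simp

lemma indicator_nat_eq_iff: "(indicator A :: 'a \<Rightarrow> nat) = indicator B \<longleftrightarrow> A = B"
  by (auto simp: fun_eq_iff indicator_def split: if_splits)

lemma code_pairfun_eq_iff:
  "code_pairfun c = code_pairfun d \<longleftrightarrow> (\<forall>X\<in>nsets UNIV 2. c X = d X)"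
proof
  assume eq: "code_pairfun c = code_pairfun d"
  show "\<forall>X\<in>nsets UNIV 2. c X = d X"
  proof
    fix X :: "nat set" assume "X \<in> nsets UNIV 2"
    then obtain x y where "X = {x, y}" "x \<noteq> y"
      by (auto simp: nsets_def card_2_iff)
    then show "c X = d X"
      using fun_cong[OF eq, of "prod_encode (x, y)"] by (simp add: code_pairfun_def)
  qed
next
  assume eq: "\<forall>X\<in>nsets UNIV 2. c X = d X"
  have "c {x, y} = d {x, y}" if "x \<noteq> y" for x y
    using eq that by (auto simp: nsets_def)
  then show "code_pairfun c = code_pairfun d"
    by (auto simp: code_pairfun_def fun_eq_iff split: prod.splits)
qed

lemma code_relation_eq_iff: "code_relation R = code_relation S \<longleftrightarrow> R = S"
  by (simp add: code_relation_def indicator_nat_eq_iff inj_image_eq_iff[OF inj_prod_encode])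

lemma inj_code_sequence: "inj code_sequence"
proof (rule injI)
  fix A B assume "code_sequence A = code_sequence B"
  then have "{(i, n). n \<in> A i} = {(i, n). n \<in> B i}"
    by (simp only: code_sequence_def code_relation_eq_iff)
  then show "A = B" by (auto simp: fun_eq_iff set_eq_iff)
qed

lemma inj_code_order: "inj code_order"
  by (rule injI) (auto simp: code_order_def join_eq_iff code_relation_eq_iff indicator_nat_eq_iff)

lemma inj_on_code_graph: "inj_on code_graph infinite_graphs"
proof (rule inj_onI, clarify)
  fix V E V' E'
  assume G: "(V, E) \<in> infinite_graphs" "(V', E') \<in> infinite_graphs"
    and eq: "code_graph (V, E) = code_graph (V', E')"
  have sub: "E \<subseteq> nsets UNIV 2" "E' \<subseteq> nsets UNIV 2"
    using G by (auto simp: infinite_graphs_def nsets_def)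
  from eq have V: "V = V'"
    and E: "\<forall>X\<in>nsets UNIV 2. (indicator E X :: nat) = indicator E' X"
    by (auto simp: code_graph_def join_eq_iff indicator_nat_eq_iff code_pairfun_eq_iff)
  have "X \<in> E \<longleftrightarrow> X \<in> E'" for X
  proof (cases "X \<in> nsets UNIV 2")
    case True
    with E have "(indicator E X :: nat) = indicator E' X" by blast
    then show ?thesis by (simp add: indicator_def of_bool_eq_iff)
  qed (use sub in blast)
  with V show "V = V' \<and> E = E'" by blast
qed

end

(*
  All non-reductions rest only on the continuity of Turing functionals.

  Nothing evasive reduces to wRSgr. Suppose Q is such that every initial segment of a solution of an
  instance can be turned into an initial segment of no solution by changing the instance far out, keeping
  promises made before. Given a reduction of Q to wRSgr, an initial segment F of a solution of the graph
  of p can then be banned: some nearby q has almost the same graph, but no solution starts with F.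
  (1) Some instance has a graph with an infinite independent set. Otherwise ban consecutive pieces of
  infinite cliques; in the limit every piece contains a vertex of finite degree, and infinitely many of
  these contain an infinite independent set. (2) Some instance has a graph with an infinite clique.
  Otherwise ban consecutive pieces of infinite independent sets, each contained in the neighbourhood of
  some vertex of every earlier piece; in the limit, such vertices form a clique. (3) Now ban an initial
  segment F of an infinite independent set and pass to a graph with an infinite clique C. Then F together
  with almost all vertices of C that are not joined to a vertex of F with finite degree into C is a
  solution, a contradiction.

  RT1_fin is not reducible to problems whose solutions depend continuously on generic instances: the
  colour of one element of the solution can be made to disappear. For SRT22 there are two kinds of
  solutions, and with three colours both can be disposed of one after the other. If wRSg were reducible
  to RT1_fin, then by the Baire category theorem the number of colours used near some graph would be
  bounded by some k, and the graph could be continued by k + 1 cliques.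

  For COH, join x < y when the sequence of bits of x lies lexicographically below that of y.
*)

theory Submission imports Defs
begin

section \<open>Computable functionals\<close>

text \<open>\<open>wRSg\<close> lies below \<open>wRSgr\<close>, so \<open>COH\<close> and
  \<open>RT1_fin\<close> are reduced to \<open>wRSg\<close>, while non-reductions are shown for
  \<open>wRSgr\<close>; both problems inherit the results. That neither graph problem lies below
  lim, \<open>SRT22\<close>, \<open>SADC\<close>, \<open>DNR\<close> or \<open>COH\<close> comes
  from \<open>RT1_fin\<close>, which is below both. The domains of \<open>LimP\<close>,
  \<open>SRT22\<close> and \<open>SADC\<close> are not closed in Baire space, so a sequence of
  growing prefixes may converge to a point outside. The forcing conditions therefore freeze whole
  columns, which carry the limit behaviour; for orders, the rank also demands that many frozen
  elements lie in either half. A ban is contradictory only if the banned piece has an extension to a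
  solution. An infinite clique extends every finite independent piece, hence the order of events: an
  independent set is found first, a clique afterwards. For \<open>SRT22\<close>, genericity makes
  each single limit colour locally constant, but not the answer to which colour is a limit
  infinitely often. This is why solutions of one colour are killed at the price of a colour of the
  \<open>RT1_fin\<close> instance.\<close>

definition agree :: "nat \<Rightarrow> baire \<Rightarrow> baire \<Rightarrow> bool" where
  "agree n p q \<longleftrightarrow> (\<forall>i<n. p i = q i)"

lemma agree_refl [simp]: "agree n p p"
  by (simp add: agree_def)

lemma agree_sym: "agree n p q \<Longrightarrow> agree n q p"
  by (simp add: agree_def)

lemma agree_trans: "agree n p q \<Longrightarrow> agree n q r \<Longrightarrow> agree n p r"
  by (simp add: agree_def)

lemma agree_mono: "agree n p q \<Longrightarrow> m \<le> n \<Longrightarrow> agree m p q"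
  by (simp add: agree_def)

lemma agreeD: "agree n p q \<Longrightarrow> i < n \<Longrightarrow> p i = q i"
  by (simp add: agree_def)

lemma agree_max [simp]: "agree (max n m) p q \<longleftrightarrow> agree n p q \<and> agree m p q"
  by (auto simp: agree_def less_max_iff_disj)

text \<open>Finitely many neighbourhoods of \<open>p\<close> have a common refinement, given by the
  largest modulus.\<close>

lemma eventually_agree_all:
  assumes "\<And>x. x < (k::nat) \<Longrightarrow> \<exists>n. \<forall>q. agree n p q \<longrightarrow> R x q"
  shows "\<exists>n. \<forall>q. agree n p q \<longrightarrow> (\<forall>x<k. R x q)"
proof -
  from assms obtain m where m: "\<And>x q. x < k \<Longrightarrow> agree (m x) p q \<Longrightarrow> R x q"
    by metis
  have "R x q" if "agree (Max (m ` {..<k})) p q" "x < k" for x q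
    using that by (intro m agree_mono[OF that(1)]) auto
  then show ?thesis by blast
qed

text \<open>The use principle: a converging computation asks finitely many oracle questions. An
  unbounded search evaluates its body only up to the value returned.\<close>

lemma run_use: "run P p x = Some y \<Longrightarrow> \<exists>n. \<forall>q. agree n p q \<longrightarrow> run P q x = Some y"
proof (induction P arbitrary: x y)
  case POracle
  then show ?case by (intro exI[of _ "Suc x"]) (auto simp: agree_def)
next
  case (PPair f g)
  from PPair.prems obtain a b where ab: "run f p x = Some a" "run g p x = Some b"
    "y = prod_encode (a, b)" by (auto simp: bind_eq_Some_conv)
  from PPair.IH(1)[OF ab(1)] PPair.IH(2)[OF ab(2)] obtain n m where
    "\<forall>q. agree n p q \<longrightarrow> run f q x = Some a" "\<forall>q. agree m p q \<longrightarrow> run g q x = Some b" by blast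
  then show ?case using ab
    by (intro exI[of _ "max n m"]) simp
next
  case (PComp f g)
  from PComp.prems obtain a where ab: "run g p x = Some a" "run f p a = Some y"
    by (auto simp: bind_eq_Some_conv)
  from PComp.IH(1)[OF ab(2)] PComp.IH(2)[OF ab(1)] obtain n m where
    "\<forall>q. agree n p q \<longrightarrow> run f q a = Some y" "\<forall>q. agree m p q \<longrightarrow> run g q x = Some a" by blast
  then show ?case
    by (intro exI[of _ "max n m"]) simp
next
  case (PRec f g)
  obtain a k where x: "prod_decode x = (a, k)" by fastforce
  let ?r = "\<lambda>p k. rec_nat (run f p a)
          (\<lambda>k r. Option.bind r (\<lambda>y. run g p (prod_encode (a, prod_encode (k, y))))) k"
  have "?r p k = Some y \<Longrightarrow> \<exists>n. \<forall>q. agree n p q \<longrightarrow> ?r q k = Some y" for y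
  proof (induction k arbitrary: y)
    case 0
    then show ?case using PRec.IH(1) by simp
  next
    case (Suc k)
    from Suc.prems obtain z where z: "?r p k = Some z"
      "run g p (prod_encode (a, prod_encode (k, z))) = Some y"
      by (auto simp: bind_eq_Some_conv)
    from Suc.IH[OF z(1)] PRec.IH(2)[OF z(2)] obtain n m where
      "\<forall>q. agree n p q \<longrightarrow> ?r q k = Some z"
      "\<forall>q. agree m p q \<longrightarrow> run g q (prod_encode (a, prod_encode (k, z))) = Some y" by blast
    then show ?case
      by (intro exI[of _ "max n m"]) simp
  qed
  then show ?case using PRec.prems by (simp add: x)
next
  case (PMu f)
  let ?z = "\<lambda>p n. run f p (prod_encode (x, n))"
  from PMu.prems have ex: "\<exists>n. ?z p n = Some 0 \<and> (\<forall>m<n. ?z p m \<noteq> None)"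
    and y: "y = (LEAST n. ?z p n = Some 0)" by (auto split: if_splits)
  from ex y have y0: "?z p y = Some 0" and below: "\<And>m. m < y \<Longrightarrow> ?z p m \<noteq> None \<and> ?z p m \<noteq> Some 0"
    by (metis (mono_tags, lifting) LeastI not_less_Least nat_neq_iff order_less_trans)+
  have "\<exists>n. \<forall>q. agree n p q \<longrightarrow> (\<forall>m<Suc y. ?z q m = ?z p m)"
  proof (rule eventually_agree_all)
    fix m assume "m < Suc y"
    then obtain v where v: "?z p m = Some v" using y0 below by (metis less_Suc_eq not_None_eq)
    with PMu.IH[OF v] show "\<exists>n. \<forall>q. agree n p q \<longrightarrow> ?z q m = ?z p m" by simp
  qed
  then obtain n where n: "\<And>q m. agree n p q \<Longrightarrow> m < Suc y \<Longrightarrow> ?z q m = ?z p m" by blast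
  have "run (PMu f) q x = Some y" if "agree n p q" for q
  proof -
    have eq: "?z q m = ?z p m" if "m \<le> y" for m using n[OF \<open>agree n p q\<close>] that by simp
    have "?z q y = Some 0" "\<forall>m<y. ?z q m \<noteq> None" using eq y0 below by auto
    moreover have "(LEAST n. ?z q n = Some 0) = y"
      using eq y0 below by (intro Least_equality) (auto simp: not_less[symmetric])
    ultimately show ?thesis by auto
  qed
  then show ?case by blast
qed auto

section \<open>Composition of functionals and closure properties of the computable ones\<close>

primrec oracle_subst :: "prog \<Rightarrow> prog \<Rightarrow> prog" where
  "oracle_subst a PZero = PZero"
| "oracle_subst a PSuc = PSuc"
| "oracle_subst a PFst = PFst"
| "oracle_subst a PSnd = PSnd"
| "oracle_subst a POracle = a"
| "oracle_subst a (PPair f g) = PPair (oracle_subst a f) (oracle_subst a g)"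
| "oracle_subst a (PComp f g) = PComp (oracle_subst a f) (oracle_subst a g)"
| "oracle_subst a (PRec f g) = PRec (oracle_subst a f) (oracle_subst a g)"
| "oracle_subst a (PMu f) = PMu (oracle_subst a f)"

lemma run_oracle_subst:
  assumes "\<And>x. run a p x = Some (q x)"
  shows "run (oracle_subst a b) p = run b q"
  by (induction b) (rule ext, simp add: assms)+

text \<open>A promise version of computability: \<open>F\<close> is total in HOL and one program
  must compute it on \<open>D\<close>, with no demand outside. Partiality then enters only through
  the choice of \<open>D\<close>.\<close>

definition comp_on :: "baire set \<Rightarrow> (baire \<Rightarrow> nat \<Rightarrow> nat) \<Rightarrow> bool" where
  "comp_on D F \<longleftrightarrow> (\<exists>P. \<forall>p\<in>D. \<forall>x. run P p x = Some (F p x))"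

abbreviation comp_pred :: "baire set \<Rightarrow> (baire \<Rightarrow> nat \<Rightarrow> bool) \<Rightarrow> bool" where
  "comp_pred D Q \<equiv> comp_on D (\<lambda>p x. of_bool (Q p x))"

lemma comp_onI: "(\<And>p x. p \<in> D \<Longrightarrow> run P p x = Some (F p x)) \<Longrightarrow> comp_on D F"
  by (auto simp: comp_on_def)

lemma comp_on_cong: "comp_on D G \<Longrightarrow> (\<And>p x. p \<in> D \<Longrightarrow> F p x = G p x) \<Longrightarrow> comp_on D F"
  by (auto simp: comp_on_def)

lemma comp_on_comp:
  assumes "comp_on D G" "comp_on D F"
  shows "comp_on D (\<lambda>p x. G p (F p x))"
proof -
  from assms obtain P Q where "\<forall>p\<in>D. \<forall>x. run P p x = Some (G p x)"
    "\<forall>p\<in>D. \<forall>x. run Q p x = Some (F p x)" by (auto simp: comp_on_def)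
  then show ?thesis by (intro comp_onI[of _ "PComp P Q"]) simp
qed

named_theorems comp_intros

lemma comp_on_id [comp_intros]: "comp_on D (\<lambda>p x. x)"
  by (rule comp_onI[of _ "PPair PFst PSnd"]) simp

lemma comp_on_Suc [comp_intros]: "comp_on D F \<Longrightarrow> comp_on D (\<lambda>p x. Suc (F p x))"
  by (rule comp_on_comp[of _ "\<lambda>p. Suc"], rule comp_onI[of _ PSuc]) auto

lemma comp_on_fst [comp_intros]: "comp_on D F \<Longrightarrow> comp_on D (\<lambda>p x. fst (prod_decode (F p x)))"
  by (rule comp_on_comp[of _ "\<lambda>p x. fst (prod_decode x)"], rule comp_onI[of _ PFst]) auto

lemma comp_on_snd [comp_intros]: "comp_on D F \<Longrightarrow> comp_on D (\<lambda>p x. snd (prod_decode (F p x)))"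
  by (rule comp_on_comp[of _ "\<lambda>p x. snd (prod_decode x)"], rule comp_onI[of _ PSnd]) auto

lemma comp_on_oracle [comp_intros]: "comp_on D F \<Longrightarrow> comp_on D (\<lambda>p x. p (F p x))"
  by (rule comp_on_comp[of _ "\<lambda>p x. p x"], rule comp_onI[of _ POracle]) auto

lemma comp_on_const [comp_intros]: "comp_on D (\<lambda>p x. c)"
proof (induction c)
  case 0
  show ?case by (rule comp_onI[of _ PZero]) simp
qed (rule comp_on_Suc)

lemma comp_on_pair [comp_intros]:
  assumes "comp_on D F" "comp_on D G"
  shows "comp_on D (\<lambda>p x. prod_encode (F p x, G p x))"
proof -
  from assms obtain P Q where "\<forall>p\<in>D. \<forall>x. run P p x = Some (F p x)"
    "\<forall>p\<in>D. \<forall>x. run Q p x = Some (G p x)" by (auto simp: comp_on_def)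
  then show ?thesis by (intro comp_onI[of _ "PPair P Q"]) simp
qed

lemma comp_on_rec [comp_intros]:
  assumes "comp_on D F"
    and "comp_on D (\<lambda>p z. G p (fst (prod_decode z)) (fst (prod_decode (snd (prod_decode z))))
           (snd (prod_decode (snd (prod_decode z)))))"
    and N: "comp_on D N"
  shows "comp_on D (\<lambda>p x. rec_nat (F p x) (G p x) (N p x))"
proof -
  from assms obtain P Q where P: "\<forall>p\<in>D. \<forall>x. run P p x = Some (F p x)"
    and Q: "\<forall>p\<in>D. \<forall>z. run Q p z = Some (G p (fst (prod_decode z))
      (fst (prod_decode (snd (prod_decode z)))) (snd (prod_decode (snd (prod_decode z)))))"
    unfolding comp_on_def by blast
  have "run (PRec P Q) p (prod_encode (x, n)) = Some (rec_nat (F p x) (G p x) n)" if "p \<in> D" for p x n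
    using that P Q by (induction n) auto
  then have "comp_on D (\<lambda>p z. rec_nat (F p (fst (prod_decode z))) (G p (fst (prod_decode z)))
      (snd (prod_decode z)))"
    by (intro comp_onI[of _ "PRec P Q"]) (metis prod.collapse prod_decode_inverse)
  \<comment> \<open>The number of rounds may depend on the input, so the pair of the input and
    \<open>N p x\<close> is fed to the recursion.\<close>
  from comp_on_comp[OF this comp_on_pair[OF comp_on_id N]] show ?thesis by simp
qed

lemma comp_on_pred_nat [comp_intros]:
  assumes "comp_on D F" shows "comp_on D (\<lambda>p x. F p x - 1)"
proof -
  have "rec_nat 0 (\<lambda>k y. k) n = n - 1" for n by (cases n) auto
  moreover have "comp_on D (\<lambda>p x. rec_nat 0 (\<lambda>k y. k) (F p x))"
    by (intro comp_intros assms)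
  ultimately show ?thesis by simp
qed

lemma comp_on_add [comp_intros]:
  assumes "comp_on D F" "comp_on D G" shows "comp_on D (\<lambda>p x. F p x + G p x)"
proof -
  have "rec_nat m (\<lambda>k y. Suc y) n = m + n" for m n by (induction n) auto
  moreover have "comp_on D (\<lambda>p x. rec_nat (F p x) (\<lambda>k y. Suc y) (G p x))"
    by (intro comp_intros assms)
  ultimately show ?thesis by simp
qed

lemma comp_on_diff [comp_intros]:
  assumes "comp_on D F" "comp_on D G" shows "comp_on D (\<lambda>p x. F p x - G p x)"
proof -
  have "rec_nat m (\<lambda>k y. y - 1) n = m - n" for m n :: nat by (induction n) auto
  moreover have "comp_on D (\<lambda>p x. rec_nat (F p x) (\<lambda>k y. y - 1) (G p x))"
    by (intro comp_intros assms)
  ultimately show ?thesis by simp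
qed

lemma comp_on_mult [comp_intros]:
  assumes "comp_on D F" "comp_on D G" shows "comp_on D (\<lambda>p x. F p x * G p x)"
proof -
  have "rec_nat 0 (\<lambda>k y. m + y) n = m * n" for m n :: nat by (induction n) auto
  moreover have "comp_on D (\<lambda>p x. rec_nat 0 (\<lambda>k y. F p x + y) (G p x))"
    by (intro comp_on_rec comp_on_const comp_on_add comp_on_snd comp_on_id assms(2)
        comp_on_comp[OF assms(1), of "\<lambda>p z. fst (prod_decode z)"] comp_on_fst)
  ultimately show ?thesis by simp
qed

lemma comp_pred_not [comp_intros]: "comp_pred D Q \<Longrightarrow> comp_pred D (\<lambda>p x. \<not> Q p x)"
  by (rule comp_on_cong[OF comp_on_diff[OF comp_on_const[of _ 1]]]) auto

lemma comp_pred_conj [comp_intros]: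
  "comp_pred D Q \<Longrightarrow> comp_pred D R \<Longrightarrow> comp_pred D (\<lambda>p x. Q p x \<and> R p x)"
  by (rule comp_on_cong[OF comp_on_mult[of _ "\<lambda>p x. of_bool (Q p x)" "\<lambda>p x. of_bool (R p x)"]]) auto

lemma comp_pred_disj [comp_intros]:
  assumes "comp_pred D Q" "comp_pred D R" shows "comp_pred D (\<lambda>p x. Q p x \<or> R p x)"
  using comp_pred_not[OF comp_pred_conj[OF comp_pred_not comp_pred_not, OF assms]] by simp

lemma comp_pred_imp [comp_intros]:
  assumes "comp_pred D Q" "comp_pred D R" shows "comp_pred D (\<lambda>p x. Q p x \<longrightarrow> R p x)"
  using comp_pred_disj[OF comp_pred_not, OF assms] by (simp only: imp_conv_disj)

lemma comp_pred_le [comp_intros]: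
  assumes "comp_on D F" "comp_on D G" shows "comp_pred D (\<lambda>p x. F p x \<le> G p x)"
  by (rule comp_on_cong[OF comp_on_diff[OF comp_on_const[of _ 1] comp_on_diff[OF assms]]]) auto

lemma comp_pred_less [comp_intros]:
  assumes "comp_on D F" "comp_on D G" shows "comp_pred D (\<lambda>p x. F p x < G p x)"
  using comp_pred_not[OF comp_pred_le[OF assms(2,1)]] by (simp add: not_le)

lemma comp_pred_eq [comp_intros]:
  assumes "comp_on D F" "comp_on D G" shows "comp_pred D (\<lambda>p x. F p x = G p x)"
  using comp_pred_conj[OF comp_pred_le[OF assms] comp_pred_le[OF assms(2,1)]]
  by (simp add: eq_iff)

lemma comp_on_if [comp_intros]:
  assumes "comp_pred D Q" "comp_on D F" "comp_on D G"
  shows "comp_on D (\<lambda>p x. if Q p x then F p x else G p x)"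
  by (rule comp_on_cong[OF comp_on_add[OF comp_on_mult[OF assms(1,2)]
        comp_on_mult[OF comp_pred_not[OF assms(1)] assms(3)]]]) auto

lemma comp_pred_bex [comp_intros]:
  assumes "comp_pred D (\<lambda>p z. Q p (fst (prod_decode z)) (snd (prod_decode z)))" "comp_on D N"
  shows "comp_pred D (\<lambda>p x. \<exists>k<N p x. Q p x k)"
proof -
  \<comment> \<open>The accumulator is a flag that stays 1 once a witness has been met.\<close>
  have "comp_on D (\<lambda>p x. rec_nat 0 (\<lambda>k y. of_bool (y = 1 \<or> Q p x k)) (N p x))"
    by (intro comp_on_rec comp_pred_disj comp_pred_eq comp_on_snd comp_on_id comp_on_const assms(2)
        comp_on_comp[OF assms(1), where F = "\<lambda>p z. prod_encode (fst (prod_decode z),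
          fst (prod_decode (snd (prod_decode z))))", simplified] comp_on_pair comp_on_fst)
  moreover have "rec_nat 0 (\<lambda>k y. of_bool (y = 1 \<or> Q p x k)) n = (of_bool (\<exists>k<n. Q p x k) :: nat)"
    for p x n by (induction n) (auto simp: less_Suc_eq)
  ultimately show ?thesis by simp
qed

lemma comp_pred_ball [comp_intros]:
  assumes "comp_pred D (\<lambda>p z. Q p (fst (prod_decode z)) (snd (prod_decode z)))" "comp_on D N"
  shows "comp_pred D (\<lambda>p x. \<forall>k<N p x. Q p x k)"
  using comp_pred_not[OF comp_pred_bex[OF comp_pred_not[OF assms(1)] assms(2)]] by simp

lemma comp_on_Least [comp_intros]:
  assumes "comp_pred D (\<lambda>p z. Q p (fst (prod_decode z)) (snd (prod_decode z)))"
    and ex: "\<And>p x. p \<in> D \<Longrightarrow> \<exists>k. Q p x k"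
  shows "comp_on D (\<lambda>p x. LEAST k. Q p x k)"
proof -
  \<comment> \<open>\<open>PMu\<close> searches for a zero, hence the negated predicate.\<close>
  from comp_pred_not[OF assms(1)] obtain P where
    P: "\<forall>p\<in>D. \<forall>z. run P p z = Some (of_bool (\<not> Q p (fst (prod_decode z)) (snd (prod_decode z))))"
    unfolding comp_on_def by blast
  show ?thesis
    by (rule comp_onI[of _ "PMu P"]) (use P ex in simp)
qed

lemma comp_pred_even [comp_intros]:
  assumes "comp_on D F" shows "comp_pred D (\<lambda>p x. even (F p x))"
proof -
  have "rec_nat 1 (\<lambda>k y. 1 - y) n = (of_bool (even n) :: nat)" for n by (induction n) auto
  moreover have "comp_on D (\<lambda>p x. rec_nat 1 (\<lambda>k y. 1 - y) (F p x))"
    by (intro comp_intros assms)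
  ultimately show ?thesis by simp
qed

lemma comp_on_div2 [comp_intros]:
  assumes "comp_on D F" shows "comp_on D (\<lambda>p x. F p x div 2)"
proof -
  have "rec_nat 0 (\<lambda>k y. if even k then y else Suc y) n = n div 2" for n by (induction n) auto
  moreover have "comp_on D (\<lambda>p x. rec_nat 0 (\<lambda>k y. if even k then y else Suc y) (F p x))"
    by (intro comp_intros assms)
  ultimately show ?thesis by simp
qed

lemma comp_on_oracle_subst:
  assumes "comp_on D' F" "comp_on D A" "\<And>p. p \<in> D \<Longrightarrow> A p \<in> D'"
  shows "comp_on D (\<lambda>p. F (A p))"
proof -
  from assms obtain P Q where "\<forall>p\<in>D'. \<forall>x. run P p x = Some (F p x)"
    "\<forall>p\<in>D. \<forall>x. run Q p x = Some (A p x)" by (auto simp: comp_on_def)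
  with assms(3) show ?thesis
    by (intro comp_onI[of _ "oracle_subst Q P"]) (simp add: run_oracle_subst[where q = "A _"])
qed

lemma comp_on_continuous:
  assumes "comp_on D F" "p \<in> D"
  shows "\<exists>m. \<forall>q\<in>D. agree m p q \<longrightarrow> agree n (F p) (F q)"
proof -
  from assms obtain P where P: "\<forall>p\<in>D. \<forall>x. run P p x = Some (F p x)" by (auto simp: comp_on_def)
  have "\<exists>m. \<forall>q. agree m p q \<longrightarrow> (\<forall>x<n. run P q x = Some (F p x))"
    by (rule eventually_agree_all) (rule run_use, use P assms(2) in blast)
  then obtain m where "\<And>q x. agree m p q \<Longrightarrow> x < n \<Longrightarrow> run P q x = Some (F p x)" by blast
  then have "agree n (F p) (F q)" if "q \<in> D" "agree m p q" for q
    using that P assms(2) unfolding agree_def[of n] by (metis option.inject)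
  then show ?thesis by blast
qed

section \<open>Weihrauch reducibility\<close>

definition left :: "baire \<Rightarrow> baire" where "left p n = p (2 * n)"

definition right :: "baire \<Rightarrow> baire" where "right p n = p (2 * n + 1)"

lemma left_join [simp]: "left (join f g) = f"
  by (simp add: left_def join_def fun_eq_iff)

lemma right_join [simp]: "right (join f g) = g"
  by (simp add: right_def join_def fun_eq_iff)

lemma join_even [simp]: "join f g (2 * n) = f n"
  by (simp add: join_def)

lemma join_odd [simp]: "join f g (Suc (2 * n)) = g n"
  by (simp add: join_def)

lemma agree_join: "agree n f f' \<Longrightarrow> agree n g g' \<Longrightarrow> agree n (join f g) (join f' g')"
  by (auto simp: agree_def join_def)

lemma comp_on_left: "comp_on D left" and comp_on_right: "comp_on D right"
  unfolding left_def right_def by (intro comp_intros)+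

lemma comp_on_join:
  assumes "comp_on D F" "comp_on D G" shows "comp_on D (\<lambda>p. join (F p) (G p))"
  unfolding join_def
  by (intro comp_on_if comp_pred_even comp_on_id comp_on_comp[OF assms(1)] comp_on_comp[OF assms(2)]
      comp_on_div2)

text \<open>Makes the two maps explicit as total functions. The backward map has to behave only on
  joins of an instance with a solution of its image; this set is the promise domain in its
  computability.\<close>

definition reduction :: "problem \<Rightarrow> problem \<Rightarrow> (baire \<Rightarrow> baire) \<Rightarrow> (baire \<Rightarrow> baire) \<Rightarrow> bool" where
  "reduction F G \<Phi> \<Psi> \<longleftrightarrow>
     comp_on (insts F) \<Phi> \<and>
     comp_on {join f g | f g. f \<in> insts F \<and> g \<in> sols G (\<Phi> f)} \<Psi> \<and>
     (\<forall>f\<in>insts F. \<Phi> f \<in> insts G \<and> (\<forall>g\<in>sols G (\<Phi> f). \<Psi> (join f g) \<in> sols F f))"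

lemma weihrauch_le_iff: "F \<le>\<^sub>W G \<longleftrightarrow> (\<exists>\<Phi> \<Psi>. reduction F G \<Phi> \<Psi>)"
proof
  assume "F \<le>\<^sub>W G"
  then obtain a b where ab: "\<And>f. f \<in> insts F \<Longrightarrow> \<exists>h\<in>insts G. functional_value a f h \<and>
        (\<forall>g\<in>sols G h. \<exists>k\<in>sols F f. functional_value b (join f g) k)"
    unfolding weihrauch_le_def by blast
  have the: "(\<lambda>n. the (Phi e p n)) = q" if "functional_value e p q" for e p q
    using that by (simp add: functional_value_def)
  define \<Phi> where "\<Phi> p = (\<lambda>n. the (Phi a p n))" for p
  define \<Psi> where "\<Psi> p = (\<lambda>n. the (Phi b p n))" for p
  have 1: "\<Phi> f \<in> insts G \<and> functional_value a f (\<Phi> f)" if f: "f \<in> insts F" for f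
    using ab[OF f] the by (auto simp: \<Phi>_def)
  have 2: "\<Psi> (join f g) \<in> sols F f \<and> functional_value b (join f g) (\<Psi> (join f g))"
    if f: "f \<in> insts F" and g: "g \<in> sols G (\<Phi> f)" for f g
  proof -
    from ab[OF f] obtain h where h: "functional_value a f h" and
      "\<forall>g\<in>sols G h. \<exists>k\<in>sols F f. functional_value b (join f g) k" by blast
    moreover have "h = \<Phi> f" using the[OF h] by (simp add: \<Phi>_def)
    ultimately show ?thesis using g the by (auto simp: \<Psi>_def)
  qed
  have "comp_on (insts F) \<Phi>"
    by (rule comp_onI[of _ "prog_of a"]) (use 1 in \<open>simp add: functional_value_def Phi_def\<close>)
  moreover have "comp_on {join f g | f g. f \<in> insts F \<and> g \<in> sols G (\<Phi> f)} \<Psi>"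
    by (rule comp_onI[of _ "prog_of b"]) (use 2 in \<open>auto simp: functional_value_def Phi_def\<close>)
  ultimately have "reduction F G \<Phi> \<Psi>"
    unfolding reduction_def using 1 2 by blast
  then show "\<exists>\<Phi> \<Psi>. reduction F G \<Phi> \<Psi>" by blast
next
  assume "\<exists>\<Phi> \<Psi>. reduction F G \<Phi> \<Psi>"
  then obtain \<Phi> \<Psi> where red: "reduction F G \<Phi> \<Psi>" by blast
  then have "comp_on (insts F) \<Phi>"
    "comp_on {join f g | f g. f \<in> insts F \<and> g \<in> sols G (\<Phi> f)} \<Psi>"
    by (simp_all add: reduction_def)
  then obtain P Q where
    P: "\<forall>f\<in>insts F. \<forall>x. run P f x = Some (\<Phi> f x)" and
    Q: "\<forall>p\<in>{join f g | f g. f \<in> insts F \<and> g \<in> sols G (\<Phi> f)}. \<forall>x. run Q p x = Some (\<Psi> p x)"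
    unfolding comp_on_def by (elim exE)
  obtain a b where ab: "prog_of a = P" "prog_of b = Q" using surj_prog_of by (metis surjD)
  have "\<exists>h\<in>insts G. functional_value a f h \<and>
      (\<forall>g\<in>sols G h. \<exists>k\<in>sols F f. functional_value b (join f g) k)" if f: "f \<in> insts F" for f
  proof (intro bexI conjI ballI)
    show "functional_value a f (\<Phi> f)"
      using P f by (simp add: functional_value_def Phi_def ab)
    show "\<Phi> f \<in> insts G" using red f by (simp add: reduction_def)
    fix g assume g: "g \<in> sols G (\<Phi> f)"
    then have "join f g \<in> {join f g | f g. f \<in> insts F \<and> g \<in> sols G (\<Phi> f)}" using f by blast
    with Q show "functional_value b (join f g) (\<Psi> (join f g))"
      by (simp add: functional_value_def Phi_def ab)
    show "\<Psi> (join f g) \<in> sols F f" using red f g by (simp add: reduction_def)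
  qed
  then show "F \<le>\<^sub>W G" unfolding weihrauch_le_def by blast
qed

lemma weihrauch_leI:
  assumes "comp_on (insts F) \<Phi>"
    and "\<And>f. f \<in> insts F \<Longrightarrow> \<Phi> f \<in> insts G"
    and "comp_on {join f g | f g. f \<in> insts F \<and> g \<in> sols G (\<Phi> f)} \<Psi>"
    and "\<And>f g. f \<in> insts F \<Longrightarrow> g \<in> sols G (\<Phi> f) \<Longrightarrow> \<Psi> (join f g) \<in> sols F f"
  shows "F \<le>\<^sub>W G"
proof -
  have "reduction F G \<Phi> \<Psi>" using assms(2,4) unfolding reduction_def by (auto intro: assms(1,3))
  then show ?thesis unfolding weihrauch_le_iff by blast
qed

lemma weihrauch_le_trans:
  assumes "F \<le>\<^sub>W G" "G \<le>\<^sub>W H" shows "F \<le>\<^sub>W H"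
proof -
  from assms obtain \<Phi> \<Psi> \<Phi>' \<Psi>' where r: "reduction F G \<Phi> \<Psi>" and r': "reduction G H \<Phi>' \<Psi>'"
    unfolding weihrauch_le_iff by blast
  let ?D = "{join f g | f g. f \<in> insts F \<and> g \<in> sols H (\<Phi>' (\<Phi> f))}"
  have 1: "comp_on (insts F) (\<lambda>f. \<Phi>' (\<Phi> f))"
    by (rule comp_on_oracle_subst[where F = \<Phi>' and A = \<Phi>, of "insts G"])
      (use r r' in \<open>auto simp: reduction_def\<close>)
  \<comment> \<open>The backward map for the composite sees only the instance of \<open>F\<close>
    and the solution for \<open>H\<close>, so it must recompute the intermediate instance of
    \<open>G\<close>.\<close>
  have left: "comp_on ?D (\<lambda>p. \<Phi> (left p))"
    by (rule comp_on_oracle_subst[where F = \<Phi> and A = left, OF _ comp_on_left, of "insts F"])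
      (use r in \<open>auto simp: reduction_def\<close>)
  have 2: "comp_on ?D (\<lambda>p. \<Psi>' (join (\<Phi> (left p)) (right p)))"
    by (rule comp_on_oracle_subst[where F = \<Psi>' and A = "\<lambda>p. join (\<Phi> (left p)) (right p)",
          OF _ comp_on_join[OF left comp_on_right],
          of "{join f g | f g. f \<in> insts G \<and> g \<in> sols H (\<Phi>' f)}"])
      (use r r' in \<open>auto simp: reduction_def join_eq_iff\<close>)
  have 3: "comp_on ?D (\<lambda>p. \<Psi> (join (left p) (\<Psi>' (join (\<Phi> (left p)) (right p)))))"
    by (rule comp_on_oracle_subst[where F = \<Psi> and
          A = "\<lambda>p. join (left p) (\<Psi>' (join (\<Phi> (left p)) (right p)))",
          OF _ comp_on_join[OF comp_on_left 2],
          of "{join f g | f g. f \<in> insts F \<and> g \<in> sols G (\<Phi> f)}"])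
      (use r r' in \<open>auto simp: reduction_def join_eq_iff\<close>)
  show ?thesis
  proof (rule weihrauch_leI[OF 1 _ 3])
    fix f assume f: "f \<in> insts F"
    then have "\<Phi> f \<in> insts G" using r by (simp add: reduction_def)
    then show "\<Phi>' (\<Phi> f) \<in> insts H" using r' by (simp add: reduction_def)
    fix g assume "g \<in> sols H (\<Phi>' (\<Phi> f))"
    with \<open>\<Phi> f \<in> insts G\<close> have "\<Psi>' (join (\<Phi> f) g) \<in> sols G (\<Phi> f)"
      using r' by (simp add: reduction_def)
    with f show "\<Psi> (join (left (join f g)) (\<Psi>' (join (\<Phi> (left (join f g))) (right (join f g)))))
        \<in> sols F f"
      using r by (simp add: reduction_def)
  qed
qed

text \<open>The identity and the projection to the solution witness this: more instances and fewer
  solutions make a problem harder.\<close>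

lemma weihrauch_le_mono:
  assumes "insts F' \<subseteq> insts F" "\<And>f. f \<in> insts F' \<Longrightarrow> sols F f \<subseteq> sols F' f"
  shows "F' \<le>\<^sub>W F"
proof (rule weihrauch_leI[where \<Phi> = "\<lambda>p. p" and \<Psi> = right])
  show "comp_on (insts F') (\<lambda>p. p)" by (rule comp_onI[of _ POracle]) simp
qed (use assms in \<open>auto intro: comp_on_right\<close>)

lemma reduction_continuous_inst:
  assumes r: "reduction F G \<Phi> \<Psi>" and p: "p \<in> insts F"
  shows "\<exists>m. \<forall>q\<in>insts F. agree m p q \<longrightarrow> agree n (\<Phi> p) (\<Phi> q)"
  using r p by (intro comp_on_continuous) (auto simp: reduction_def)

text \<open>Instance and solution may be varied at the same time beyond \<open>m\<close>. All later
  contradictions arise in this way: the output keeps an initial segment that the new instance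
  forbids.\<close>

lemma reduction_continuous_sol:
  assumes r: "reduction F G \<Phi> \<Psi>" and p: "p \<in> insts F" and g: "g \<in> sols G (\<Phi> p)"
  shows "\<exists>m. \<forall>q\<in>insts F. \<forall>g'\<in>sols G (\<Phi> q). agree m p q \<longrightarrow> agree m g g' \<longrightarrow>
    agree n (\<Psi> (join p g)) (\<Psi> (join q g'))"
proof -
  define D where "D = {join f g | f g. f \<in> insts F \<and> g \<in> sols G (\<Phi> f)}"
  have "\<exists>m. \<forall>q\<in>D. agree m (join p g) q \<longrightarrow> agree n (\<Psi> (join p g)) (\<Psi> q)"
    using r p g by (intro comp_on_continuous) (auto simp: reduction_def D_def)
  then obtain m where m: "\<forall>q\<in>D. agree m (join p g) q \<longrightarrow> agree n (\<Psi> (join p g)) (\<Psi> q)" ..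
  show ?thesis
  proof (intro exI[of _ m] ballI impI)
    fix q g' assume q: "q \<in> insts F" "g' \<in> sols G (\<Phi> q)" and "agree m p q" "agree m g g'"
    then have "agree m (join p g) (join q g')" by (simp add: agree_join)
    moreover have "join q g' \<in> D" using q by (auto simp: D_def)
    ultimately show "agree n (\<Psi> (join p g)) (\<Psi> (join q g'))" using m by blast
  qed
qed

section \<open>Solutions of graphs\<close>

definition rsgr_sol :: "nat set \<Rightarrow> nat set set \<Rightarrow> nat set \<Rightarrow> bool" where
  "rsgr_sol V E H \<longleftrightarrow> H \<subseteq> V \<and> infinite H \<and> (\<forall>v\<in>H. infinite (H \<inter> nbh E v) \<or> H \<inter> nbh E v = {})"

definition clique :: "nat set set \<Rightarrow> nat set \<Rightarrow> bool" where
  "clique E C \<longleftrightarrow> (\<forall>x\<in>C. \<forall>y\<in>C. x \<noteq> y \<longrightarrow> {x, y} \<in> E)"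

definition indep :: "nat set set \<Rightarrow> nat set \<Rightarrow> bool" where
  "indep E C \<longleftrightarrow> (\<forall>x\<in>C. \<forall>y\<in>C. {x, y} \<notin> E)"

lemma clique_subset: "clique E C \<Longrightarrow> C' \<subseteq> C \<Longrightarrow> clique E C'"
  by (auto simp: clique_def)

lemma indep_subset: "indep E C \<Longrightarrow> C' \<subseteq> C \<Longrightarrow> indep E C'"
  by (auto simp: indep_def)

lemma edge_neq: "E \<subseteq> nsets V 2 \<Longrightarrow> {x, y} \<in> E \<Longrightarrow> x \<noteq> y"
  by (auto simp: nsets_def)

lemma infinite_Diff_lessThan: "infinite (A :: nat set) \<Longrightarrow> infinite (A - {..<u})"
  by simp

text \<open>Ramsey's theorem for pairs inside \<open>W\<close>. All special solutions built below
  are made of cliques, independent sets and a finite piece.\<close>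

lemma infinite_clique_or_indep:
  assumes E: "E \<subseteq> nsets V 2" and W: "infinite W"
  obtains C where "C \<subseteq> W" "infinite C" "clique E C \<or> indep E C"
proof -
  have "\<exists>Y t. Y \<subseteq> W \<and> infinite Y \<and> t < 2 \<and>
      (\<forall>x\<in>Y. \<forall>y\<in>Y. x \<noteq> y \<longrightarrow> (of_bool ({x, y} \<in> E) :: nat) = t)"
    by (rule Ramsey2[OF W]) auto
  then obtain Y and t :: nat where Y: "Y \<subseteq> W" "infinite Y" "t < 2"
    "\<And>x y. x \<in> Y \<Longrightarrow> y \<in> Y \<Longrightarrow> x \<noteq> y \<Longrightarrow> of_bool ({x, y} \<in> E) = t" by blast
  show ?thesis
  proof (cases "t = 0")
    case True
    then have "indep E Y" using Y(4) edge_neq[OF E] by (fastforce simp: indep_def)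
    with Y that show ?thesis by blast
  next
    case False
    then have "clique E Y" using Y(3,4) by (fastforce simp: clique_def)
    with Y that show ?thesis by blast
  qed
qed

lemma rsgr_sol_indep: "H \<subseteq> V \<Longrightarrow> infinite H \<Longrightarrow> indep E H \<Longrightarrow> rsgr_sol V E H"
  by (auto simp: rsgr_sol_def indep_def nbh_def)

lemma infinite_clique_nbh:
  assumes "clique E C" "infinite C" "v \<in> C" shows "infinite (C \<inter> nbh E v)"
proof -
  have "C - {v} \<subseteq> C \<inter> nbh E v" using assms by (auto simp: clique_def nbh_def)
  moreover have "infinite (C - {v})" using assms(2) by simp
  ultimately show ?thesis using finite_subset by blast
qed

lemma rsgr_sol_clique: "H \<subseteq> V \<Longrightarrow> infinite H \<Longrightarrow> clique E H \<Longrightarrow> rsgr_sol V E H"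
  by (simp add: rsgr_sol_def infinite_clique_nbh)

text \<open>Vertices of \<open>F\<close> with finite degree into \<open>C\<close> end up isolated,
  because \<open>F\<close> is independent and their neighbours in \<open>C\<close> are removed. All
  other vertices keep infinitely many neighbours, because only finitely much of \<open>C\<close> is
  removed.\<close>

lemma extend_by_clique:
  assumes E: "E \<subseteq> nsets V 2" and F: "F \<subseteq> V" "indep E F" "F \<subseteq> {..<u}"
    and C: "C \<subseteq> V" "infinite C" "clique E C"
  shows "\<exists>H. rsgr_sol V E H \<and> H \<inter> {..<u} = F"
proof -
  define B where "B = {v \<in> F. finite (C \<inter> nbh E v)}"
  define C' where "C' = C - {..<u} - (\<Union>v\<in>B. C \<inter> nbh E v)"
  have "finite F" using F(3) finite_subset by blast
  then have fin: "finite (\<Union>v\<in>B. C \<inter> nbh E v)" by (intro finite_UN_I) (auto simp: B_def)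
  then have inf: "infinite C'" using C(2) by (simp add: C'_def)
  have C': "C' \<subseteq> C" "C' \<inter> {..<u} = {}" by (auto simp: C'_def)
  have "infinite ((F \<union> C') \<inter> nbh E v)" if "v \<in> C'" for v
    using infinite_clique_nbh[OF clique_subset[OF C(3) C'(1)] inf that]
    by (rule contrapos_nn) (erule finite_subset[rotated], blast)
  moreover have "(F \<union> C') \<inter> nbh E v = {}" if "v \<in> B" for v
    using that F(2) by (auto simp: B_def C'_def indep_def nbh_def)
  moreover have "infinite ((F \<union> C') \<inter> nbh E v)" if "v \<in> F - B" for v
  proof
    assume "finite ((F \<union> C') \<inter> nbh E v)"
    then have "finite ((F \<union> C') \<inter> nbh E v \<union> {..<u} \<union> (\<Union>v\<in>B. C \<inter> nbh E v))" using fin by simp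
    moreover have "C \<inter> nbh E v \<subseteq> (F \<union> C') \<inter> nbh E v \<union> {..<u} \<union> (\<Union>v\<in>B. C \<inter> nbh E v)"
      by (auto simp: C'_def)
    ultimately show False using that finite_subset by (auto simp: B_def)
  qed
  ultimately have "rsgr_sol V E (F \<union> C')"
    using F(1) C(1) C'(1) inf unfolding rsgr_sol_def by blast
  moreover have "(F \<union> C') \<inter> {..<u} = F" using F(3) C'(2) by blast
  ultimately show ?thesis by blast
qed

text \<open>Without infinite independent sets, Ramsey's theorem gives a clique in every infinite set
  of vertices. Adding one inside the neighbourhood of each element of \<open>F\<close> gives every
  vertex of the union infinite degree.\<close>

lemma extend_by_nbh_cliques:
  assumes E: "E \<subseteq> nsets V 2" and F: "F \<subseteq> V" "F \<subseteq> {..<u}"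
    and inf: "\<And>v. v \<in> F \<Longrightarrow> infinite (nbh E v)"
    and no_indep: "\<And>C. C \<subseteq> V \<Longrightarrow> infinite C \<Longrightarrow> \<not> indep E C"
    and V: "infinite V"
  shows "\<exists>H. rsgr_sol V E H \<and> H \<inter> {..<u} = F"
proof -
  have nbh_V: "nbh E v \<subseteq> V" for v using E by (auto simp: nbh_def nsets_def)
  have ex: "\<exists>C. C \<subseteq> W - {..<u} \<and> infinite C \<and> clique E C" if W: "W \<subseteq> V" "infinite W" for W
  proof -
    obtain C where C: "C \<subseteq> W - {..<u}" "infinite C" "clique E C \<or> indep E C"
      using infinite_clique_or_indep[OF E infinite_Diff_lessThan[OF W(2)]] .
    then show ?thesis using no_indep[of C] W(1) by blast
  qed
  \<comment> \<open>This clique makes the solution infinite even if \<open>F\<close> is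
    empty.\<close>
  obtain C0 where C0: "C0 \<subseteq> V - {..<u}" "infinite C0" "clique E C0" using ex[OF order.refl V] by blast
  have "\<forall>v\<in>F. \<exists>C. C \<subseteq> nbh E v - {..<u} \<and> infinite C \<and> clique E C" using ex nbh_V inf by blast
  then obtain C where C: "\<And>v. v \<in> F \<Longrightarrow> C v \<subseteq> nbh E v - {..<u} \<and> infinite (C v) \<and> clique E (C v)"
    by metis
  define H where "H = F \<union> C0 \<union> (\<Union>v\<in>F. C v)"
  have sub: "infinite (H \<inter> nbh E w)" if "infinite (D \<inter> nbh E w)" "D \<subseteq> H" for D w
    using that by (meson Int_mono finite_subset order.refl)
  have "infinite (H \<inter> nbh E w)" if w: "w \<in> H" for w
  proof -
    consider "w \<in> F" | "w \<in> C0" | v where "v \<in> F" "w \<in> C v" using w by (auto simp: H_def)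
    then show ?thesis
    proof cases
      case 1
      then have "C w \<inter> nbh E w = C w" using C by blast
      then show ?thesis using 1 C by (intro sub[of "C w"]) (auto simp: H_def)
    next
      case 2
      then show ?thesis by (intro sub[of C0] infinite_clique_nbh C0) (auto simp: H_def)
    next
      case 3
      then show ?thesis using C by (intro sub[of "C v"] infinite_clique_nbh) (auto simp: H_def)
    qed
  qed
  moreover have "H \<subseteq> V" using F(1) C0 C nbh_V by (fastforce simp: H_def)
  moreover have "infinite H" using C0 by (simp add: H_def)
  ultimately have "rsgr_sol V E H" by (simp add: rsgr_sol_def)
  moreover have "H \<inter> {..<u} = F" using F(2) C0 C by (fastforce simp: H_def)
  ultimately show ?thesis by blast
qed

section \<open>Banned pieces and the forcing argument\<close>

definition banned :: "nat set \<Rightarrow> nat set set \<Rightarrow> nat \<Rightarrow> nat set \<Rightarrow> bool" where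
  "banned V E u F \<longleftrightarrow> F \<subseteq> V \<and> F \<subseteq> {..<u} \<and> (\<forall>H. rsgr_sol V E H \<longrightarrow> H \<inter> {..<u} \<noteq> F)"

lemma banned_mono: "banned V E u F \<Longrightarrow> u \<le> u' \<Longrightarrow> banned V E u' F"
  unfolding banned_def
proof (intro conjI allI impI notI, blast)
  assume *: "F \<subseteq> V \<and> F \<subseteq> {..<u} \<and> (\<forall>H. rsgr_sol V E H \<longrightarrow> H \<inter> {..<u} \<noteq> F)" "u \<le> u'"
  then show "F \<subseteq> {..<u'}" by auto
  fix H assume H: "rsgr_sol V E H" "H \<inter> {..<u'} = F"
  then have "H \<inter> {..<u} = F" using * by auto
  then show False using * H by blast
qed

text \<open>If every vertex of a banned independent \<open>F\<close> had only finitely many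
  neighbours in \<open>J\<close>, then \<open>F\<close> together with almost all of \<open>J\<close>
  would be an infinite independent set starting with \<open>F\<close>, against the ban. So some
  vertex of \<open>F\<close> is joined to infinitely many elements of \<open>J\<close>; restrict
  \<open>J\<close> to these and treat the next member of the family.\<close>

lemma thin_indep:
  assumes E: "E \<subseteq> nsets V 2" and I: "I \<subseteq> V" "infinite I" "indep E I"
    and "finite \<F>" "\<And>F. F \<in> \<F> \<Longrightarrow> banned V E u F \<and> indep E F"
  shows "\<exists>J\<subseteq>I. infinite J \<and> (\<forall>F\<in>\<F>. \<exists>v\<in>F. J \<subseteq> nbh E v)"
  using assms(5,6)
proof (induction \<F> rule: finite_induct)
  case empty
  then show ?case using I by auto
next
  case (insert F \<F>)
  then obtain J where J: "J \<subseteq> I" "infinite J" "\<forall>F\<in>\<F>. \<exists>v\<in>F. J \<subseteq> nbh E v" by auto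
  have F: "F \<subseteq> V" "F \<subseteq> {..<u}" "indep E F" "\<And>H. rsgr_sol V E H \<Longrightarrow> H \<inter> {..<u} \<noteq> F"
    using insert.prems by (auto simp: banned_def)
  have "\<exists>v\<in>F. infinite (J \<inter> nbh E v)"
  proof (rule ccontr)
    assume neg: "\<not> ?thesis"
    define J' where "J' = J - {..<u} - (\<Union>v\<in>F. J \<inter> nbh E v)"
    have "finite F" using F(2) finite_subset by blast
    then have "finite (\<Union>v\<in>F. J \<inter> nbh E v)" using neg by (intro finite_UN_I) auto
    then have "infinite J'" using J(2) by (simp add: J'_def)
    moreover have "J' \<subseteq> V" using J(1) I(1) by (auto simp: J'_def)
    moreover have "{x, y} \<notin> E" "{y, x} \<notin> E" if "x \<in> F" "y \<in> J'" for x y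
      using that by (auto simp: J'_def nbh_def insert_commute)
    moreover have "indep E J'" using J(1) by (intro indep_subset[OF I(3)]) (auto simp: J'_def)
    ultimately have "J' \<subseteq> V" "infinite J'" "indep E (F \<union> J')" using F(3) by (auto simp: indep_def)
    then have "rsgr_sol V E (F \<union> J')" using F(1) by (intro rsgr_sol_indep) auto
    moreover have "(F \<union> J') \<inter> {..<u} = F" using F(2) by (auto simp: J'_def)
    ultimately show False using F(4) by blast
  qed
  then obtain v where v: "v \<in> F" "infinite (J \<inter> nbh E v)" by blast
  have "\<exists>w\<in>F'. J \<inter> nbh E v \<subseteq> nbh E w" if F': "F' \<in> insert F \<F>" for F'
  proof (cases "F' = F")
    case False
    then obtain w where "w \<in> F'" "J \<subseteq> nbh E w" using J(3) F' by blast
    then show ?thesis by blast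
  qed (use v in blast)
  moreover have "J \<inter> nbh E v \<subseteq> I" using J(1) by blast
  ultimately show ?case using v(2) by blast
qed

text \<open>The vertex of block \<open>i\<close> joined to all of block \<open>j\<close> depends on
  \<open>j\<close>. Since blocks are finite, one vertex serves infinitely many \<open>j\<close>;
  repeating this inside the surviving indices, as in proofs of Ramsey's theorem, yields the
  clique.\<close>

lemma clique_from_blocks:
  fixes F :: "nat \<Rightarrow> nat set"
  assumes E: "E \<subseteq> nsets V 2" and fin: "\<And>i. finite (F i)"
    and edges: "\<And>i j. i < j \<Longrightarrow> \<exists>v\<in>F i. \<forall>w\<in>F j. {v, w} \<in> E"
  shows "\<exists>C. C \<subseteq> (\<Union>i. F i) \<and> infinite C \<and> clique E C"
proof -
  obtain v where v: "\<And>i j. i < j \<Longrightarrow> v i j \<in> F i \<and> (\<forall>w\<in>F j. {v i j, w} \<in> E)"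
    using edges by metis
  \<comment> \<open>State of the construction: the vertex \<open>x\<close> chosen last is joined to
    all vertices of the blocks with index in the infinite reservoir \<open>J\<close>.\<close>
  let ?P = "\<lambda>(J :: nat set, x). infinite J \<and> (\<forall>j\<in>J. \<forall>w\<in>F j. {x, w} \<in> E)"
  let ?Q = "\<lambda>(J :: nat set, x :: nat) (J', x'). J' \<subseteq> J \<and> (\<exists>j\<in>J. x' \<in> F j)"
  have step: "\<exists>J' x'. ?P (J', x') \<and> J' \<subseteq> J \<and> (\<exists>j\<in>J. x' \<in> F j)" if J: "infinite J" for J
  proof -
    obtain n where n: "n \<in> J" using J by fastforce
    have inf: "infinite (J - {..n})" using J by simp
    have vF: "v n j \<in> F n" if "j \<in> J - {..n}" for j using v[of n j] that by auto
    then have "v n ` (J - {..n}) \<subseteq> F n" by blast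
    then have "finite (v n ` (J - {..n}))" using fin finite_subset by blast
    then obtain j0 where j0: "j0 \<in> J - {..n}" "infinite {j \<in> J - {..n}. v n j = v n j0}"
      using pigeonhole_infinite[OF inf] by blast
    then have "?P ({j \<in> J - {..n}. v n j = v n j0}, v n j0)" using v[of n] by simp (metis not_le)
    moreover have "v n j0 \<in> F n" using vF j0 by blast
    ultimately show ?thesis using n by blast
  qed
  have "\<exists>f. \<forall>n. ?P (f n) \<and> ?Q (f n) (f (Suc n))"
  proof (rule dependent_nat_choice)
    show "\<exists>s. ?P s" using step[of UNIV] by auto
    show "\<exists>t. ?P t \<and> ?Q s t" if "?P s" for s
      using that step[of "fst s"] by (auto split: prod.splits)
  qed
  then obtain f where f: "\<forall>n. ?P (f n) \<and> ?Q (f n) (f (Suc n))" ..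
  define J where "J n = fst (f n)" for n
  define x where "x n = snd (f n)" for n
  have J: "\<And>n. infinite (J n)" "\<And>n j w. j \<in> J n \<Longrightarrow> w \<in> F j \<Longrightarrow> {x n, w} \<in> E"
    using f by (simp_all add: J_def x_def split_beta)
  have Q: "\<And>n. J (Suc n) \<subseteq> J n" "\<And>n. \<exists>j\<in>J n. x (Suc n) \<in> F j"
    using f by (simp_all add: J_def x_def split_beta)
  have mono: "J l \<subseteq> J k" if "k \<le> l" for k l
    using Q(1) that by (rule lift_Suc_antimono_le)
  have adj: "{x k, x l} \<in> E" if kl: "k < l" for k l
  proof -
    obtain m where m: "l = Suc m" using kl by (cases l) auto
    then obtain j where "j \<in> J m" "x l \<in> F j" using Q(2) by blast
    moreover have "J m \<subseteq> J k" using mono kl m by simp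
    ultimately show ?thesis using J(2) by blast
  qed
  then have adj': "{x k, x l} \<in> E" if "k \<noteq> l" for k l
    using that by (metis insert_commute linorder_neqE_nat)
  then have "inj x" using edge_neq[OF E] by (metis injI)
  \<comment> \<open>The sequence is shifted because \<open>?Q\<close> places only later vertices in
    blocks; it says nothing about \<open>x 0\<close>.\<close>
  let ?C = "range (\<lambda>n. x (Suc n))"
  have "inj (\<lambda>n. x (Suc n))" using \<open>inj x\<close> by (metis injD injI nat.inject)
  then have "infinite ?C" by (rule range_inj_infinite)
  moreover have "?C \<subseteq> (\<Union>i. F i)" using Q(2) by blast
  moreover have "clique E ?C" unfolding clique_def
  proof (intro ballI impI)
    fix a b assume ab: "a \<in> ?C" "b \<in> ?C" "a \<noteq> b"
    then obtain k l where kl: "a = x (Suc k)" "b = x (Suc l)" by blast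
    then have "Suc k \<noteq> Suc l" using ab(3) by auto
    then show "{a, b} \<in> E" unfolding kl by (rule adj')
  qed
  ultimately show ?thesis by blast
qed

text \<open>\<open>K n\<close> is the set of forcing conditions of rank at least \<open>n\<close>; a condition is identified with
  the set of instances that satisfy it.\<close>

locale banning_family =
  fixes K :: "nat \<Rightarrow> 'a set set" and V :: "'a \<Rightarrow> nat set" and E :: "'a \<Rightarrow> nat set set"
  assumes start: "K 0 \<noteq> {}"
    and antimono: "i \<le> j \<Longrightarrow> K j \<subseteq> K i"
    and nonempty: "X \<in> K 0 \<Longrightarrow> X \<noteq> {}"
    and chain: "(\<And>i. Z i \<in> K i) \<Longrightarrow> (\<And>i. Z (Suc i) \<subseteq> Z i) \<Longrightarrow> (\<Inter>i. Z i) \<noteq> {}"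
    and graph: "X \<in> K 0 \<Longrightarrow> p \<in> X \<Longrightarrow> infinite (V p) \<and> E p \<subseteq> nsets (V p) 2"
    and ban: "X \<in> K 0 \<Longrightarrow> p \<in> X \<Longrightarrow> rsgr_sol (V p) (E p) H \<Longrightarrow>
      \<exists>u\<ge>l. \<exists>Y\<in>K l. Y \<subseteq> X \<and> (\<forall>q\<in>Y. V q \<inter> {..<u} = V p \<inter> {..<u} \<and>
        (\<forall>x<u. \<forall>y<u. {x, y} \<in> E q \<longleftrightarrow> {x, y} \<in> E p) \<and>
        (\<forall>H'. rsgr_sol (V q) (E q) H' \<longrightarrow> H' \<inter> {..<u} \<noteq> H \<inter> {..<u}))"
begin

lemma K0: "X \<in> K i \<Longrightarrow> X \<in> K 0"
  using antimono[of 0 i] by blast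

text \<open>Asking for rank at least \<open>Suc u\<close> pushes the new bound \<open>u'\<close>
  above \<open>u\<close>. Since \<open>H\<close> has nothing below \<open>u\<close>, the banned
  piece lies in the fresh interval from \<open>u\<close> to \<open>u'\<close>, so pieces of
  successive bans are disjoint.\<close>

lemma ban_solution:
  assumes X: "X \<in> K 0" and p: "p \<in> X" and H: "rsgr_sol (V p) (E p) H" "H \<inter> {..<u} = {}"
  obtains u' Y F where "u < u'" "Y \<in> K l" "Y \<subseteq> X" "F \<subseteq> H" "F \<subseteq> {u..<u'}"
    "\<And>q. q \<in> Y \<Longrightarrow> banned (V q) (E q) u' F"
    "\<And>q x y. q \<in> Y \<Longrightarrow> x < u' \<Longrightarrow> y < u' \<Longrightarrow> {x, y} \<in> E q \<longleftrightarrow> {x, y} \<in> E p"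
proof -
  obtain u' Y where u': "u' \<ge> max l (Suc u)" and Y: "Y \<in> K (max l (Suc u))" "Y \<subseteq> X"
    and q: "\<And>q. q \<in> Y \<Longrightarrow> V q \<inter> {..<u'} = V p \<inter> {..<u'} \<and>
        (\<forall>x<u'. \<forall>y<u'. {x, y} \<in> E q \<longleftrightarrow> {x, y} \<in> E p) \<and>
        (\<forall>H'. rsgr_sol (V q) (E q) H' \<longrightarrow> H' \<inter> {..<u'} \<noteq> H \<inter> {..<u'})"
    using ban[OF X p H(1)] by meson
  show thesis
  proof (rule that[of u' Y "H \<inter> {..<u'}"])
    show "u < u'" using u' by simp
    show "Y \<in> K l" using Y(1) antimono[of l "max l (Suc u)"] by auto
    show "H \<inter> {..<u'} \<subseteq> {u..<u'}" using H(2) by auto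
    fix q' assume "q' \<in> Y"
    from q[OF this] H(1) show "banned (V q') (E q') u' (H \<inter> {..<u'})"
      by (auto simp: banned_def rsgr_sol_def)
  qed (use Y q in blast)+
qed

lemma dense_indep:
  assumes X: "X \<in> K 0"
  shows "\<exists>p\<in>X. \<exists>I\<subseteq>V p. infinite I \<and> indep (E p) I"
proof (rule ccontr)
  assume neg: "\<not> ?thesis"
  have no_indep: "\<not> indep (E q) C" if "q \<in> X" "C \<subseteq> V q" "infinite C" for q C
    using neg that by blast
  let ?P = "\<lambda>n (Z, u :: nat). Z \<in> K n \<and> Z \<subseteq> X"
  let ?Q = "\<lambda>(Z, u) (Z', u'). Z' \<subseteq> Z \<and>
    (\<exists>F. F \<subseteq> {u..<u'} \<and> (\<forall>q\<in>Z'. banned (V q) (E q) u' F)) \<and> u < u'"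
  have "\<exists>f. \<forall>n. ?P n (f n) \<and> ?Q (f n) (f (Suc n))"
  proof (rule dependent_nat_choice)
    show "\<exists>s. ?P 0 s" using X by auto
    fix s n assume "?P n s"
    then obtain Z u where s: "s = (Z, u)" "Z \<in> K n" "Z \<subseteq> X" by (cases s) auto
    then obtain p where p: "p \<in> Z" using nonempty K0 by blast
    then have g: "infinite (V p)" "E p \<subseteq> nsets (V p) 2" using graph[of Z p] s K0 by auto
    obtain C where C: "C \<subseteq> V p - {..<u}" "infinite C" "clique (E p) C \<or> indep (E p) C"
      using infinite_clique_or_indep[OF g(2) infinite_Diff_lessThan[OF g(1)]] .
    then have sol: "rsgr_sol (V p) (E p) C"
      using no_indep[of p C] p s by (intro rsgr_sol_clique) auto
    have disj: "C \<inter> {..<u} = {}" using C(1) by auto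
    obtain u' Y F where
      "u < u'" "Y \<in> K (Suc n)" "Y \<subseteq> Z" "F \<subseteq> C" "F \<subseteq> {u..<u'}"
      "\<And>q. q \<in> Y \<Longrightarrow> banned (V q) (E q) u' F"
      "\<And>q x y. q \<in> Y \<Longrightarrow> x < u' \<Longrightarrow> y < u' \<Longrightarrow> {x, y} \<in> E q \<longleftrightarrow> {x, y} \<in> E p"
      using ban_solution[OF K0[OF s(2)] p sol disj, where l = "Suc n"] by metis
    then show "\<exists>t. ?P (Suc n) t \<and> ?Q s t" using s by (intro exI[of _ "(Y, u')"]) auto
  qed
  then obtain f where f: "\<forall>n. ?P n (f n) \<and> ?Q (f n) (f (Suc n))" ..
  define Z where "Z n = fst (f n)" for n
  define u where "u n = snd (f n)" for n
  have Z: "Z n \<in> K n" "Z n \<subseteq> X" "Z (Suc n) \<subseteq> Z n" "u n < u (Suc n)"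
    "\<exists>F. F \<subseteq> {u n..<u (Suc n)} \<and> (\<forall>q\<in>Z (Suc n). banned (V q) (E q) (u (Suc n)) F)" for n
    using spec[OF f, of n] by (auto simp: Z_def u_def split: prod.splits)
  have "\<forall>n. \<exists>F. F \<subseteq> {u n..<u (Suc n)} \<and> (\<forall>q\<in>Z (Suc n). banned (V q) (E q) (u (Suc n)) F)"
    using Z(5) by blast
  from choice[OF this] obtain F where "\<forall>n. F n \<subseteq> {u n..<u (Suc n)} \<and>
      (\<forall>q\<in>Z (Suc n). banned (V q) (E q) (u (Suc n)) (F n))" ..
  then have F: "\<And>n. F n \<subseteq> {u n..<u (Suc n)}"
    "\<And>n q. q \<in> Z (Suc n) \<Longrightarrow> banned (V q) (E q) (u (Suc n)) (F n)"
    by auto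
  have "(\<Inter>n. Z n) \<noteq> {}" using Z(1,3) by (rule chain)
  then obtain q where q: "\<And>n. q \<in> Z n" by auto
  then have g: "infinite (V q)" "E q \<subseteq> nsets (V q) 2" "q \<in> X"
    using graph[of "Z 0" q] Z by auto
  \<comment> \<open>If all degrees in \<open>F n\<close> were infinite,
    \<open>extend_by_nbh_cliques\<close> would extend the banned piece to a solution. This also
    excludes an empty piece.\<close>
  have "\<exists>v\<in>F n. finite (nbh (E q) v)" for n
  proof (rule ccontr)
    assume "\<not> ?thesis"
    then have "\<exists>H. rsgr_sol (V q) (E q) H \<and> H \<inter> {..<u (Suc n)} = F n"
      using F(2)[OF q] no_indep[OF g(3)] g
      by (intro extend_by_nbh_cliques) (auto simp: banned_def)
    then show False using F(2)[OF q] by (auto simp: banned_def)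
  qed
  then obtain v where v: "\<And>n. v n \<in> F n" "\<And>n. finite (nbh (E q) (v n))" by metis
  have "strict_mono u" using Z(4) by (simp add: strict_mono_Suc_iff)
  then have "strict_mono v"
    unfolding strict_mono_Suc_iff using v(1) F(1)
    by (metis atLeastLessThan_iff less_le_trans subsetD)
  then have "infinite (range v)" by (simp add: finite_image_iff strict_mono_imp_inj_on)
  \<comment> \<open>One vertex of finite degree per interval gives an infinite set. An infinite
    clique inside it contradicts the finite degrees, an infinite independent set the
    assumption.\<close>
  then obtain C where C: "C \<subseteq> range v" "infinite C" "clique (E q) C \<or> indep (E q) C"
    using infinite_clique_or_indep[OF g(2)] by blast
  have "C \<subseteq> V q" using C(1) v(1) F(2)[OF q] by (force simp: banned_def)
  then have "clique (E q) C" using C no_indep[OF g(3)] by blast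
  moreover obtain w where "w \<in> C" using C(2) by fastforce
  ultimately have "infinite (nbh (E q) w)" using infinite_clique_nbh[of "E q" C w] C(2) by auto
  then show False using \<open>w \<in> C\<close> C(1) v(2) by auto
qed

lemma dense_clique:
  assumes X: "X \<in> K 0"
  shows "\<exists>p\<in>X. \<exists>C\<subseteq>V p. infinite C \<and> clique (E p) C"
proof (rule ccontr)
  assume neg: "\<not> ?thesis"
  have no_clique: "\<not> clique (E q) C" if "q \<in> X" "C \<subseteq> V q" "infinite C" for q C
    using neg that by blast
  \<comment> \<open>Independence is recorded next to the ban because \<open>thin_indep\<close> needs
    both for all earlier pieces when the next solution is chosen.\<close>
  let ?R = "\<lambda>q u F. banned (V q) (E q) u F \<and> indep (E q) F"
  let ?P = "\<lambda>n (Z, u :: nat, \<F>). Z \<in> K n \<and> Z \<subseteq> X \<and> finite \<F> \<and> (\<forall>F\<in>\<F>. \<forall>q\<in>Z. ?R q u F)"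
  let ?Q = "\<lambda>(Z, u :: nat, \<F>) (Z', u' :: nat, \<F>'). Z' \<subseteq> Z \<and> (\<exists>F. finite F \<and> \<F>' = insert F \<F> \<and>
    (\<forall>q\<in>Z'. F \<subseteq> V q \<and> (\<forall>F'\<in>\<F>. \<exists>v\<in>F'. \<forall>w\<in>F. {v, w} \<in> E q)))"
  have "\<exists>f. \<forall>n. ?P n (f n) \<and> ?Q (f n) (f (Suc n))"
  proof (rule dependent_nat_choice)
    show "\<exists>s. ?P 0 s" using X by (intro exI[of _ "(X, 0, {})"]) auto
    fix s n assume "?P n s"
    then obtain Z u \<F> where s: "s = (Z, u, \<F>)" "Z \<in> K n" "Z \<subseteq> X" "finite \<F>"
      "\<And>F q. F \<in> \<F> \<Longrightarrow> q \<in> Z \<Longrightarrow> ?R q u F" by (cases s) auto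
    then obtain p where p: "p \<in> Z" using nonempty K0 by blast
    then have g: "infinite (V p)" "E p \<subseteq> nsets (V p) 2" using graph[of Z p] s K0 by auto
    obtain C where C: "C \<subseteq> V p - {..<u}" "infinite C" "clique (E p) C \<or> indep (E p) C"
      using infinite_clique_or_indep[OF g(2) infinite_Diff_lessThan[OF g(1)]] .
    then have "indep (E p) C" using no_clique[of p C] p s by auto
    then have "\<exists>J\<subseteq>C. infinite J \<and> (\<forall>F\<in>\<F>. \<exists>v\<in>F. J \<subseteq> nbh (E p) v)"
      using C(1,2) s(4) s(5)[OF _ p] by (intro thin_indep[OF g(2), where u = u]) auto
    then obtain J where J: "J \<subseteq> C" "infinite J" "\<And>F. F \<in> \<F> \<Longrightarrow> \<exists>v\<in>F. J \<subseteq> nbh (E p) v"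
      by auto
    have indep: "indep (E p) J" using J(1) \<open>indep (E p) C\<close> indep_subset by blast
    have sol: "rsgr_sol (V p) (E p) J" using indep J C(1) by (intro rsgr_sol_indep) auto
    have disj: "J \<inter> {..<u} = {}" using J(1) C(1) by auto
    obtain u' Y F where Y: "u < u'" "Y \<in> K (Suc n)" "Y \<subseteq> Z" "F \<subseteq> J" "F \<subseteq> {u..<u'}"
      "\<And>q. q \<in> Y \<Longrightarrow> banned (V q) (E q) u' F"
      "\<And>q x y. q \<in> Y \<Longrightarrow> x < u' \<Longrightarrow> y < u' \<Longrightarrow> {x, y} \<in> E q \<longleftrightarrow> {x, y} \<in> E p"
      using ban_solution[OF K0[OF s(2)] p sol disj, where l = "Suc n"] by metis
    have lt: "w < u'" if "w \<in> F" for w using that Y(5) by auto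
    have indep': "indep (E q) F" if "q \<in> Y" for q
      using Y(7)[OF that] lt indep_subset[OF indep Y(4)] by (auto simp: indep_def)
    \<comment> \<open>Inside \<open>J\<close>, a single vertex of each earlier piece is joined to
      everything. The edges from it to \<open>F\<close> lie below \<open>u'\<close>, hence are
      shared by all graphs of the condition \<open>Y\<close> and survive in the limit.\<close>
    have edges: "\<exists>v\<in>F'. \<forall>w\<in>F. {v, w} \<in> E q" if q: "q \<in> Y" and F': "F' \<in> \<F>" for q F'
    proof -
      from J(3)[OF F'] obtain v where v: "v \<in> F'" "J \<subseteq> nbh (E p) v" by blast
      moreover have "v < u'" using s(5)[OF F' p] v(1) Y(1) by (auto simp: banned_def)
      ultimately show ?thesis using Y(4,7) lt q by (intro bexI[of _ v]) (auto simp: nbh_def)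
    qed
    have fin: "finite F" using Y(5) finite_subset by blast
    have R: "?R q u' F'" if "q \<in> Y" "F' \<in> \<F>" for q F'
      using s(5)[OF that(2), of q] that(1) Y(1,3) banned_mono[of "V q" "E q" u F' u'] by auto
    have FV: "F \<subseteq> V q" if "q \<in> Y" for q using Y(6)[OF that] by (simp add: banned_def)
    have Q: "?Q s (Y, u', insert F \<F>)" unfolding s(1) prod.case
      by (intro conjI exI[of _ F] ballI refl Y(3) fin FV edges)
    have P: "?P (Suc n) (Y, u', insert F \<F>)" unfolding prod.case
    proof (intro conjI ballI Y(2))
      show "Y \<subseteq> X" using Y(3) s(3) by blast
      show "finite (insert F \<F>)" using s(4) by simp
      fix F' q assume "F' \<in> insert F \<F>" "q \<in> Y"
      then show "banned (V q) (E q) u' F'" "indep (E q) F'" using Y(6) indep' R by blast+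
    qed
    show "\<exists>t. ?P (Suc n) t \<and> ?Q s t" by (rule exI, rule conjI[OF P Q])
  qed
  then obtain f where f: "\<forall>n. ?P n (f n) \<and> ?Q (f n) (f (Suc n))" ..
  define Z where "Z n = fst (f n)" for n
  define \<F> where "\<F> n = snd (snd (f n))" for n
  have Z: "Z n \<in> K n" "Z n \<subseteq> X" "Z (Suc n) \<subseteq> Z n" "\<exists>F. finite F \<and> \<F> (Suc n) = insert F (\<F> n) \<and>
    (\<forall>q\<in>Z (Suc n). F \<subseteq> V q \<and> (\<forall>F'\<in>\<F> n. \<exists>v\<in>F'. \<forall>w\<in>F. {v, w} \<in> E q))" for n
    using spec[OF f, of n] by (auto simp: Z_def \<F>_def split: prod.splits)
  have "\<forall>n. \<exists>F. finite F \<and> \<F> (Suc n) = insert F (\<F> n) \<and>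
    (\<forall>q\<in>Z (Suc n). F \<subseteq> V q \<and> (\<forall>F'\<in>\<F> n. \<exists>v\<in>F'. \<forall>w\<in>F. {v, w} \<in> E q))"
    using Z(4) by blast
  from choice[OF this] obtain F where "\<forall>n. finite (F n) \<and> \<F> (Suc n) = insert (F n) (\<F> n) \<and>
    (\<forall>q\<in>Z (Suc n). F n \<subseteq> V q \<and> (\<forall>F'\<in>\<F> n. \<exists>v\<in>F'. \<forall>w\<in>F n. {v, w} \<in> E q))" ..
  then have F: "\<And>n. finite (F n)" "\<And>n. \<F> (Suc n) = insert (F n) (\<F> n)"
    "\<And>n q. q \<in> Z (Suc n) \<Longrightarrow> F n \<subseteq> V q \<and> (\<forall>F'\<in>\<F> n. \<exists>v\<in>F'. \<forall>w\<in>F n. {v, w} \<in> E q)"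
    by auto
  have "(\<Inter>n. Z n) \<noteq> {}" using Z(1,3) by (rule chain)
  then obtain q where q: "\<And>n. q \<in> Z n" by auto
  then have g: "infinite (V q)" "E q \<subseteq> nsets (V q) 2" "q \<in> X"
    using graph[of "Z 0" q] Z by auto
  have "F i \<in> \<F> j" if "i < j" for i j
    using that by (induction j) (auto simp: F(2) less_Suc_eq)
  then have "\<exists>C. C \<subseteq> (\<Union>i. F i) \<and> infinite C \<and> clique (E q) C"
    using F(3)[OF q] by (intro clique_from_blocks[OF g(2) F(1)]) blast
  then obtain C where C: "C \<subseteq> (\<Union>i. F i)" "infinite C" "clique (E q) C" by blast
  have "F i \<subseteq> V q" for i using F(3)[OF q] by simp
  then have "C \<subseteq> V q" using C(1) by fast
  then show False using no_clique[OF g(3)] C(2,3) by simp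
qed

theorem contradiction: False
proof -
  obtain X where X: "X \<in> K 0" using start by blast
  obtain p I where p: "p \<in> X" "I \<subseteq> V p" "infinite I" "indep (E p) I"
    using dense_indep[OF X] by blast
  obtain u Y F where Y: "Y \<in> K 0" "Y \<subseteq> X" "F \<subseteq> I" "F \<subseteq> {0..<u}"
    "\<And>q. q \<in> Y \<Longrightarrow> banned (V q) (E q) u F"
    "\<And>q x y. q \<in> Y \<Longrightarrow> x < u \<Longrightarrow> y < u \<Longrightarrow> {x, y} \<in> E q \<longleftrightarrow> {x, y} \<in> E p"
    by (rule ban_solution[OF X p(1) rsgr_sol_indep[OF p(2-4)], where u = 0 and l = 0]) auto
  obtain q C where q: "q \<in> Y" "C \<subseteq> V q" "infinite C" "clique (E q) C"
    using dense_clique[OF Y(1)] by blast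
  have "x < u" if "x \<in> F" for x using that Y(4) by auto
  \<comment> \<open>The graphs of \<open>p\<close> and \<open>q\<close> agree below
    \<open>u\<close>, so \<open>F\<close> is still independent in the graph that has a clique, and
    the clique extends it despite the ban.\<close>
  then have "indep (E q) F" using Y(6)[OF q(1)] indep_subset[OF p(4) Y(3)]
    by (simp add: indep_def)
  then have "\<exists>H. rsgr_sol (V q) (E q) H \<and> H \<inter> {..<u} = F"
    using Y(5)[OF q(1)] graph[OF Y(1) q(1)] q
    by (intro extend_by_clique[where C = C]) (auto simp: banned_def)
  then show False using Y(5)[OF q(1)] by (auto simp: banned_def)
qed

end

section \<open>Problems not reducible to \<open>wRSgr\<close>\<close>

lemma sols_coded_problem:
  assumes "inj_on ci I" "i \<in> I"
  shows "sols (coded_problem ci co I S) (ci i) = co ` S i"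
  using assms by (auto simp: coded_problem_def dest: inj_onD)

lemma insts_coded_problem [simp]: "insts (coded_problem ci co I S) = ci ` I"
  by (simp add: coded_problem_def)

lemma agree_indicator: "agree u (indicator A) (indicator B) \<longleftrightarrow> A \<inter> {..<u} = B \<inter> {..<u}"
  by (auto simp: agree_def indicator_def split: if_splits)

lemma sols_wRSgr:
  assumes "(V, E) \<in> infinite_graphs"
  shows "sols wRSgr (code_graph (V, E)) = indicator ` {H. rsgr_sol V E H}"
  by (simp add: sols_coded_problem[OF inj_on_code_graph assms] wRSgr_def rsgr_sol_def)

lemma code_graph_edge:
  "x \<noteq> y \<Longrightarrow> code_graph (V, E) (Suc (2 * prod_encode (x, y))) = of_bool ({x, y} \<in> E)"
  by (simp add: code_graph_def code_pairfun_def indicator_def)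

lemma code_graph_vertex: "code_graph (V, E) (2 * x) = of_bool (x \<in> V)"
  by (simp add: code_graph_def indicator_def)

lemma code_graph_agree:
  "\<exists>N. \<forall>V E V' E'. E \<subseteq> nsets V 2 \<longrightarrow> E' \<subseteq> nsets V' 2 \<longrightarrow>
     agree N (code_graph (V, E)) (code_graph (V', E')) \<longrightarrow>
     V' \<inter> {..<u} = V \<inter> {..<u} \<and> (\<forall>x<u. \<forall>y<u. {x, y} \<in> E' \<longleftrightarrow> {x, y} \<in> E)"
proof -
  have "finite (prod_encode ` ({..<u} \<times> {..<u}) \<union> {u})" by simp
  then obtain N where N: "\<forall>i\<in>prod_encode ` ({..<u} \<times> {..<u}) \<union> {u}. i \<le> N"
    using finite_nat_set_iff_bounded_le by blast
  show ?thesis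
  \<comment> \<open>Vertex bits sit at \<open>2 * x\<close> and edge bits at
    \<open>2 * c + 1\<close> for a pair code \<open>c\<close>; both numbers \<open>x\<close> and
    \<open>c\<close> are at most \<open>N\<close>.\<close>
  proof (intro exI[of _ "2 * N + 2"] allI impI conjI)
    fix V V' E E' assume E: "E \<subseteq> nsets V 2" "E' \<subseteq> nsets V' 2"
      and agr: "agree (2 * N + 2) (code_graph (V, E)) (code_graph (V', E'))"
    have "x \<in> V' \<longleftrightarrow> x \<in> V" if "x < u" for x
      using agreeD[OF agr, of "2 * x"] N that by (auto simp: code_graph_vertex of_bool_eq_iff)
    then show "V' \<inter> {..<u} = V \<inter> {..<u}" by auto
    fix x y assume "x < u" "y < u"
    then have "prod_encode (x, y) \<le> N" using N by auto
    moreover have "{y} \<notin> E" "{y} \<notin> E'" using edge_neq[OF E(1), of y y] edge_neq[OF E(2), of y y] by auto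
    ultimately show "{x, y} \<in> E' \<longleftrightarrow> {x, y} \<in> E"
      using agreeD[OF agr, of "Suc (2 * prod_encode (x, y))"]
      by (cases "x = y") (auto simp: code_graph_edge of_bool_eq_iff)
  qed
qed

text \<open>The hypothesis \<open>ban\<close> forbids an initial segment of one output of the
  reduction. By continuity a solution of the new graph with the same initial segment as
  \<open>H\<close> would produce exactly that output, so the initial segment of \<open>H\<close> is
  banned in the sense of \<open>banning_family\<close>.\<close>

lemma not_le_wRSgr:
  assumes start: "K 0 \<noteq> {}"
    and antimono: "\<And>i j. i \<le> j \<Longrightarrow> K j \<subseteq> K i"
    and K: "\<And>X. X \<in> K 0 \<Longrightarrow> X \<noteq> {} \<and> X \<subseteq> insts Q"
    and chain: "\<And>Z. (\<And>i. Z i \<in> K i) \<Longrightarrow> (\<And>i. Z (Suc i) \<subseteq> Z i) \<Longrightarrow> (\<Inter>i. Z i) \<noteq> {}"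
    and ban: "\<And>X p g. X \<in> K 0 \<Longrightarrow> p \<in> X \<Longrightarrow> g \<in> sols Q p \<Longrightarrow>
      \<exists>n. \<forall>m. \<exists>Y\<in>K m. Y \<subseteq> X \<and> (\<forall>q\<in>Y. agree m p q \<and> (\<forall>g'\<in>sols Q q. \<not> agree n g g'))"
  shows "\<not> Q \<le>\<^sub>W wRSgr"
proof
  assume "Q \<le>\<^sub>W wRSgr"
  then obtain \<Phi> \<Psi> where red: "reduction Q wRSgr \<Phi> \<Psi>" unfolding weihrauch_le_iff by blast
  have "\<exists>VE. VE \<in> infinite_graphs \<and> \<Phi> p = code_graph VE" if "p \<in> insts Q" for p
  proof -
    have "\<Phi> p \<in> insts wRSgr" using red that by (simp add: reduction_def)
    then show ?thesis by (auto simp: wRSgr_def)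
  qed
  then obtain VE where VE: "\<And>p. p \<in> insts Q \<Longrightarrow> VE p \<in> infinite_graphs \<and> \<Phi> p = code_graph (VE p)"
    by metis
  define V where "V p = fst (VE p)" for p
  define E where "E p = snd (VE p)" for p
  have G: "(V p, E p) \<in> infinite_graphs" "\<Phi> p = code_graph (V p, E p)" if "p \<in> insts Q" for p
    using VE[OF that] by (simp_all add: V_def E_def)
  have sol: "indicator H \<in> sols wRSgr (\<Phi> p)" if "p \<in> insts Q" "rsgr_sol (V p) (E p) H" for p H
    using that G sols_wRSgr by auto
  have val: "\<Psi> (join p (indicator H)) \<in> sols Q p" if "p \<in> insts Q" "rsgr_sol (V p) (E p) H" for p H
    using red sol[OF that] that(1) by (simp add: reduction_def)
  have "banning_family K V E"
  proof
    show "K 0 \<noteq> {}" by (rule start)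
    show "K j \<subseteq> K i" if "i \<le> j" for i j by (rule antimono[OF that])
    show "X \<noteq> {}" if "X \<in> K 0" for X using K[OF that] by simp
    show "(\<Inter>i. Z i) \<noteq> {}" if "\<And>i. Z i \<in> K i" "\<And>i. Z (Suc i) \<subseteq> Z i" for Z using that by (rule chain)
    show "infinite (V p) \<and> E p \<subseteq> nsets (V p) 2" if "X \<in> K 0" "p \<in> X" for X p
      using G(1)[of p] K that by (auto simp: infinite_graphs_def)
  next
    fix X p H l assume X: "X \<in> K 0" "p \<in> X" and H: "rsgr_sol (V p) (E p) H"
    then have p: "p \<in> insts Q" using K by blast
    from ban[OF X val[OF p H]] obtain n where n: "\<And>m. \<exists>Y\<in>K m. Y \<subseteq> X \<and> (\<forall>q\<in>Y. agree m p q \<and>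
      (\<forall>g'\<in>sols Q q. \<not> agree n (\<Psi> (join p (indicator H))) g'))" by blast
    from reduction_continuous_sol[OF red, OF p, OF sol[OF p H], of n] obtain m1 where m1:
      "\<forall>q\<in>insts Q. \<forall>g'\<in>sols wRSgr (\<Phi> q). agree m1 p q \<longrightarrow> agree m1 (indicator H) g' \<longrightarrow>
        agree n (\<Psi> (join p (indicator H))) (\<Psi> (join q g'))" ..
    \<comment> \<open>Below \<open>m1\<close> the solution determines the first \<open>n\<close>
      values of the output; the locale asks for \<open>u\<close> at least \<open>l\<close>.\<close>
    define u where "u = max l m1"
    obtain N where N: "\<And>V E V' E'. E \<subseteq> nsets V 2 \<Longrightarrow> E' \<subseteq> nsets V' 2 \<Longrightarrow>
     agree N (code_graph (V, E)) (code_graph (V', E')) \<Longrightarrow>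
     V' \<inter> {..<u} = V \<inter> {..<u} \<and> (\<forall>x<u. \<forall>y<u. {x, y} \<in> E' \<longleftrightarrow> {x, y} \<in> E)"
      using code_graph_agree[of u] by metis
    from reduction_continuous_inst[OF red p, of N] obtain m2 where m2:
      "\<forall>q\<in>insts Q. agree m2 p q \<longrightarrow> agree N (\<Phi> p) (\<Phi> q)" ..
    from n[of "max l (max m1 m2)"] obtain Y where Y: "Y \<in> K (max l (max m1 m2))" "Y \<subseteq> X"
      "\<And>q. q \<in> Y \<Longrightarrow> agree (max l (max m1 m2)) p q"
      "\<And>q g'. q \<in> Y \<Longrightarrow> g' \<in> sols Q q \<Longrightarrow> \<not> agree n (\<Psi> (join p (indicator H))) g'" by blast
    have "V q \<inter> {..<u} = V p \<inter> {..<u} \<and> (\<forall>x<u. \<forall>y<u. {x, y} \<in> E q \<longleftrightarrow> {x, y} \<in> E p) \<and>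
        (\<forall>H'. rsgr_sol (V q) (E q) H' \<longrightarrow> H' \<inter> {..<u} \<noteq> H \<inter> {..<u})" if q: "q \<in> Y" for q
    proof -
      have qi: "q \<in> insts Q" using q Y(2) K X(1) by blast
      have agr: "agree N (code_graph (V p, E p)) (code_graph (V q, E q))"
        using bspec[OF m2 qi] Y(3)[OF q] G(2)[OF p] G(2)[OF qi] by simp
      have sub: "E p \<subseteq> nsets (V p) 2" "E q \<subseteq> nsets (V q) 2"
        using G(1)[OF p] G(1)[OF qi] by (auto simp: infinite_graphs_def)
      have "V q \<inter> {..<u} = V p \<inter> {..<u} \<and> (\<forall>x<u. \<forall>y<u. {x, y} \<in> E q \<longleftrightarrow> {x, y} \<in> E p)"
        using N[OF sub agr] .
      moreover have "H' \<inter> {..<u} \<noteq> H \<inter> {..<u}" if H': "rsgr_sol (V q) (E q) H'" for H'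
      proof
        assume "H' \<inter> {..<u} = H \<inter> {..<u}"
        then have "agree u (indicator H) (indicator H')" by (simp add: agree_indicator)
        then have "agree m1 (indicator H) (indicator H')" by (rule agree_mono) (simp add: u_def)
        then have "agree n (\<Psi> (join p (indicator H))) (\<Psi> (join q (indicator H')))"
          using bspec[OF bspec[OF m1 qi] sol[OF qi H']] Y(3)[OF q] by simp
        then show False using Y(4)[OF q val[OF qi H']] by simp
      qed
      ultimately show ?thesis by blast
    qed
    moreover have "u \<ge> l" by (simp add: u_def)
    moreover have "Y \<in> K l" using Y(1) antimono[of l "max l (max m1 m2)"] by auto
    ultimately show "\<exists>u\<ge>l. \<exists>Y\<in>K l. Y \<subseteq> X \<and> (\<forall>q\<in>Y. V q \<inter> {..<u} = V p \<inter> {..<u} \<and>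
        (\<forall>x<u. \<forall>y<u. {x, y} \<in> E q \<longleftrightarrow> {x, y} \<in> E p) \<and>
        (\<forall>H'. rsgr_sol (V q) (E q) H' \<longrightarrow> H' \<inter> {..<u} \<noteq> H \<inter> {..<u}))"
      using Y(2) by (intro exI[of _ u] conjI bexI[of _ Y]) simp_all
  qed
  then show False by (rule banning_family.contradiction)
qed

text \<open>The forcing conditions fix finitely many columns of an instance completely.\<close>

lemma not_le_wRSgr_columns:
  fixes col :: "baire \<Rightarrow> nat \<Rightarrow> 'c" and rk :: "nat \<Rightarrow> baire \<Rightarrow> nat \<Rightarrow> bool"
  assumes I: "I \<noteq> {}" "I \<subseteq> insts Q"
    and agree_col: "\<And>p q m. p \<in> I \<Longrightarrow> q \<in> I \<Longrightarrow> (\<And>e. e < m \<Longrightarrow> col q e = col p e) \<Longrightarrow> agree m p q"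
    and rk_mono: "\<And>i j p n. rk j p n \<Longrightarrow> i \<le> j \<Longrightarrow> rk i p n"
    and rk_ex: "\<And>m p n. p \<in> I \<Longrightarrow> \<exists>n'\<ge>n. rk m p n'"
    and limit: "\<And>p n. (\<And>i. p i \<in> I) \<Longrightarrow> (\<And>i. rk i (p i) (n i)) \<Longrightarrow>
      (\<And>i j e. i \<le> j \<Longrightarrow> e < n i \<Longrightarrow> col (p j) e = col (p i) e) \<Longrightarrow>
      \<exists>r\<in>I. \<forall>i. \<forall>e<n i. col r e = col (p i) e"
    and ban: "\<And>p g n0. p \<in> I \<Longrightarrow> g \<in> sols Q p \<Longrightarrow> \<exists>n. \<forall>m. \<exists>r\<in>I. \<exists>M. agree m p r \<and>
      (\<forall>e<n0. col r e = col p e) \<and>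
      (\<forall>q\<in>I. (\<forall>e<M. col q e = col r e) \<longrightarrow> (\<forall>g'\<in>sols Q q. \<not> agree n g g'))"
  shows "\<not> Q \<le>\<^sub>W wRSgr"
proof -
  define X where "X p n = {q \<in> I. \<forall>e<n. col q e = col p e}" for p n
  define K where "K m = {X p n | p n. p \<in> I \<and> rk m p n}" for m
  have self: "p \<in> I \<Longrightarrow> p \<in> X p n" for p n by (simp add: X_def)
  show ?thesis
  proof (rule not_le_wRSgr[of K])
    obtain p where "p \<in> I" using I by blast
    then show "K 0 \<noteq> {}" using rk_ex[of p 0 0] by (auto simp: K_def)
    show "K j \<subseteq> K i" if "i \<le> j" for i j using rk_mono[OF _ that] by (auto simp: K_def)
    show "Z \<noteq> {} \<and> Z \<subseteq> insts Q" if "Z \<in> K 0" for Z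
      using that self I(2) by (auto simp: K_def X_def)
  next
    fix Z assume Z: "\<And>i. Z i \<in> K i" "\<And>i. Z (Suc i) \<subseteq> Z i"
    have "\<forall>i. \<exists>pn. Z i = X (fst pn) (snd pn) \<and> fst pn \<in> I \<and> rk i (fst pn) (snd pn)"
      using Z(1) by (fastforce simp: K_def)
    from choice[OF this] obtain pn where pn: "\<And>i. Z i = X (fst (pn i)) (snd (pn i))"
      "\<And>i. fst (pn i) \<in> I" "\<And>i. rk i (fst (pn i)) (snd (pn i))" by blast
    have mono: "Z j \<subseteq> Z i" if "i \<le> j" for i j
      using Z(2) that by (rule lift_Suc_antimono_le)
    have "\<exists>r\<in>I. \<forall>i. \<forall>e<snd (pn i). col r e = col (fst (pn i)) e"
    proof (rule limit)
      fix i j e assume "i \<le> j" "e < snd (pn i)"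
      moreover have "fst (pn j) \<in> Z j" using pn self by simp
      ultimately have "fst (pn j) \<in> Z i" using mono by blast
      then show "col (fst (pn j)) e = col (fst (pn i)) e"
        unfolding pn(1) X_def using \<open>e < snd (pn i)\<close> by simp
    qed (use pn in auto)
    then obtain r where "r \<in> I" "\<And>i e. e < snd (pn i) \<Longrightarrow> col r e = col (fst (pn i)) e" by blast
    then have "r \<in> Z i" for i unfolding pn(1) X_def by simp
    then show "(\<Inter>i. Z i) \<noteq> {}" by auto
  next
    fix Z p g assume Z: "Z \<in> K 0" "p \<in> Z" "g \<in> sols Q p"
    then obtain p0 n0 where p0: "Z = X p0 n0" by (auto simp: K_def)
    then have p: "p \<in> I" "\<And>e. e < n0 \<Longrightarrow> col p e = col p0 e" using Z(2) by (auto simp: X_def)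
    from ban[OF p(1) Z(3), of n0] obtain n where n: "\<And>m. \<exists>r\<in>I. \<exists>M. agree m p r \<and>
      (\<forall>e<n0. col r e = col p e) \<and>
      (\<forall>q\<in>I. (\<forall>e<M. col q e = col r e) \<longrightarrow> (\<forall>g'\<in>sols Q q. \<not> agree n g g'))" by blast
    have "\<exists>Y\<in>K m. Y \<subseteq> Z \<and> (\<forall>q\<in>Y. agree m p q \<and> (\<forall>g'\<in>sols Q q. \<not> agree n g g'))" for m
    proof -
      from n[of m] obtain r M where r: "r \<in> I" "agree m p r" "\<And>e. e < n0 \<Longrightarrow> col r e = col p e"
        "\<And>q g'. q \<in> I \<Longrightarrow> (\<And>e. e < M \<Longrightarrow> col q e = col r e) \<Longrightarrow> g' \<in> sols Q q \<Longrightarrow> \<not> agree n g g'"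
        by blast
      obtain k where k: "k \<ge> max m (max M n0)" "rk m r k" using rk_ex[OF r(1)] by blast
      show ?thesis
      proof (intro bexI[of _ "X r k"] conjI ballI)
        show "X r k \<in> K m" using r(1) k(2) by (auto simp: K_def)
        show "X r k \<subseteq> Z" using k(1) r(3) p(2) by (auto simp: p0 X_def)
        fix q assume q: "q \<in> X r k"
        then have "agree m r q" using k(1) by (intro agree_col r(1)) (auto simp: X_def)
        then show "agree m p q" using r(2) agree_trans by blast
        fix g' assume "g' \<in> sols Q q"
        then show "\<not> agree n g g'" using q k(1) by (intro r(4)[of q]) (auto simp: X_def)
      qed
    qed
    then show "\<exists>n. \<forall>m. \<exists>Y\<in>K m. Y \<subseteq> Z \<and> (\<forall>q\<in>Y. agree m p q \<and> (\<forall>g'\<in>sols Q q. \<not> agree n g g'))"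
      by (intro exI[of _ n] allI)
  qed
qed

subsection \<open>Limits and diagonally non-recursive functions\<close>

lemma prod_encode_ge: "x \<le> prod_encode (x, y)" "y \<le> prod_encode (x, y)"
  by (rule le_prod_encode_1, rule le_prod_encode_2)

lemma baire_eq_pairs: "(p :: baire) = q \<longleftrightarrow> (\<forall>x y. p (prod_encode (x, y)) = q (prod_encode (x, y)))"
  by (metis ext prod_decode_inverse surj_pair)

lemma agree_pairs:
  "agree m p q \<longleftrightarrow> (\<forall>x y. prod_encode (x, y) < m \<longrightarrow> p (prod_encode (x, y)) = q (prod_encode (x, y)))"
  unfolding agree_def by (metis prod_decode_inverse surj_pair)

definition column :: "baire \<Rightarrow> nat \<Rightarrow> baire" where
  "column p x y = p (prod_encode (x, y))"

lemma agree_columns: "(\<And>e. e < m \<Longrightarrow> column q e = column p e) \<Longrightarrow> agree m p q"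
  unfolding agree_pairs column_def using prod_encode_ge(1) le_less_trans by (metis (no_types))

lemma agree_even_odd:
  assumes "\<And>x. x < n \<Longrightarrow> p (2 * x) = q (2 * x)"
    and "\<And>x y. x < n \<Longrightarrow> y < n \<Longrightarrow> p (Suc (2 * prod_encode (x, y))) = q (Suc (2 * prod_encode (x, y)))"
  shows "agree n p q"
  unfolding agree_def
proof (intro allI impI)
  fix i assume i: "i < n"
  show "p i = q i"
  proof (cases "even i")
    case True
    then obtain x where "i = 2 * x" by (rule evenE)
    then show ?thesis using assms(1)[of x] i by simp
  next
    case False
    then obtain x y where xy: "i = Suc (2 * prod_encode (x, y))"
      by (metis oddE Suc_eq_plus1 prod_decode_inverse surj_pair)
    then have "x < n \<and> y < n" using i prod_encode_ge(1)[of x y] prod_encode_ge(2)[of y x] by linarith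
    then show ?thesis using assms(2) by (simp add: xy)
  qed
qed

definition glue :: "(nat \<Rightarrow> baire) \<Rightarrow> baire" where
  "glue c n = (case prod_decode n of (x, y) \<Rightarrow> c x y)"

lemma column_glue [simp]: "column (glue c) = c"
  by (simp add: column_def glue_def fun_eq_iff)

lemma column_inject: "column p = column q \<longleftrightarrow> p = q"
  by (metis baire_eq_pairs column_def)

text \<open>Column \<open>e\<close> is frozen from stage \<open>Suc e\<close> on, because
  \<open>e < n (Suc e)\<close>; the diagonal therefore reads every column after it has
  settled.\<close>

lemma limit_columns:
  assumes "\<And>i. i \<le> n i" "\<And>i j e. i \<le> j \<Longrightarrow> e < n i \<Longrightarrow> column (p j) e = column (p i) e"
  shows "e < n i \<Longrightarrow> column (glue (\<lambda>e. column (p (Suc e)) e)) e = column (p i) e"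
proof -
  assume e: "e < n i"
  have "e < n (Suc e)" using assms(1)[of "Suc e"] by simp
  then have "column (p (Suc e)) e = column (p (max i (Suc e))) e"
    using assms(2)[of "Suc e" "max i (Suc e)" e] by simp
  also have "\<dots> = column (p i) e" using assms(2)[of i "max i (Suc e)" e] e by simp
  finally show ?thesis by simp
qed

lemma insts_LimP: "p \<in> insts LimP \<longleftrightarrow> (\<forall>x. \<exists>l. eventually (\<lambda>s. column p x s = l) sequentially)"
proof
  assume "\<forall>x. \<exists>l. eventually (\<lambda>s. column p x s = l) sequentially"
  then show "p \<in> insts LimP"
    by (auto simp: LimP_def column_def intro!: image_eqI[of _ _ "\<lambda>z. p (prod_encode z)"])
qed (auto simp: LimP_def column_def)

lemma sols_LimP:
  assumes "p \<in> insts LimP"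
  shows "g \<in> sols LimP p \<longleftrightarrow> (\<forall>x. eventually (\<lambda>s. column p x s = g x) sequentially)"
proof -
  from assms obtain f where f: "p = f \<circ> prod_decode" "f \<in> {f. \<forall>n. \<exists>l. eventually (\<lambda>s. f (n, s) = l) sequentially}"
    by (auto simp: LimP_def)
  have "inj (\<lambda>f :: nat \<times> nat \<Rightarrow> nat. f \<circ> prod_decode)"
    by (metis (no_types, lifting) comp_assoc comp_id injI prod_encode_inverse fun_eq_iff comp_apply)
  then show ?thesis unfolding LimP_def f(1)
    by (subst sols_coded_problem[OF inj_on_subset f(2)]) (auto simp: column_def)
qed

theorem not_LimP_le_wRSgr: "\<not> LimP \<le>\<^sub>W wRSgr"
proof (rule not_le_wRSgr_columns[where I = "insts LimP" and col = column and rk = "\<lambda>i p n. i \<le> n"])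
  show "insts LimP \<noteq> {}"
    using insts_LimP[of "\<lambda>_. 0"] by (auto simp: column_def)
  show "\<exists>r\<in>insts LimP. \<forall>i. \<forall>e<n i. column r e = column (p i) e"
    if "\<And>i. p i \<in> insts LimP" "\<And>i. i \<le> n i"
      "\<And>i j e. i \<le> j \<Longrightarrow> e < n i \<Longrightarrow> column (p j) e = column (p i) e" for p n
    using that(1) limit_columns[of n p, OF that(2,3)]
    by (intro bexI[of _ "glue (\<lambda>e. column (p (Suc e)) e)"]) (auto simp: insts_LimP)
next
  fix p g n0 assume p: "p \<in> insts LimP" and g: "g \<in> sols LimP p"
  have "\<exists>r\<in>insts LimP. \<exists>M. agree m p r \<and> (\<forall>e<n0. column r e = column p e) \<and>
      (\<forall>q\<in>insts LimP. (\<forall>e<M. column q e = column r e) \<longrightarrow>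
        (\<forall>g'\<in>sols LimP q. \<not> agree (Suc n0) g g'))" for m
  proof -
    \<comment> \<open>Column \<open>n0\<close> is the first one not promised. Changing it beyond
      \<open>m\<close> gives it a limit different from \<open>g n0\<close>.\<close>
    define r where "r = glue (\<lambda>e s. if e = n0 \<and> s \<ge> m then Suc (g n0) else column p e s)"
    have ev: "eventually (\<lambda>s. column r n0 s = Suc (g n0)) sequentially"
      unfolding eventually_sequentially by (intro exI[of _ m]) (simp add: r_def)
    have cols: "column r e = column p e" if "e \<noteq> n0" for e using that by (simp add: r_def)
    have r: "r \<in> insts LimP"
      unfolding insts_LimP using p ev cols by (metis insts_LimP)
    moreover have "agree m p r"
      unfolding agree_pairs
    proof (intro allI impI)
      fix x y assume "prod_encode (x, y) < m"
      then have "y < m" using prod_encode_ge(2) le_less_trans by blast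
      then have "column p x y = column r x y" by (simp add: r_def)
      then show "p (prod_encode (x, y)) = r (prod_encode (x, y))" by (simp add: column_def)
    qed
    moreover have "\<not> agree (Suc n0) g g'"
      if q: "q \<in> insts LimP" "\<forall>e<Suc n0. column q e = column r e" "g' \<in> sols LimP q" for q g'
    proof
      assume "agree (Suc n0) g g'"
      then have "g n0 = g' n0" by (simp add: agree_def)
      moreover have "column q n0 = column r n0" using q(2) by simp
      with q(3) have "eventually (\<lambda>s. column r n0 s = g' n0) sequentially"
        unfolding sols_LimP[OF q(1)] by metis
      then have "eventually (\<lambda>s. g' n0 = Suc (g n0)) sequentially" using ev
        by eventually_elim simp
      ultimately show False by simp
    qed
    ultimately show ?thesis using cols by (metis nat_neq_iff)
  qed
  then show "\<exists>n. \<forall>m. \<exists>r\<in>insts LimP. \<exists>M. agree m p r \<and> (\<forall>e<n0. column r e = column p e) \<and>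
      (\<forall>q\<in>insts LimP. (\<forall>e<M. column q e = column r e) \<longrightarrow>
        (\<forall>g'\<in>sols LimP q. \<not> agree n g g'))" by blast
next
  show "\<exists>n'\<ge>n. m \<le> n'" for m n :: nat by (intro exI[of _ "max n m"]) auto
qed (auto intro: agree_columns)

lemma sols_DNR: "g \<in> sols DNR p \<longleftrightarrow> (\<forall>e. Phi e p e \<noteq> Some (g e))"
  by (auto simp: DNR_def coded_problem_def)

text \<open>As long as column \<open>c\<close> vanishes beyond \<open>t\<close>, the value of this functional can still be chosen.\<close>

lemma first_nonzero_index:
  "\<exists>e. \<forall>p s. t \<le> s \<longrightarrow> column p c s \<noteq> 0 \<longrightarrow> (\<forall>s'. t \<le> s' \<longrightarrow> s' < s \<longrightarrow> column p c s' = 0) \<longrightarrow>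
     (\<forall>x. Phi e p x = Some (column p c s - 1))"
proof -
  have "comp_pred UNIV (\<lambda>p z. \<not> (t \<le> snd (prod_decode z) \<and> p (prod_encode (c, snd (prod_decode z))) \<noteq> 0))"
    by (intro comp_intros)
  then obtain P where P: "\<And>p z. run P p z =
      Some (of_bool (\<not> (t \<le> snd (prod_decode z) \<and> column p c (snd (prod_decode z)) \<noteq> 0)))"
    unfolding comp_on_def column_def by blast
  \<comment> \<open>A nonzero entry \<open>Suc v\<close> signals the output \<open>v\<close>, so
    that 0 is available as an output as well.\<close>
  have "comp_on UNIV (\<lambda>p s. p (prod_encode (c, s)) - 1)" by (intro comp_intros)
  then obtain P' where P': "\<And>p s. run P' p s = Some (column p c s - 1)"
    unfolding comp_on_def column_def by blast
  obtain e where e: "prog_of e = PComp P' (PMu P)" using surj_prog_of by (metis surjD)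
  have "Phi e p x = Some (column p c s - 1)"
    if "t \<le> s" "column p c s \<noteq> 0" "\<And>s'. t \<le> s' \<Longrightarrow> s' < s \<Longrightarrow> column p c s' = 0" for p s x
  proof -
    have "(LEAST n. run P p (prod_encode (x, n)) = Some 0) = s"
      using that by (intro Least_equality) (auto simp: P not_less[symmetric])
    moreover have "run P p (prod_encode (x, s)) = Some 0 \<and> (\<forall>m<s. run P p (prod_encode (x, m)) \<noteq> None)"
      using that by (simp add: P)
    ultimately have "run (PMu P) p x = Some s" by auto
    then show ?thesis by (simp add: Phi_def e P' del: run.simps(9))
  qed
  then show ?thesis by blast
qed

theorem not_DNR_le_wRSgr: "\<not> DNR \<le>\<^sub>W wRSgr"
proof -
  \<comment> \<open>In such an instance column \<open>c\<close> is still silent beyond some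
    \<open>t\<close>. A functional that waits for its first nonzero entry past \<open>t\<close> can
    then be given any value later.\<close>
  define I where "I = {p. \<forall>c. eventually (\<lambda>s. column p c s = 0) sequentially}"
  show ?thesis
  proof (rule not_le_wRSgr_columns[where I = I and col = column and rk = "\<lambda>i p n. i \<le> n"])
    have "(\<lambda>_. 0) \<in> I" by (simp add: I_def column_def)
    then show "I \<noteq> {}" by blast
    show "\<exists>r\<in>I. \<forall>i. \<forall>e<n i. column r e = column (p i) e"
      if "\<And>i. p i \<in> I" "\<And>i. i \<le> n i"
        "\<And>i j e. i \<le> j \<Longrightarrow> e < n i \<Longrightarrow> column (p j) e = column (p i) e" for p n
      using that(1) limit_columns[of n p, OF that(2,3)]
      by (intro bexI[of _ "glue (\<lambda>e. column (p (Suc e)) e)"]) (auto simp: I_def)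
  next
    fix p g c assume p: "p \<in> I" and g: "g \<in> sols DNR p"
    from p obtain t where t: "\<And>s. s \<ge> t \<Longrightarrow> column p c s = 0"
      unfolding I_def eventually_sequentially by blast
    obtain e where e: "\<And>p s x. t \<le> s \<Longrightarrow> column p c s \<noteq> 0 \<Longrightarrow>
      (\<And>s'. t \<le> s' \<Longrightarrow> s' < s \<Longrightarrow> column p c s' = 0) \<Longrightarrow> Phi e p x = Some (column p c s - 1)"
      using first_nonzero_index[of t c] by blast
    have "\<exists>r\<in>I. \<exists>M. agree m p r \<and> (\<forall>e<c. column r e = column p e) \<and>
      (\<forall>q\<in>I. (\<forall>e<M. column q e = column r e) \<longrightarrow> (\<forall>g'\<in>sols DNR q. \<not> agree (Suc e) g g'))" for m
    proof -
      \<comment> \<open>At position \<open>s\<close> the functional with index \<open>e\<close> is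
        told to output \<open>g e\<close>, so no solution of the new instance can take the value
        \<open>g e\<close> at \<open>e\<close>.\<close>
      define s where "s = max m t"
      define r where "r = glue (\<lambda>c' s'. if c' = c \<and> s' = s then Suc (g e) else column p c' s')"
      have cols: "column r e = column p e" if "e \<noteq> c" for e using that by (simp add: r_def)
      have "eventually (\<lambda>s'. column r c' s' = 0) sequentially" for c'
      proof (cases "c' = c")
        case True
        then show ?thesis unfolding eventually_sequentially
          using t by (intro exI[of _ "Suc s"]) (auto simp: r_def s_def)
      next
        case False
        then show ?thesis using p cols by (simp add: I_def)
      qed
      then have r: "r \<in> I" by (simp add: I_def)
      moreover have "agree m p r"
        unfolding agree_pairs
      proof (intro allI impI)
        fix x y assume "prod_encode (x, y) < m"
        then have "y < m" using prod_encode_ge(2) le_less_trans by blast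
        then have "column p x y = column r x y" by (auto simp: r_def s_def)
        then show "p (prod_encode (x, y)) = r (prod_encode (x, y))" by (simp add: column_def)
      qed
      moreover have "\<not> agree (Suc e) g g'"
        if q: "\<forall>c'<Suc c. column q c' = column r c'" "g' \<in> sols DNR q" for q g'
      proof
        assume "agree (Suc e) g g'"
        then have "g e = g' e" by (simp add: agree_def)
        moreover have "column q c = column r c" using q(1) by simp
        then have "Phi e q e = Some (column q c s - 1)"
          using t by (intro e) (auto simp: r_def s_def)
        moreover have "column q c s = Suc (g e)" using \<open>column q c = column r c\<close> by (simp add: r_def)
        ultimately show False using q(2) by (auto simp: sols_DNR)
      qed
      ultimately show ?thesis using cols by (metis nat_neq_iff)
    qed
    then show "\<exists>n. \<forall>m. \<exists>r\<in>I. \<exists>M. agree m p r \<and> (\<forall>e<c. column r e = column p e) \<and>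
      (\<forall>q\<in>I. (\<forall>e<M. column q e = column r e) \<longrightarrow> (\<forall>g'\<in>sols DNR q. \<not> agree n g g'))" by blast
  next
  show "\<exists>n'\<ge>n. m \<le> n'" for m n :: nat by (intro exI[of _ "max n m"]) auto
  qed (auto intro: agree_columns simp: DNR_def)
qed

subsection \<open>Stable colourings\<close>

lemma column_code_pairfun: "column (code_pairfun c) x y = (if x = y then 0 else c {x, y})"
  by (simp add: column_def code_pairfun_def)

lemma insts_SRT22:
  "p \<in> insts SRT22 \<longleftrightarrow>
     (\<forall>x y. column p x y = column p y x \<and> column p x y \<le> 1) \<and> (\<forall>x. column p x x = 0) \<and>
     (\<forall>x. \<exists>i. eventually (\<lambda>s. column p x s = i) sequentially)"
proof
  assume "p \<in> insts SRT22"
  then obtain c where c: "p = code_pairfun c" "c \<in> colourings" "stable c" by (auto simp: SRT22_def)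
  have "c {x, y} \<le> 1" if "x \<noteq> y" for x y
  proof -
    have "{x, y} \<in> nsets UNIV 2" using that by (auto simp: nsets_def)
    then have "c {x, y} \<in> {0, 1}" using c(2) unfolding colourings_def by (rule funcset_mem[rotated])
    then show ?thesis by auto
  qed
  moreover have "\<exists>i. eventually (\<lambda>s. column p x s = i) sequentially" for x
  proof -
    obtain i where "eventually (\<lambda>s. c {x, s} = i) sequentially" using c(3) by (auto simp: stable_def)
    then have "eventually (\<lambda>s. column p x s = i) sequentially"
      using eventually_gt_at_top[of x] by eventually_elim (simp add: c(1) column_code_pairfun)
    then show ?thesis ..
  qed
  ultimately show "(\<forall>x y. column p x y = column p y x \<and> column p x y \<le> 1) \<and> (\<forall>x. column p x x = 0) \<and>
     (\<forall>x. \<exists>i. eventually (\<lambda>s. column p x s = i) sequentially)"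
    by (simp add: c(1) column_code_pairfun insert_commute)
next
  assume *: "(\<forall>x y. column p x y = column p y x \<and> column p x y \<le> 1) \<and> (\<forall>x. column p x x = 0) \<and>
     (\<forall>x. \<exists>i. eventually (\<lambda>s. column p x s = i) sequentially)"
  define c where "c X = column p (Min X) (Max X)" for X
  have c: "c {x, y} = column p x y" for x y
    using * by (auto simp: c_def min_def max_def)
  have "column (code_pairfun c) = column p"
    using * by (auto simp: column_code_pairfun c fun_eq_iff)
  then have "p = code_pairfun c" by (simp add: column_inject)
  moreover have "c \<in> colourings" using * by (auto simp: colourings_def c_def le_Suc_eq)
  moreover have "stable c" using * by (simp add: stable_def c)
  ultimately show "p \<in> insts SRT22" by (auto simp: SRT22_def)
qed

lemma homogeneous_sets_iff:
  "H \<in> homogeneous_sets c \<longleftrightarrow> infinite H \<and> (\<exists>i. \<forall>x\<in>H. \<forall>y\<in>H. x \<noteq> y \<longrightarrow> c {x, y} = i)"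
proof -
  have "(\<forall>X\<in>nsets H 2. c X = i) \<longleftrightarrow> (\<forall>x\<in>H. \<forall>y\<in>H. x \<noteq> y \<longrightarrow> c {x, y} = i)" for i
  proof safe
    fix x y assume "\<forall>X\<in>nsets H 2. c X = i" "x \<in> H" "y \<in> H" "x \<noteq> y"
    moreover from this have "{x, y} \<in> nsets H 2" by (simp add: nsets_def)
    ultimately show "c {x, y} = i" by blast
  qed (auto simp: nsets_def card_2_iff)
  then show ?thesis by (simp add: homogeneous_sets_def)
qed

lemma sols_SRT22:
  assumes "p \<in> insts SRT22"
  shows "g \<in> sols SRT22 p \<longleftrightarrow> (\<exists>H. g = indicator H \<and> infinite H \<and>
    (\<exists>i. \<forall>x\<in>H. \<forall>y\<in>H. x \<noteq> y \<longrightarrow> column p x y = i))"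
proof -
  have *: "H \<in> homogeneous_sets c \<longleftrightarrow>
      infinite H \<and> (\<exists>i. \<forall>x\<in>H. \<forall>y\<in>H. x \<noteq> y \<longrightarrow> column (code_pairfun c) x y = i)" for H c
    by (simp add: homogeneous_sets_iff column_code_pairfun cong: conj_cong)
  from assms show ?thesis
    by (auto simp: SRT22_def coded_problem_def *)
qed

theorem not_SRT22_le_wRSgr: "\<not> SRT22 \<le>\<^sub>W wRSgr"
proof (rule not_le_wRSgr_columns[where I = "insts SRT22" and col = column and rk = "\<lambda>i p n. i \<le> n"])
  have "(\<lambda>_. 0) \<in> insts SRT22" by (simp add: insts_SRT22 column_def)
  then show "insts SRT22 \<noteq> {}" by blast
  fix p :: "nat \<Rightarrow> baire" and n
  assume p: "\<And>i. p i \<in> insts SRT22" "\<And>i. i \<le> n i"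
    "\<And>i j e. i \<le> j \<Longrightarrow> e < n i \<Longrightarrow> column (p j) e = column (p i) e"
  define r where "r = glue (\<lambda>e. column (p (Suc e)) e)"
  have r: "column r e = column (p i) e" if "e < n i" for e i
    using limit_columns[of n p, OF p(2,3) that] by (simp add: r_def)
  have "column r x y = column r y x \<and> column r x y \<le> 1" for x y
  proof -
    have "x < n (Suc (max x y)) \<and> y < n (Suc (max x y))"
      using p(2)[of "Suc (max x y)"] by (simp add: Suc_le_eq)
    then have "column r x = column (p (Suc (max x y))) x" "column r y = column (p (Suc (max x y))) y"
      by (auto intro: r)
    then show ?thesis using p(1) by (simp add: insts_SRT22)
  qed
  moreover have "column r x x = 0 \<and> (\<exists>i. eventually (\<lambda>s. column r x s = i) sequentially)" for x
  proof -
    have "column r x = column (p (Suc x)) x" by (simp add: r_def)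
    then show ?thesis using iffD1[OF insts_SRT22 p(1)[of "Suc x"]] by metis
  qed
  ultimately have "r \<in> insts SRT22" by (simp add: insts_SRT22)
  then show "\<exists>r\<in>insts SRT22. \<forall>i. \<forall>e<n i. column r e = column (p i) e" using r by blast
next
  fix p g n0 assume p: "p \<in> insts SRT22" and g: "g \<in> sols SRT22 p"
  from p have p': "\<And>x y. column p x y = column p y x" "\<And>x y. column p x y \<le> 1" "\<And>x. column p x x = 0"
    "\<And>x. \<exists>i. eventually (\<lambda>s. column p x s = i) sequentially" by (simp_all add: insts_SRT22)
  from g obtain H i where H: "g = indicator H" "infinite H"
    "\<And>x y. x \<in> H \<Longrightarrow> y \<in> H \<Longrightarrow> x \<noteq> y \<Longrightarrow> column p x y = i"
    by (auto simp: sols_SRT22[OF p])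
  \<comment> \<open>Both \<open>x\<close> and \<open>y\<close> are taken outside the promised
    columns, so their colours with large numbers may be changed.\<close>
  obtain x where x: "x \<in> H" "x \<ge> n0" using H(2) by (metis infinite_nat_iff_unbounded_le)
  obtain y where y: "y \<in> H" "y > x" using H(2) by (metis infinite_nat_iff_unbounded)
  have i: "column p x y = i" "i \<le> 1" using H(3)[of x y] x y p'(2)[of x y] by auto
  have "\<exists>r\<in>insts SRT22. \<exists>M. agree m p r \<and> (\<forall>e<n0. column r e = column p e) \<and>
      (\<forall>q\<in>insts SRT22. (\<forall>e<M. column q e = column r e) \<longrightarrow>
        (\<forall>g'\<in>sols SRT22 q. \<not> agree (Suc y) g g'))" for m
  proof -
    define k where "k = max m (Suc y)"
    \<comment> \<open>The pair of \<open>x\<close> and \<open>y\<close> keeps its colour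
      \<open>i\<close>, but each of them gets colour \<open>1 - i\<close> with everything from
      \<open>k\<close> on. No infinite homogeneous set contains both. Other columns change at two
      places only, so stability survives.\<close>
    define r where "r = glue (\<lambda>a b. if (a \<in> {x, y} \<and> b \<ge> k) \<or> (b \<in> {x, y} \<and> a \<ge> k) then 1 - i
      else column p a b)"
    have r: "column r a b = (if (a \<in> {x, y} \<and> b \<ge> k) \<or> (b \<in> {x, y} \<and> a \<ge> k) then 1 - i
      else column p a b)" for a b by (simp add: r_def)
    have "\<exists>i. eventually (\<lambda>s. column r a s = i) sequentially" for a
    proof (cases "a \<in> {x, y}")
      case True
      have "eventually (\<lambda>s. column r a s = 1 - i) sequentially"
        using eventually_ge_at_top[of k] by eventually_elim (use True in \<open>simp add: r\<close>)
      then show ?thesis ..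
    next
      case False
      obtain j where "eventually (\<lambda>s. column p a s = j) sequentially" using p'(4) by blast
      then have "eventually (\<lambda>s. column r a s = j) sequentially"
        using eventually_gt_at_top[of y] by eventually_elim (use False y in \<open>simp add: r\<close>)
      then show ?thesis ..
    qed
    then have r_inst: "r \<in> insts SRT22"
      using p'(1-3) y(2) by (auto simp: insts_SRT22 r k_def)
    have "agree m p r"
      unfolding agree_pairs
    proof (intro allI impI)
      fix a b assume "prod_encode (a, b) < m"
      then have "a < k" "b < k"
        using prod_encode_ge[of a b] prod_encode_ge[of b a] le_less_trans unfolding k_def by fastforce+
      then have "column p a b = column r a b" by (simp add: r)
      then show "p (prod_encode (a, b)) = r (prod_encode (a, b))" by (simp add: column_def)
    qed
    moreover have "column r e = column p e" if "e < n0" for e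
      using that x y by (auto simp: r k_def fun_eq_iff)
    moreover have "\<not> agree (Suc y) g g'"
      if q: "q \<in> insts SRT22" "\<forall>e<Suc y. column q e = column r e" "g' \<in> sols SRT22 q" for q g'
    proof
      assume agr: "agree (Suc y) g g'"
      from q(3) obtain H' i' where H': "g' = indicator H'" "infinite H'"
        "\<And>x y. x \<in> H' \<Longrightarrow> y \<in> H' \<Longrightarrow> x \<noteq> y \<Longrightarrow> column q x y = i'"
        by (auto simp: sols_SRT22[OF q(1)])
      have "H \<inter> {..<Suc y} = H' \<inter> {..<Suc y}" using agr by (simp add: H(1) H'(1) agree_indicator)
      then have "z \<in> H'" if "z \<in> H" "z < Suc y" for z using that by blast
      then have xy: "x \<in> H'" "y \<in> H'" using x(1) y by simp_all
      have col: "column q x = column r x" using q(2) y(2) by simp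
      obtain s where s: "s \<in> H'" "s \<ge> k" using H'(2) by (metis infinite_nat_iff_unbounded_le)
      have "x \<noteq> s" using s(2) y(2) by (auto simp: k_def)
      then have "i' = 1 - i" using H'(3)[OF xy(1) s(1)] s(2) by (simp add: col r)
      moreover have "i' = i" using H'(3)[OF xy] y(2) i(1) by (simp add: col r k_def)
      ultimately show False using i(2) by arith
    qed
    ultimately show ?thesis using r_inst by blast
  qed
  then show "\<exists>n. \<forall>m. \<exists>r\<in>insts SRT22. \<exists>M. agree m p r \<and> (\<forall>e<n0. column r e = column p e) \<and>
      (\<forall>q\<in>insts SRT22. (\<forall>e<M. column q e = column r e) \<longrightarrow>
        (\<forall>g'\<in>sols SRT22 q. \<not> agree n g g'))" by blast
next
  show "\<exists>n'\<ge>n. m \<le> n'" for m n :: nat by (intro exI[of _ "max n m"]) auto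
qed (auto intro: agree_columns)

subsection \<open>Orders of type \<open>\<omega> + \<omega>\<^sup>*\<close>\<close>

text \<open>An infinite linear order with finite initial segments is a copy of the natural numbers;
  the isomorphism counts predecessors.\<close>

lemma card_below:
  assumes R: "trans R" "irrefl R" "total_on A R" and inf: "infinite A"
    and fin: "\<And>x. x \<in> A \<Longrightarrow> finite {y \<in> A. (y, x) \<in> R}"
  defines "f \<equiv> \<lambda>x. card {y \<in> A. (y, x) \<in> R}"
  shows "bij_betw f A UNIV" and "x \<in> A \<Longrightarrow> y \<in> A \<Longrightarrow> (x, y) \<in> R \<longleftrightarrow> f x < f y"
proof -
  have mono: "f x < f y" if "x \<in> A" "y \<in> A" "(x, y) \<in> R" for x y
    unfolding f_def
  proof (rule psubset_card_mono[OF fin])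
    show "{z \<in> A. (z, x) \<in> R} \<subset> {z \<in> A. (z, y) \<in> R}"
      using that transD[OF R(1)] R(2) by (auto simp: irrefl_def)
  qed fact
  show iff: "(x, y) \<in> R \<longleftrightarrow> f x < f y" if "x \<in> A" "y \<in> A" for x y
    using mono that R(3) unfolding total_on_def by (metis less_asym less_irrefl)
  have inj: "inj_on f A"
    using R(3) iff unfolding inj_on_def total_on_def by (metis less_irrefl)
  have "n \<in> f ` A" for n
  proof -
    have "infinite (f ` A)" using inj inf finite_imageD by blast
    then obtain x where x: "x \<in> A" "f x > n" by (metis imageE infinite_nat_iff_unbounded)
    \<comment> \<open>The predecessors of \<open>x\<close> have distinct ranks below
      \<open>f x\<close>, and there are exactly \<open>f x\<close> of them; so every smaller rank,
      in particular \<open>n\<close>, is attained.\<close>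
    have "f ` {y \<in> A. (y, x) \<in> R} \<subseteq> {..<f x}" using mono x(1) by auto
    moreover have "card (f ` {y \<in> A. (y, x) \<in> R}) = card {y \<in> A. (y, x) \<in> R}"
      by (rule card_image) (rule inj_on_subset[OF inj], blast)
    then have "card (f ` {y \<in> A. (y, x) \<in> R}) = f x" by (simp add: f_def)
    ultimately have "f ` {y \<in> A. (y, x) \<in> R} = {..<f x}" by (intro card_subset_eq) auto
    then show ?thesis using x(2) by blast
  qed
  then show "bij_betw f A UNIV" using inj by (auto simp: bij_betw_def)
qed

text \<open>Replaces the isomorphism by finiteness conditions that can be controlled element by
  element. Conversely, the elements with finitely many predecessors form the lower half, the others
  the upper half under the reversed order, and \<open>card_below\<close> ranks each half.\<close>

lemma type_omega_omega_star_iff: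
  assumes R: "strict_linear_order_on L R" and inf: "infinite L"
  shows "type_omega_omega_star L R \<longleftrightarrow>
    (\<forall>x\<in>L. finite {y \<in> L. (y, x) \<in> R} \<or> finite {y \<in> L. (x, y) \<in> R}) \<and>
    infinite {x \<in> L. finite {y \<in> L. (y, x) \<in> R}} \<and> infinite {x \<in> L. finite {y \<in> L. (x, y) \<in> R}}"
    (is "_ \<longleftrightarrow> ?R")
proof
  assume "type_omega_omega_star L R"
  then obtain \<phi> :: "nat \<Rightarrow> nat + nat" where \<phi>: "bij_betw \<phi> L UNIV"
    "\<And>x y. x \<in> L \<Longrightarrow> y \<in> L \<Longrightarrow> (x, y) \<in> R \<longleftrightarrow> omega_omega_star_less (\<phi> x) (\<phi> y)"
    unfolding type_omega_omega_star_def by blast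
  have inj: "inj_on \<phi> L" using \<phi>(1) bij_betw_def by blast
  have l: "finite {y \<in> L. (y, x) \<in> R}" if "x \<in> L" "\<phi> x = Inl m" for x m
  proof -
    have "\<phi> y \<in> Inl ` {..<m}" if y: "y \<in> L" "(y, x) \<in> R" for y
      using \<phi>(2)[OF y(1) \<open>x \<in> L\<close>] y(2) \<open>\<phi> x = Inl m\<close> by (cases "\<phi> y") auto
    then have "\<phi> ` {y \<in> L. (y, x) \<in> R} \<subseteq> Inl ` {..<m}" by blast
    then have "finite (\<phi> ` {y \<in> L. (y, x) \<in> R})" using finite_subset by blast
    then show ?thesis by (rule finite_imageD) (rule inj_on_subset[OF inj], blast)
  qed
  have r: "finite {y \<in> L. (x, y) \<in> R}" if "x \<in> L" "\<phi> x = Inr m" for x m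
  proof -
    have "\<phi> y \<in> Inr ` {..<m}" if y: "y \<in> L" "(x, y) \<in> R" for y
      using \<phi>(2)[OF \<open>x \<in> L\<close> y(1)] y(2) \<open>\<phi> x = Inr m\<close> by (cases "\<phi> y") auto
    then have "\<phi> ` {y \<in> L. (x, y) \<in> R} \<subseteq> Inr ` {..<m}" by blast
    then have "finite (\<phi> ` {y \<in> L. (x, y) \<in> R})" using finite_subset by blast
    then show ?thesis by (rule finite_imageD) (rule inj_on_subset[OF inj], blast)
  qed
  have surj: "\<exists>x\<in>L. \<phi> x = z" for z using \<phi>(1) by (metis UNIV_I bij_betw_def imageE)
  have "range Inl \<subseteq> \<phi> ` {x \<in> L. finite {y \<in> L. (y, x) \<in> R}}"
    using surj l by (metis (mono_tags, lifting) image_eqI imageE mem_Collect_eq subsetI)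
  then have "infinite {x \<in> L. finite {y \<in> L. (y, x) \<in> R}}"
    by (meson finite_imageI finite_subset inj_Inl infinite_UNIV_nat range_inj_infinite)
  moreover have "range Inr \<subseteq> \<phi> ` {x \<in> L. finite {y \<in> L. (x, y) \<in> R}}"
    using surj r by (metis (mono_tags, lifting) image_eqI imageE mem_Collect_eq subsetI)
  then have "infinite {x \<in> L. finite {y \<in> L. (x, y) \<in> R}}"
    by (meson finite_imageI finite_subset inj_Inr infinite_UNIV_nat range_inj_infinite)
  moreover have "finite {y \<in> L. (y, x) \<in> R} \<or> finite {y \<in> L. (x, y) \<in> R}" if "x \<in> L" for x
    using l[OF that] r[OF that] by (cases "\<phi> x") auto
  ultimately show ?R by blast
next
  assume fin: ?R
  have R': "trans R" "irrefl R" "total_on L R" using R by (auto simp: strict_linear_order_on_def)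
  define A where "A = {x \<in> L. finite {y \<in> L. (y, x) \<in> R}}"
  define f where "f = (\<lambda>x. card {y \<in> A. (y, x) \<in> R})"
  define g where "g = (\<lambda>x. card {y \<in> L - A. (y, x) \<in> R\<inverse>})"
  have "L \<subseteq> {y \<in> L. (y, x) \<in> R} \<union> {y \<in> L. (x, y) \<in> R} \<union> {x}" if "x \<in> L" for x
    using R'(3) that by (auto simp: total_on_def)
  then have not_both: "infinite {y \<in> L. (y, x) \<in> R} \<or> infinite {y \<in> L. (x, y) \<in> R}" if "x \<in> L" for x
    using inf that by (meson finite.emptyI finite.insertI finite_UnI finite_subset)
  then have "{x \<in> L. finite {y \<in> L. (x, y) \<in> R}} \<subseteq> L - A" by (auto simp: A_def)
  then have infB: "infinite (L - A)" using fin finite_subset by blast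
  have sub: "A \<subseteq> L" by (auto simp: A_def)
  have tot: "total_on A R" "total_on (L - A) (R\<inverse>)"
    using R'(3) sub by (auto simp: total_on_def)
  have "infinite A" using fin by (simp add: A_def)
  moreover have "finite {y \<in> A. (y, x) \<in> R}" if "x \<in> A" for x
  proof -
    have "finite {y \<in> L. (y, x) \<in> R}" using that by (simp add: A_def)
    then show ?thesis by (rule finite_subset[rotated]) (use sub in auto)
  qed
  ultimately have f: "bij_betw f A UNIV" "\<And>x y. x \<in> A \<Longrightarrow> y \<in> A \<Longrightarrow> (x, y) \<in> R \<longleftrightarrow> f x < f y"
    using card_below[OF R'(1,2) tot(1)] unfolding f_def by blast+
  have R'': "trans (R\<inverse>)" "irrefl (R\<inverse>)" using R'(1,2) by (auto simp: irrefl_def)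
  have "finite {y \<in> L - A. (y, x) \<in> R\<inverse>}" if "x \<in> L - A" for x
  proof -
    have "finite {y \<in> L. (x, y) \<in> R}" using fin that by (auto simp: A_def)
    then show ?thesis by (rule finite_subset[rotated]) auto
  qed
  then have g: "bij_betw g (L - A) UNIV"
    "\<And>x y. x \<in> L - A \<Longrightarrow> y \<in> L - A \<Longrightarrow> (x, y) \<in> R\<inverse> \<longleftrightarrow> g x < g y"
    using card_below[OF R'' tot(2) infB] unfolding g_def by blast+
  have AB: "(x, y) \<in> R" "(y, x) \<notin> R" if x: "x \<in> A" and y: "y \<in> L - A" for x y
  proof -
    show "(y, x) \<notin> R"
    proof
      assume "(y, x) \<in> R"
      then have "{z \<in> L. (z, y) \<in> R} \<subseteq> {z \<in> L. (z, x) \<in> R}" using transD[OF R'(1)] by blast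
      then show False using x y finite_subset by (auto simp: A_def)
    qed
    then show "(x, y) \<in> R" using R'(3) x y sub by (auto simp: total_on_def)
  qed
  define \<phi> where "\<phi> x = (if x \<in> A then Inl (f x) else Inr (g x))" for x
  have "bij_betw \<phi> A (range Inl)"
    using bij_betw_trans[OF f(1) inj_on_imp_bij_betw[OF inj_Inl]]
    by (rule bij_betw_cong[THEN iffD1, rotated]) (simp add: \<phi>_def)
  moreover have "bij_betw \<phi> (L - A) (range Inr)"
    using bij_betw_trans[OF g(1) inj_on_imp_bij_betw[OF inj_Inr]]
    by (rule bij_betw_cong[THEN iffD1, rotated]) (simp add: \<phi>_def)
  ultimately have "bij_betw \<phi> (A \<union> (L - A)) (range Inl \<union> range Inr)"
    by (rule bij_betw_combine) auto
  moreover have "A \<union> (L - A) = L" using sub by blast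
  moreover have "range Inl \<union> range Inr = (UNIV :: (nat + nat) set)" by (simp add: UNIV_sum)
  ultimately have "bij_betw \<phi> L UNIV" by simp
  moreover have "(x, y) \<in> R \<longleftrightarrow> omega_omega_star_less (\<phi> x) (\<phi> y)" if "x \<in> L" "y \<in> L" for x y
    using f(2)[of x y] g(2)[of y x] AB[of x y] AB[of y x] that by (auto simp: \<phi>_def)
  ultimately show "type_omega_omega_star L R" unfolding type_omega_omega_star_def by blast
qed

lemma sols_SADC:
  assumes "(L, R) \<in> SADC_orders"
  shows "sols SADC (code_order (L, R)) =
    indicator ` {C. C \<subseteq> L \<and> infinite C \<and> (ascending_chain R C \<or> descending_chain R C)}"
  by (simp add: SADC_def sols_coded_problem[OF inj_on_subset[OF inj_code_order subset_UNIV] assms])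

lemma code_order_in: "code_order (L, R) (2 * x) = of_bool (x \<in> L)"
  by (simp add: code_order_def indicator_def)

lemma code_order_less: "code_order (L, R) (Suc (2 * prod_encode (x, y))) = of_bool ((x, y) \<in> R)"
  by (simp add: code_order_def code_relation_def indicator_def inj_image_mem_iff[OF inj_prod_encode])

lemma column_code_order: "column (right (code_order (L, R))) x y = of_bool ((x, y) \<in> R)"
  by (simp add: column_def right_def code_order_less)

text \<open>Up to \<open>x\<close> itself, the predecessors of \<open>x\<close> are the complement
  of its successors. So the side of the cut on which \<open>x\<close> lies can be read off the
  column of \<open>x\<close> alone.\<close>

lemma SADC_orders_UNIV:
  assumes R: "strict_linear_order_on UNIV R"
  shows "(UNIV, R) \<in> SADC_orders \<longleftrightarrow> (\<forall>x. finite {y. (x, y) \<notin> R} \<or> finite {y. (x, y) \<in> R}) \<and>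
    infinite {x. finite {y. (x, y) \<notin> R}} \<and> infinite {x. finite {y. (x, y) \<in> R}}"
proof -
  have "{y. (x, y) \<notin> R} = insert x {y. (y, x) \<in> R}" for x
    using R by (auto simp: strict_linear_order_on_def irrefl_def total_on_def trans_def)
  then show ?thesis
    using R type_omega_omega_star_iff[OF R infinite_UNIV_nat] by (simp add: SADC_orders_def)
qed

lemma infinite_card_below:
  assumes "infinite (A :: nat set)"
  shows "\<exists>n0. \<forall>n\<ge>n0. m \<le> card (A \<inter> {..<n})"
proof -
  obtain B where B: "B \<subseteq> A" "finite B" "card B = m"
    using infinite_arbitrarily_large[OF assms] by blast
  then obtain n0 where n0: "\<forall>b\<in>B. b < n0" using finite_nat_set_iff_bounded by blast
  have "m \<le> card (A \<inter> {..<n})" if "n \<ge> n0" for n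
  proof -
    have "B \<subseteq> A \<inter> {..<n}" using B(1) n0 that less_le_trans by blast
    then show ?thesis using B(3) card_mono[of "A \<inter> {..<n}" B] by simp
  qed
  then show ?thesis by blast
qed

text \<open>Moves the cut of the order between \<open>x\<close> and \<open>y\<close>: all elements beyond \<open>k\<close> that lie strictly
  between the finite sets \<open>Bl\<close> and \<open>Ab\<close> are put there.\<close>

lemma move_cut:
  assumes R: "(UNIV, R) \<in> SADC_orders"
    and Bl: "finite Bl" "\<And>u v. (u, v) \<in> R \<Longrightarrow> v \<in> Bl \<Longrightarrow> u \<in> Bl"
    and Ab: "finite Ab" "\<And>u v. (u, v) \<in> R \<Longrightarrow> u \<in> Ab \<Longrightarrow> v \<in> Ab"
    and disj: "Bl \<inter> Ab = {}"
    and xy: "x \<notin> Bl" "x \<notin> Ab" "y \<notin> Bl" "y \<notin> Ab" "(x, y) \<in> R" "x < k" "y < k"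
  shows "\<exists>R'. (UNIV, R') \<in> SADC_orders \<and>
    (\<forall>u v. u \<in> Bl \<union> Ab \<or> u < k \<and> v < k \<longrightarrow> ((u, v) \<in> R' \<longleftrightarrow> (u, v) \<in> R)) \<and>
    finite {v. (x, v) \<notin> R' \<or> (v, y) \<notin> R'}"
proof -
  have lin: "strict_linear_order_on UNIV R" using R by (simp add: SADC_orders_def)
  then have tr: "trans R" and irr: "irrefl R" and tot: "\<And>u v. u \<noteq> v \<Longrightarrow> (u, v) \<in> R \<or> (v, u) \<in> R"
    by (auto simp: strict_linear_order_on_def total_on_def)
  have asym: "(v, u) \<notin> R" if "(u, v) \<in> R" for u v
    using that tr irr by (metis irrefl_def transD)
  note R_type = R[unfolded SADC_orders_UNIV[OF lin]]
  \<comment> \<open>Five consecutive layers: \<open>Bl\<close>, then the small elements up to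
    \<open>x\<close>, then all large elements, then the remaining small elements including
    \<open>y\<close>, then \<open>Ab\<close>. The new order compares layers first and uses
    \<open>R\<close> inside a layer.\<close>
  define cl :: "nat \<Rightarrow> nat" where "cl u = (if u \<in> Bl then 0 else if u \<in> Ab then 4 else
    if u \<ge> k then 2 else if u = x \<or> (u, x) \<in> R then 1 else 3)" for u
  define R' where "R' = {(u, v). cl u < cl v \<or> cl u = cl v \<and> (u, v) \<in> R}"
  have R'_iff: "(u, v) \<in> R' \<longleftrightarrow> cl u < cl v \<or> cl u = cl v \<and> (u, v) \<in> R" for u v by (simp add: R'_def)
  have lin': "strict_linear_order_on UNIV R'"
    unfolding strict_linear_order_on_def
  proof (intro conjI)
    show "trans R'" using transD[OF tr] by (auto simp: trans_def R'_def)
    show "irrefl R'" using irr by (auto simp: irrefl_def R'_def)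
    show "total_on UNIV R'" using tot by (auto simp: total_on_def R'_def)
  qed
  have cls: "cl u \<in> {0, 1, 2, 3, 4}" for u by (simp add: cl_def)
  have fin_not2: "finite {u. cl u \<noteq> 2}"
  proof (rule finite_subset)
    show "{u. cl u \<noteq> 2} \<subseteq> Bl \<union> Ab \<union> {..<k}" by (auto simp: cl_def)
  qed (use Bl(1) Ab(1) in simp)
  have cl_xy: "cl x = 1" "cl y = 3"
    using xy asym[OF xy(5)] irr by (auto simp: cl_def irrefl_def)
  \<comment> \<open>Layers contradict \<open>R\<close> only for pairs of a large and a small
    element, both outside \<open>Bl\<close> and \<open>Ab\<close>.\<close>
  have consistent: "(u, v) \<in> R"
    if lt: "cl u < cl v" and uv: "u \<in> Bl \<union> Ab \<or> v \<in> Bl \<union> Ab \<or> u < k \<and> v < k" for u v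
  proof -
    have "u \<noteq> v" using lt by auto
    moreover have "(v, u) \<notin> R"
    proof
      assume vu: "(v, u) \<in> R"
      have "u \<notin> Bl" using Bl(2)[OF vu] lt by (auto simp: cl_def split: if_splits)
      moreover have "v \<notin> Bl" using lt by (auto simp: cl_def)
      moreover have "v \<notin> Ab" using Ab(2)[OF vu] lt disj by (auto simp: cl_def split: if_splits)
      moreover have "u \<notin> Ab" using lt cls[of v] calculation by (auto simp: cl_def split: if_splits)
      ultimately have "u = x \<or> (u, x) \<in> R" "\<not> (v = x \<or> (v, x) \<in> R)"
        using lt uv by (auto simp: cl_def split: if_splits)
      then show False using vu transD[OF tr] by blast
    qed
    ultimately show ?thesis using tot by blast
  qed
  have same: "(u, v) \<in> R' \<longleftrightarrow> (u, v) \<in> R" if "u \<in> Bl \<union> Ab \<or> u < k \<and> v < k" for u v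
    using consistent[of u v] consistent[of v u] that asym[of u v] unfolding R'_iff
    by (metis nat_neq_iff)
  \<comment> \<open>Almost all elements are in layer 2. Hence lower layers lie in the new lower
    half, higher layers in the new upper half, and elements of layer 2 stay on their side.\<close>
  have fin_lo: "finite {v. (u, v) \<notin> R'}" if "cl u < 2 \<or> cl u = 2 \<and> finite {v. (u, v) \<notin> R}" for u
  proof (rule finite_subset)
    show "{v. (u, v) \<notin> R'} \<subseteq> {v. cl v \<noteq> 2} \<union> (if cl u = 2 then {v. (u, v) \<notin> R} else {})"
      using that by (auto simp: R'_iff)
    show "finite ({v. cl v \<noteq> 2} \<union> (if cl u = 2 then {v. (u, v) \<notin> R} else {}))"
      using that fin_not2 by auto
  qed
  have fin_hi: "finite {v. (u, v) \<in> R'}" if "cl u > 2 \<or> cl u = 2 \<and> finite {v. (u, v) \<in> R}" for u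
  proof (rule finite_subset)
    show "{v. (u, v) \<in> R'} \<subseteq> {v. cl v \<noteq> 2} \<union> (if cl u = 2 then {v. (u, v) \<in> R} else {})"
      using that by (auto simp: R'_iff)
    show "finite ({v. cl v \<noteq> 2} \<union> (if cl u = 2 then {v. (u, v) \<in> R} else {}))"
      using that fin_not2 by auto
  qed
  have "finite {v. (u, v) \<notin> R'} \<or> finite {v. (u, v) \<in> R'}" for u
    using fin_lo[of u] fin_hi[of u] R_type by (metis nat_neq_iff)
  moreover have "infinite {u. finite {v. (u, v) \<notin> R'}}"
  proof
    assume "finite {u. finite {v. (u, v) \<notin> R'}}"
    then have "finite ({u. finite {v. (u, v) \<notin> R'}} \<union> {u. cl u \<noteq> 2})" using fin_not2 by simp
    moreover have "{u. finite {v. (u, v) \<notin> R}} \<subseteq> {u. finite {v. (u, v) \<notin> R'}} \<union> {u. cl u \<noteq> 2}"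
      using fin_lo by auto
    ultimately show False using R_type finite_subset by blast
  qed
  moreover have "infinite {u. finite {v. (u, v) \<in> R'}}"
  proof
    assume "finite {u. finite {v. (u, v) \<in> R'}}"
    then have "finite ({u. finite {v. (u, v) \<in> R'}} \<union> {u. cl u \<noteq> 2})" using fin_not2 by simp
    moreover have "{u. finite {v. (u, v) \<in> R}} \<subseteq> {u. finite {v. (u, v) \<in> R'}} \<union> {u. cl u \<noteq> 2}"
      using fin_hi by auto
    ultimately show False using R_type finite_subset by blast
  qed
  ultimately have "(UNIV, R') \<in> SADC_orders" unfolding SADC_orders_UNIV[OF lin'] by blast
  moreover have "finite {v. (x, v) \<notin> R' \<or> (v, y) \<notin> R'}"
    by (rule finite_subset[OF _ fin_not2]) (auto simp: R'_iff cl_xy)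
  ultimately show ?thesis using same by (intro exI[of _ R'] conjI allI impI)
qed

theorem not_SADC_le_wRSgr: "\<not> SADC \<le>\<^sub>W wRSgr"
proof -
  define col where "col p = column (right p)" for p
  define I where "I = {code_order (UNIV, R) | R. (UNIV, R) \<in> SADC_orders}"
  define lo where "lo p = {a. finite {s. col p a s = 0}}" for p
  define hi where "hi p = {a. finite {s. col p a s \<noteq> 0}}" for p
  \<comment> \<open>A limit of orders could lose one half. Rank \<open>m\<close> freezes at least
    \<open>m\<close> columns from each half, which makes both halves of the limit infinite.\<close>
  define rk where "rk m p n \<longleftrightarrow> m \<le> n \<and> m \<le> card (lo p \<inter> {..<n}) \<and> m \<le> card (hi p \<inter> {..<n})"
    for m n :: nat and p
  have col: "col (code_order (UNIV, R)) a b = of_bool ((a, b) \<in> R)" for R a b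
    by (simp add: col_def column_code_order)
  have lo: "lo (code_order (UNIV, R)) = {a. finite {b. (a, b) \<notin> R}}"
    and hi: "hi (code_order (UNIV, R)) = {a. finite {b. (a, b) \<in> R}}" for R
    by (simp_all add: lo_def hi_def col)
  have lin: "strict_linear_order_on UNIV R" if "(UNIV, R) \<in> SADC_orders" for R
    using that by (simp add: SADC_orders_def)
  have type: "finite {b. (a, b) \<notin> R} \<or> finite {b. (a, b) \<in> R}"
    "infinite {x. finite {y. (x, y) \<notin> R}}" "infinite {x. finite {y. (x, y) \<in> R}}"
    if "(UNIV, R) \<in> SADC_orders" for R a
    using that SADC_orders_UNIV[OF lin[OF that]] by auto
  show ?thesis
  proof (rule not_le_wRSgr_columns[where I = I and col = col and rk = rk])
    show "I \<subseteq> insts SADC" by (auto simp: I_def SADC_def)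
    show "rk i p n" if "rk j p n" "i \<le> j" for i j p n using that by (auto simp: rk_def)
    show "\<exists>n'\<ge>n. rk m p n'" if "p \<in> I" for p m n
    proof -
      from that have "infinite (lo p)" "infinite (hi p)" using type(2,3) by (auto simp: I_def lo hi)
      then obtain n1 n2 where "\<forall>n\<ge>n1. m \<le> card (lo p \<inter> {..<n})" "\<forall>n\<ge>n2. m \<le> card (hi p \<inter> {..<n})"
        using infinite_card_below by metis
      then show ?thesis by (intro exI[of _ "max (max n m) (max n1 n2)"]) (auto simp: rk_def)
    qed
    show "agree m p q" if "p \<in> I" "q \<in> I" "\<And>e. e < m \<Longrightarrow> col q e = col p e" for p q m
    proof (rule agree_even_odd)
      show "p (2 * a) = q (2 * a)" for a using that(1,2) by (auto simp: I_def code_order_in)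
      show "p (Suc (2 * prod_encode (a, b))) = q (Suc (2 * prod_encode (a, b)))" if "a < m" for a b
        using fun_cong[OF \<open>\<And>e. e < m \<Longrightarrow> col q e = col p e\<close>[OF that], of b]
        by (simp add: col_def column_def right_def)
    qed
  next
    fix p :: "nat \<Rightarrow> baire" and n
    assume p: "\<And>i. p i \<in> I" and rk: "\<And>i. rk i (p i) (n i)"
      and eq: "\<And>i j e. i \<le> j \<Longrightarrow> e < n i \<Longrightarrow> col (p j) e = col (p i) e"
    have "\<forall>i. \<exists>R. p i = code_order (UNIV, R) \<and> (UNIV, R) \<in> SADC_orders" using p by (auto simp: I_def)
    from choice[OF this] obtain S where S: "\<And>i. p i = code_order (UNIV, S i)"
      "\<And>i. (UNIV, S i) \<in> SADC_orders" by blast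
    have n: "i \<le> n i" for i using rk by (simp add: rk_def)
    \<comment> \<open>The limit order reads the successors of \<open>a\<close> at a stage where the
      column of \<open>a\<close> is frozen.\<close>
    define R where "R = {(a, b). (a, b) \<in> S (Suc a)}"
    have R: "(a, b) \<in> R \<longleftrightarrow> (a, b) \<in> S i" if "a < n i" for a b i
    proof -
      have "a < n (Suc a)" using n[of "Suc a"] by simp
      then have "col (p (Suc a)) a = col (p (max i (Suc a))) a"
        using eq[of "Suc a" "max i (Suc a)" a] by simp
      also have "\<dots> = col (p i) a" using eq[of i "max i (Suc a)" a] that by simp
      finally show ?thesis by (auto simp: S(1) col fun_eq_iff R_def of_bool_eq_iff)
    qed
    have S_lin: "trans (S i)" "irrefl (S i)" "total_on UNIV (S i)" for i
      using lin[OF S(2)] by (auto simp: strict_linear_order_on_def)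
    have lin_R: "strict_linear_order_on UNIV R"
      unfolding strict_linear_order_on_def
    proof (intro conjI)
      have big: "a < n (Suc (a + b))" "b < n (Suc (a + b))" for a b
        using n[of "Suc (a + b)"] by linarith+
      show "trans R"
      proof (rule transI)
        fix a b c assume "(a, b) \<in> R" "(b, c) \<in> R"
        then show "(a, c) \<in> R"
          using R[OF big(1)[of a b]] R[OF big(2)[of b a]] S_lin(1) transD by (metis add.commute)
      qed
      show "irrefl R" using R[OF big(1)] S_lin(2) by (auto simp: irrefl_def R_def)
      show "total_on UNIV R"
        using R[OF big(1)] R[OF big(2)] S_lin(3) unfolding total_on_def by metis
    qed
    have col_R: "col (code_order (UNIV, R)) e = col (p i) e" if "e < n i" for e i
      using R[OF that] by (auto simp: S(1) col fun_eq_iff)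
    then have lohi: "lo (code_order (UNIV, R)) \<inter> {..<n i} = lo (p i) \<inter> {..<n i}"
      "hi (code_order (UNIV, R)) \<inter> {..<n i} = hi (p i) \<inter> {..<n i}" for i
      by (auto simp: lo_def hi_def)
    have large: "infinite A" if A: "\<And>i. i \<le> card (A \<inter> {..<n i})" for A
    proof
      assume "finite A"
      then have "card (A \<inter> {..<n (Suc (card A))}) \<le> card A" by (intro card_mono) auto
      then show False using A[of "Suc (card A)"] by simp
    qed
    have "finite {b. (a, b) \<notin> R} \<or> finite {b. (a, b) \<in> R}" for a
    proof -
      have "a < n (Suc a)" using n[of "Suc a"] by simp
      then show ?thesis using type(1)[OF S(2), of a "Suc a"] R by simp
    qed
    moreover have "infinite {x. finite {y. (x, y) \<notin> R}}" "infinite {x. finite {y. (x, y) \<in> R}}"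
      using rk unfolding rk_def lo[symmetric] hi[symmetric] by (intro large; simp add: lohi)+
    ultimately have "(UNIV, R) \<in> SADC_orders" unfolding SADC_orders_UNIV[OF lin_R] by blast
    then show "\<exists>r\<in>I. \<forall>i. \<forall>e<n i. col r e = col (p i) e"
      using col_R by (intro bexI[of _ "code_order (UNIV, R)"]) (auto simp: I_def)
  next
    fix p g n0 assume p: "p \<in> I" and g: "g \<in> sols SADC p"
    from p obtain R where R: "p = code_order (UNIV, R)" "(UNIV, R) \<in> SADC_orders" by (auto simp: I_def)
    from g obtain C where C: "g = indicator C" "infinite C" by (auto simp: R(1) sols_SADC[OF R(2)])
    have tr: "trans R" and irr: "irrefl R" and tot: "\<And>u v. u \<noteq> v \<Longrightarrow> (u, v) \<in> R \<or> (v, u) \<in> R"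
      using lin[OF R(2)] by (auto simp: strict_linear_order_on_def total_on_def)
    \<comment> \<open>\<open>Bl\<close> and \<open>Ab\<close> are the finite downward and upward
      closures of the promised elements of the lower and the upper half. Together they contain
      everything below \<open>n0\<close>, so moving the cut in the middle respects the
      promises.\<close>
    define Bl where "Bl = {u. \<exists>a<n0. finite {b. (a, b) \<notin> R} \<and> (a, u) \<notin> R}"
    define Ab where "Ab = {u. \<exists>a<n0. finite {b. (a, b) \<in> R} \<and> (u = a \<or> (a, u) \<in> R)}"
    have Bl_eq: "Bl = (\<Union>a\<in>{a. a < n0 \<and> finite {b. (a, b) \<notin> R}}. {b. (a, b) \<notin> R})" by (auto simp: Bl_def)
    have fin_Bl: "finite Bl" unfolding Bl_eq by (intro finite_UN_I) auto
    have Ab_eq: "Ab = (\<Union>a\<in>{a. a < n0 \<and> finite {b. (a, b) \<in> R}}. insert a {b. (a, b) \<in> R})" by (auto simp: Ab_def)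
    have fin_Ab: "finite Ab" unfolding Ab_eq by (intro finite_UN_I) auto
    have down: "u \<in> Bl" if "(u, v) \<in> R" "v \<in> Bl" for u v
      using that transD[OF tr] by (auto simp: Bl_def)
    have up: "v \<in> Ab" if "(u, v) \<in> R" "u \<in> Ab" for u v
      using that transD[OF tr] by (auto simp: Ab_def)
    have disj: "Bl \<inter> Ab = {}"
    proof (rule ccontr)
      assume "Bl \<inter> Ab \<noteq> {}"
      then obtain u a b where a: "finite {c. (a, c) \<notin> R}" "(a, u) \<notin> R"
        and b: "finite {c. (b, c) \<in> R}" "u = b \<or> (b, u) \<in> R" by (auto simp: Bl_def Ab_def)
      then have "b = a \<or> (b, a) \<in> R" using tot transD[OF tr] by metis
      then have "UNIV \<subseteq> {c. (a, c) \<notin> R} \<union> {c. (b, c) \<in> R}" using transD[OF tr] by blast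
      then show False using a(1) b(1) by (meson finite_UnI finite_subset infinite_UNIV_nat)
    qed
    have n0: "a \<in> Bl \<union> Ab" if "a < n0" for a
      using type(1)[OF R(2), of a] that irr by (auto simp: Bl_def Ab_def irrefl_def)
    have inf: "infinite (C - (Bl \<union> Ab))" using C(2) fin_Bl fin_Ab by simp
    then obtain x0 where x0: "x0 \<in> C - (Bl \<union> Ab)" using infinite_nat_iff_unbounded by blast
    obtain y0 where y0: "y0 \<in> C - (Bl \<union> Ab)" "y0 \<noteq> x0"
      using inf unfolding infinite_nat_iff_unbounded by (metis less_irrefl)
    obtain x y where xy: "x \<in> C - (Bl \<union> Ab)" "y \<in> C - (Bl \<union> Ab)" "(x, y) \<in> R"
      using x0 y0 tot by blast
    have "\<exists>r\<in>I. \<exists>M. agree m p r \<and> (\<forall>e<n0. col r e = col p e) \<and>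
      (\<forall>q\<in>I. (\<forall>e<M. col q e = col r e) \<longrightarrow> (\<forall>g'\<in>sols SADC q. \<not> agree (Suc (max x y)) g g'))" for m
    proof -
      define k where "k = max m (Suc (max x y))"
      have "x < k" "y < k" by (auto simp: k_def)
      with xy have "\<exists>R'. (UNIV, R') \<in> SADC_orders \<and>
          (\<forall>u v. u \<in> Bl \<union> Ab \<or> u < k \<and> v < k \<longrightarrow> ((u, v) \<in> R' \<longleftrightarrow> (u, v) \<in> R)) \<and>
          finite {v. (x, v) \<notin> R' \<or> (v, y) \<notin> R'}"
        by (intro move_cut[OF R(2) fin_Bl down fin_Ab up disj]) auto
      then obtain R' where R': "(UNIV, R') \<in> SADC_orders"
        "\<And>u v. u \<in> Bl \<union> Ab \<or> u < k \<and> v < k \<Longrightarrow> (u, v) \<in> R' \<longleftrightarrow> (u, v) \<in> R"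
        "finite {v. (x, v) \<notin> R' \<or> (v, y) \<notin> R'}"
        by blast
      define r where "r = code_order (UNIV, R')"
      have "r \<in> I" using R'(1) by (auto simp: I_def r_def)
      moreover have "(a, b) \<in> R' \<longleftrightarrow> (a, b) \<in> R" if "a < m" "b < m" for a b
        using R'(2)[of a b] that by (simp add: k_def less_max_iff_disj)
      then have "agree m p r"
        by (intro agree_even_odd) (simp_all add: R(1) r_def code_order_in code_order_less)
      moreover have "col r e = col p e" if "e < n0" for e
        using R'(2) n0[OF that] by (auto simp: R(1) r_def col fun_eq_iff)
      moreover have "\<not> agree (Suc (max x y)) g g'"
        if q: "q \<in> I" "\<forall>e<Suc (max x y). col q e = col r e" "g' \<in> sols SADC q" for q g'
      proof
        assume agr: "agree (Suc (max x y)) g g'"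
        from q(1) obtain Q where Q: "q = code_order (UNIV, Q)" "(UNIV, Q) \<in> SADC_orders"
          by (auto simp: I_def)
        from q(3) obtain C' where C': "g' = indicator C'" "infinite C'"
          "ascending_chain Q C' \<or> descending_chain Q C'" by (auto simp: Q(1) sols_SADC[OF Q(2)])
        have "C \<inter> {..<Suc (max x y)} = C' \<inter> {..<Suc (max x y)}"
          using agr by (simp add: C(1) C'(1) agree_indicator)
        then have "z \<in> C'" if "z \<in> C" "z < Suc (max x y)" for z using that by blast
        then have xC: "x \<in> C'" "y \<in> C'" using xy by simp_all
        have col_xy: "col q x = col r x" "col q y = col r y" using q(2) by auto
        have x: "(x, v) \<in> Q \<longleftrightarrow> (x, v) \<in> R'" and y: "(y, v) \<in> Q \<longleftrightarrow> (y, v) \<in> R'" for v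
          using fun_cong[OF col_xy(1), of v] fun_cong[OF col_xy(2), of v]
          by (auto simp: Q(1) r_def col of_bool_eq_iff)
        have Q_lin: "\<And>u v. u \<noteq> v \<Longrightarrow> (u, v) \<in> Q \<or> (v, u) \<in> Q" and R'_lin: "trans R'" "irrefl R'"
          using lin[OF Q(2)] lin[OF R'(1)] by (auto simp: strict_linear_order_on_def total_on_def)
        \<comment> \<open>After the move almost everything lies between \<open>x\<close> and
          \<open>y\<close>. A chain containing both would have infinitely many elements above
          \<open>x\<close> and infinitely many below \<open>y\<close>, so it is neither descending
          nor ascending.\<close>
        define D where "D = C' - insert y {v. (x, v) \<notin> R' \<or> (v, y) \<notin> R'}"
        have D: "infinite D" using C'(2) R'(3) by (simp add: D_def)
        have "D \<subseteq> {v \<in> C'. (x, v) \<in> Q}" by (auto simp: D_def x)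
        then have "\<not> descending_chain Q C'"
          using D xC(1) finite_subset by (auto simp: descending_chain_def)
        moreover have "(v, y) \<in> Q" if "v \<in> D" for v
        proof -
          have v: "(v, y) \<in> R'" "v \<noteq> y" using that by (auto simp: D_def)
          then have "(y, v) \<notin> R'" using R'_lin by (metis irrefl_def transD)
          then show ?thesis using Q_lin[OF v(2)] y by blast
        qed
        then have "D \<subseteq> {v \<in> C'. (v, y) \<in> Q}" by (auto simp: D_def)
        then have "\<not> ascending_chain Q C'"
          using D xC(2) finite_subset by (auto simp: ascending_chain_def)
        ultimately show False using C'(3) by blast
      qed
      ultimately show ?thesis by blast
    qed
    then show "\<exists>n. \<forall>m. \<exists>r\<in>I. \<exists>M. agree m p r \<and> (\<forall>e<n0. col r e = col p e) \<and>
      (\<forall>q\<in>I. (\<forall>e<M. col q e = col r e) \<longrightarrow> (\<forall>g'\<in>sols SADC q. \<not> agree n g g'))" by blast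
  next
    define \<phi> :: "nat \<Rightarrow> nat + nat" where "\<phi> = sum_decode"
    define R where "R = {(x, y). omega_omega_star_less (\<phi> x) (\<phi> y)}"
    have "bij \<phi>" unfolding \<phi>_def by (rule bij_sum_decode)
    moreover have "\<not> omega_omega_star_less a a" for a by (cases a) auto
    moreover have "omega_omega_star_less a c" if "omega_omega_star_less a b" "omega_omega_star_less b c"
      for a b c using that by (cases a; cases b; cases c) auto
    moreover have "omega_omega_star_less a b \<or> omega_omega_star_less b a" if "a \<noteq> b" for a b
      using that by (cases a; cases b) auto
    moreover have "\<phi> x \<noteq> \<phi> y" if "x \<noteq> y" for x y using \<open>bij \<phi>\<close> that by (metis bij_pointE)
    ultimately have "strict_linear_order_on UNIV R" "type_omega_omega_star UNIV R"
      unfolding strict_linear_order_on_def type_omega_omega_star_def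
      by (auto simp: R_def trans_def irrefl_def total_on_def)
    then have "code_order (UNIV, R) \<in> I" by (auto simp: I_def SADC_orders_def)
    then show "I \<noteq> {}" by blast
  qed
qed

section \<open>Generic instances\<close>

definition closed_set :: "baire set \<Rightarrow> bool" where
  "closed_set X \<longleftrightarrow> (\<forall>p. (\<forall>n. \<exists>q\<in>X. agree n p q) \<longrightarrow> p \<in> X)"

definition continuous_map :: "baire set \<Rightarrow> (baire \<Rightarrow> baire) \<Rightarrow> bool" where
  "continuous_map X f \<longleftrightarrow> (\<forall>p\<in>X. \<forall>n. \<exists>m. \<forall>q\<in>X. agree m p q \<longrightarrow> agree n (f p) (f q))"

text \<open>Baire category on a closed set: for each \<open>k\<close> the points near which one
  \<open>j\<close> is decided form a dense open set, and some point lies in all of these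
  sets.\<close>

lemma generic_point:
  assumes X: "closed_set X" "X \<noteq> {}"
    and dense: "\<And>k p n. p \<in> X \<Longrightarrow>
      \<exists>p'\<in>X. agree n p p' \<and> (\<exists>m j. \<forall>q\<in>X. agree m p' q \<longrightarrow> D k j q)"
  shows "\<exists>p\<in>X. \<forall>k :: nat. \<exists>m j. \<forall>q\<in>X. agree m p q \<longrightarrow> D k j q"
proof -
  let ?P = "\<lambda>(p, n :: nat). p \<in> X"
  let ?Q = "\<lambda>k (p, n) (p', n'). n < n' \<and> agree n p p' \<and> (\<exists>j. \<forall>q\<in>X. agree n' p' q \<longrightarrow> D k j q)"
  have "\<exists>f. \<forall>k. ?P (f k) \<and> ?Q k (f k) (f (Suc k))"
  proof (rule dependent_nat_choice)
    show "\<exists>s. ?P s" using X(2) by auto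
    fix s k assume "?P s"
    then obtain p n where s: "s = (p, n)" "p \<in> X" by (cases s) auto
    from dense[OF s(2), of n k] obtain p' m j where p': "p' \<in> X" "agree n p p'"
      "\<And>q. q \<in> X \<Longrightarrow> agree m p' q \<Longrightarrow> D k j q" by blast
    \<comment> \<open>Besides deciding \<open>j\<close>, the prefix grows strictly, so the points
      converge.\<close>
    have "\<forall>q\<in>X. agree (max m (Suc n)) p' q \<longrightarrow> D k j q" using p'(3) by simp
    then have "?P (p', max m (Suc n)) \<and> ?Q k s (p', max m (Suc n))"
      unfolding s(1) prod.case using p'(1,2) by auto
    then show "\<exists>t. ?P t \<and> ?Q k s t" by (rule exI)
  qed
  then obtain f where f: "\<forall>k. ?P (f k) \<and> ?Q k (f k) (f (Suc k))" ..
  define p where "p k = fst (f k)" for k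
  define n where "n k = snd (f k)" for k
  have pn: "p k \<in> X" "n k < n (Suc k)" "agree (n k) (p k) (p (Suc k))"
    "\<exists>j. \<forall>q\<in>X. agree (n (Suc k)) (p (Suc k)) q \<longrightarrow> D k j q" for k
    using spec[OF f, of k] by (auto simp: p_def n_def split: prod.splits)
  have n_mono: "n k \<le> n l" if "k \<le> l" for k l
    using that by (induction l rule: dec_induct) (use pn(2) less_imp_le_nat le_trans in blast)+
  have n_ge: "k \<le> n k" for k
    by (induction k) (use pn(2) in \<open>auto simp: Suc_le_eq intro: le_less_trans\<close>)
  have chain: "agree (n k) (p k) (p l)" if "k \<le> l" for k l
    using that
  proof (induction l rule: dec_induct)
    case (step l)
    have "agree (n k) (p l) (p (Suc l))" using pn(3)[of l] n_mono[OF step(1)] agree_mono by blast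
    then show ?case using step(3) agree_trans by blast
  qed simp
  define r where "r i = p (Suc i) i" for i
  have r: "agree (n k) (p k) r" for k
    unfolding agree_def
  proof (intro allI impI)
    fix i assume i: "i < n k"
    have "i < n (Suc i)" using n_ge[of "Suc i"] by simp
    then have "p (Suc i) i = p (max k (Suc i)) i" by (intro agreeD[OF chain]) auto
    moreover have "p k i = p (max k (Suc i)) i" using i by (intro agreeD[OF chain]) auto
    ultimately show "p k i = r i" by (simp add: r_def)
  qed
  have "r \<in> X"
  proof -
    have "agree k r (p k)" for k using agree_mono[OF r n_ge] agree_sym by blast
    then show ?thesis using X(1) pn(1) unfolding closed_set_def by blast
  qed
  moreover have "\<exists>m j. \<forall>q\<in>X. agree m r q \<longrightarrow> D k j q" for k
  proof -
    obtain j where "\<forall>q\<in>X. agree (n (Suc k)) (p (Suc k)) q \<longrightarrow> D k j q" using pn(4) by blast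
    then have "\<forall>q\<in>X. agree (n (Suc k)) r q \<longrightarrow> D k j q" using agree_trans[OF r] by blast
    then show ?thesis by blast
  qed
  ultimately show ?thesis by blast
qed

text \<open>The covering form of Baire's theorem: if countably many closed sets cover
  \<open>X\<close>, one of them contains an open part of every neighbourhood. Otherwise all
  complements are dense open in the neighbourhood, and a generic point escapes the cover.\<close>

lemma baire_cover:
  assumes X: "closed_set X" and p0: "p0 \<in> X"
    and cover: "\<And>p. p \<in> X \<Longrightarrow> \<exists>j :: nat. D j p"
    and closed: "\<And>j p. p \<in> X \<Longrightarrow> (\<And>n. \<exists>q\<in>X. agree n p q \<and> D j q) \<Longrightarrow> D j p"
  shows "\<exists>p\<in>X. agree n p0 p \<and> (\<exists>m j. \<forall>q\<in>X. agree m p q \<longrightarrow> D j q)"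
proof (rule ccontr)
  assume neg: "\<not> ?thesis"
  define Y where "Y = {q \<in> X. agree n p0 q}"
  have "closed_set Y" unfolding closed_set_def
  proof (intro allI impI)
    fix p assume p: "\<forall>m. \<exists>q\<in>Y. agree m p q"
    then have "p \<in> X" using X unfolding closed_set_def Y_def by blast
    moreover obtain q where "q \<in> Y" "agree n p q" using p by blast
    then have "agree n p0 p" unfolding Y_def using agree_trans agree_sym by blast
    ultimately show "p \<in> Y" by (simp add: Y_def)
  qed
  moreover have "p0 \<in> Y" using p0 by (simp add: Y_def)
  moreover have "\<exists>p'\<in>Y. agree m p p' \<and> (\<exists>m' (j' :: unit). \<forall>q\<in>Y. agree m' p' q \<longrightarrow> \<not> D j q)"
    if p: "p \<in> Y" for p m j
  proof -
    have "\<not> (\<forall>q\<in>X. agree (max m n) p q \<longrightarrow> D j q)" using neg p unfolding Y_def by blast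
    then obtain q where q: "q \<in> X" "agree m p q" "agree n p q" "\<not> D j q" by auto
    then obtain m' where "\<forall>q'\<in>X. agree m' q q' \<longrightarrow> \<not> D j q'" using closed[of q j] by blast
    moreover have "q \<in> Y" using p q agree_trans unfolding Y_def by blast
    ultimately show ?thesis using q(2) unfolding Y_def by blast
  qed
  ultimately obtain p where "p \<in> Y" "\<forall>j. \<exists>m (j' :: unit). \<forall>q\<in>Y. agree m p q \<longrightarrow> \<not> D j q"
    using generic_point[of Y "\<lambda>j (j' :: unit) q. \<not> D j q"] by blast
  then have "\<not> D j p" for j using agree_refl by blast
  moreover have "p \<in> X" using \<open>p \<in> Y\<close> by (simp add: Y_def)
  ultimately show False using cover by blast
qed

lemma generic_cover:
  assumes X: "closed_set X" "X \<noteq> {}"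
    and cover: "\<And>k p. p \<in> X \<Longrightarrow> \<exists>j :: nat. D k j p"
    and closed: "\<And>k j p. p \<in> X \<Longrightarrow> (\<And>n. \<exists>q\<in>X. agree n p q \<and> D k j q) \<Longrightarrow> D k j p"
  shows "\<exists>p\<in>X. \<forall>k :: nat. \<exists>m j. \<forall>q\<in>X. agree m p q \<longrightarrow> D k j q"
  using X
proof (rule generic_point)
  show "\<exists>p'\<in>X. agree n p p' \<and> (\<exists>m j. \<forall>q\<in>X. agree m p' q \<longrightarrow> D k j q)" if "p \<in> X" for k p n
    by (rule baire_cover[OF X(1) that cover closed])
qed

lemma reduction_continuous_map:
  assumes red: "reduction F G \<Phi> \<Psi>" and X: "X \<subseteq> insts F"
  shows "continuous_map X \<Phi>"
  unfolding continuous_map_def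
proof (intro ballI allI)
  fix p n assume "p \<in> X"
  then have "p \<in> insts F" using X by blast
  from reduction_continuous_inst[OF red this, of n] obtain m where
    m: "\<forall>q\<in>insts F. agree m p q \<longrightarrow> agree n (\<Phi> p) (\<Phi> q)" ..
  then show "\<exists>m. \<forall>q\<in>X. agree m p q \<longrightarrow> agree n (\<Phi> p) (\<Phi> q)"
    using X by (intro exI[of _ m]) blast
qed

text \<open>If \<open>Q\<close> inspects only \<open>n\<close> values, it passes from points
  arbitrarily near \<open>p\<close> to \<open>p\<close> by continuity. This supplies the closedness
  required by the category lemmas.\<close>

lemma closed_value:
  assumes f: "continuous_map X f" and p: "p \<in> X"
    and ex: "\<And>n. \<exists>q\<in>X. agree n p q \<and> Q (f q)"
    and fin: "\<And>r. agree n (f p) r \<Longrightarrow> Q r \<Longrightarrow> R"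
  shows R
proof -
  obtain m where m: "\<forall>q\<in>X. agree m p q \<longrightarrow> agree n (f p) (f q)"
    using f p unfolding continuous_map_def by blast
  obtain q where "q \<in> X" "agree m p q" "Q (f q)" using ex by blast
  then show R using m fin by blast
qed

text \<open>Having a limit is a countable union of closed conditions, one for each threshold and
  value; at a generic point every limit is therefore locally constant.\<close>

lemma generic_limits:
  assumes X: "closed_set X" "X \<noteq> {}" and f: "continuous_map X f"
    and lim: "\<And>p x. p \<in> X \<Longrightarrow> \<exists>l. eventually (\<lambda>s. column (f p) x s = l) sequentially"
  shows "\<exists>p\<in>X. \<forall>x. \<exists>m l. \<forall>q\<in>X. agree m p q \<longrightarrow> eventually (\<lambda>s. column (f q) x s = l) sequentially"
proof -
  \<comment> \<open>The index \<open>j\<close> codes the threshold from which the column is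
    constant, together with the constant.\<close>
  define D where "D x j p \<longleftrightarrow> (\<forall>s\<ge>fst (prod_decode j). column (f p) x s = snd (prod_decode j))"
    for x j p
  have "\<exists>p\<in>X. \<forall>x. \<exists>m j. \<forall>q\<in>X. agree m p q \<longrightarrow> D x j q"
    using X
  proof (rule generic_cover)
    fix x p assume "p \<in> X"
    then obtain l t where "\<forall>s\<ge>t. column (f p) x s = l"
      using lim[of p x] unfolding eventually_sequentially by blast
    then have "D x (prod_encode (t, l)) p" by (simp add: D_def)
    then show "\<exists>j. D x j p" ..
  next
    fix x j p assume p: "p \<in> X" and ex: "\<And>n. \<exists>q\<in>X. agree n p q \<and> D x j q"
    show "D x j p"
      unfolding D_def
    proof (intro allI impI)
      fix s assume s: "s \<ge> fst (prod_decode j)"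
      show "column (f p) x s = snd (prod_decode j)"
      proof (rule closed_value[OF f p])
        show "\<exists>q\<in>X. agree n p q \<and> column (f q) x s = snd (prod_decode j)" for n
          using ex[of n] s by (auto simp: D_def)
        show "column (f p) x s = snd (prod_decode j)"
          if "agree (Suc (prod_encode (x, s))) (f p) r" "column r x s = snd (prod_decode j)" for r
          using that by (simp add: agree_def column_def)
      qed
    qed
  qed
  then obtain p where p: "p \<in> X" "\<And>x. \<exists>m j. \<forall>q\<in>X. agree m p q \<longrightarrow> D x j q" by blast
  have "\<exists>m l. \<forall>q\<in>X. agree m p q \<longrightarrow> eventually (\<lambda>s. column (f q) x s = l) sequentially" for x
  proof -
    obtain m j where "\<forall>q\<in>X. agree m p q \<longrightarrow> D x j q" using p(2) by blast
    then show ?thesis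
      by (intro exI[of _ m] exI[of _ "snd (prod_decode j)"]) (auto simp: D_def eventually_sequentially)
  qed
  then show ?thesis using p(1) by blast
qed

section \<open>Problems to which \<open>RT1_fin\<close> is not reducible\<close>

lemma insts_RT1_fin: "d \<in> insts RT1_fin \<longleftrightarrow> finite (range d)"
  by (simp add: RT1_fin_def)

lemma sols_RT1_fin:
  "finite (range d) \<Longrightarrow> sols RT1_fin d = indicator ` {H. infinite H \<and> (\<exists>i. \<forall>x\<in>H. d x = i)}"
  using sols_coded_problem[of id "{c. finite (range c)}" d] by (simp add: RT1_fin_def)

text \<open>Lower semicontinuity of the solutions at one point of each closed set: every initial
  segment of \<open>g\<close> starts a solution for all instances near \<open>d\<close>. In the
  application \<open>f\<close> is the forward map of a reduction.\<close>

definition tame :: "problem \<Rightarrow> bool" where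
  "tame Q \<longleftrightarrow> (\<forall>X f. closed_set X \<longrightarrow> X \<noteq> {} \<longrightarrow> f ` X \<subseteq> insts Q \<longrightarrow> continuous_map X f \<longrightarrow>
     (\<exists>d\<in>X. \<exists>g\<in>sols Q (f d). \<forall>u. \<exists>n. \<forall>q\<in>X. agree n d q \<longrightarrow> (\<exists>g'\<in>sols Q (f q). agree u g g')))"

lemma indicator_agree_mem: "agree u (indicator A) (indicator B) \<Longrightarrow> x < u \<Longrightarrow> x \<in> A \<longleftrightarrow> x \<in> B"
  unfolding agree_indicator by blast

theorem not_RT1_fin_le_tame:
  assumes "tame Q" shows "\<not> RT1_fin \<le>\<^sub>W Q"
proof
  assume "RT1_fin \<le>\<^sub>W Q"
  then obtain \<Phi> \<Psi> where red: "reduction RT1_fin Q \<Phi> \<Psi>" unfolding weihrauch_le_iff by blast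
  define X :: "baire set" where "X = {d. \<forall>i. d i \<le> 1}"
  have fin: "finite (range d)" if "d \<in> X" for d
    using that by (intro finite_subset[of "range d" "{..1}"]) (auto simp: X_def)
  then have sub: "X \<subseteq> insts RT1_fin" by (auto simp: insts_RT1_fin)
  have "closed_set X" unfolding closed_set_def
  proof (intro allI impI)
    fix p assume p: "\<forall>n. \<exists>q\<in>X. agree n p q"
    have "p i \<le> 1" for i
    proof -
      obtain q where "q \<in> X" "agree (Suc i) p q" using p by blast
      then show ?thesis by (auto simp: X_def agree_def)
    qed
    then show "p \<in> X" by (simp add: X_def)
  qed
  moreover have "X \<noteq> {}" by (auto simp: X_def intro!: exI[of _ "\<lambda>_. 0"])
  moreover have "\<Phi> ` X \<subseteq> insts Q" using red sub by (auto simp: reduction_def)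
  ultimately have "\<exists>d\<in>X. \<exists>g\<in>sols Q (\<Phi> d). \<forall>u. \<exists>n. \<forall>q\<in>X. agree n d q \<longrightarrow>
      (\<exists>g'\<in>sols Q (\<Phi> q). agree u g g')"
    using assms reduction_continuous_map[OF red sub] unfolding tame_def by blast
  then obtain d g where d: "d \<in> X" and g: "g \<in> sols Q (\<Phi> d)"
    and near: "\<And>u. \<exists>n. \<forall>q\<in>X. agree n d q \<longrightarrow> (\<exists>g'\<in>sols Q (\<Phi> q). agree u g g')" by blast
  have di: "d \<in> insts RT1_fin" using d sub by blast
  then have "\<Psi> (join d g) \<in> sols RT1_fin d" using red g by (simp add: reduction_def)
  then obtain H i where H: "\<Psi> (join d g) = indicator H" "infinite H" "\<And>x. x \<in> H \<Longrightarrow> d x = i"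
    by (auto simp: sols_RT1_fin[OF fin[OF d]])
  obtain y where y: "y \<in> H" using H(2) infinite_nat_iff_unbounded by blast
  from reduction_continuous_sol[OF red, OF di, OF g, of "Suc y"] obtain u where u:
    "\<forall>q\<in>insts RT1_fin. \<forall>g'\<in>sols Q (\<Phi> q). agree u d q \<longrightarrow> agree u g g' \<longrightarrow>
      agree (Suc y) (\<Psi> (join d g)) (\<Psi> (join q g'))" ..
  from near[of u] obtain n where n: "\<And>q. q \<in> X \<Longrightarrow> agree n d q \<Longrightarrow> \<exists>g'\<in>sols Q (\<Phi> q). agree u g g'"
    by blast
  define m where "m = max n (max u (Suc y))"
  \<comment> \<open>The element \<open>y\<close> is already committed with colour \<open>i\<close>,
    but from \<open>m\<close> on this colour no longer occurs, so no infinite homogeneous set can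
    contain \<open>y\<close>.\<close>
  define q where "q x = (if x < m then d x else 1 - i)" for x
  have q: "q \<in> X" using d by (auto simp: X_def q_def)
  have "agree m d q" by (simp add: agree_def q_def)
  then have agr: "agree n d q" "agree u d q" "agree (Suc y) d q"
    by (auto intro: agree_mono simp: m_def)
  from n[OF q agr(1)] obtain g' where g': "g' \<in> sols Q (\<Phi> q)" "agree u g g'" by blast
  have qi: "q \<in> insts RT1_fin" using q sub by blast
  then have "\<Psi> (join q g') \<in> sols RT1_fin q" using red g'(1) by (simp add: reduction_def)
  then obtain H' i' where H': "\<Psi> (join q g') = indicator H'" "infinite H'" "\<And>x. x \<in> H' \<Longrightarrow> q x = i'"
    by (auto simp: sols_RT1_fin[OF fin[OF q]])
  have "agree (Suc y) (indicator H) (indicator H')"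
    using bspec[OF bspec[OF u qi] g'(1)] g'(2) agr(2) by (simp add: H(1) H'(1))
  then have "y \<in> H'" using y by (simp add: indicator_agree_mem)
  then have "i' = i" using H'(3) H(3)[OF y] agreeD[OF agr(3), of y] by auto
  moreover obtain x where "x \<in> H'" "x \<ge> m" using H'(2) infinite_nat_iff_unbounded_le by blast
  ultimately have "1 - i = i" using H'(3)[of x] by (simp add: q_def)
  then show False by arith
qed

lemma tame_LimP: "tame LimP"
  unfolding tame_def
proof (intro allI impI)
  fix X f assume X: "closed_set X" "X \<noteq> {}" and f: "f ` X \<subseteq> insts LimP" "continuous_map X f"
  have lim: "\<exists>l. eventually (\<lambda>s. column (f p) x s = l) sequentially" if "p \<in> X" for p x
    using f(1) that insts_LimP by blast
  from generic_limits[OF X f(2) lim] obtain d where d: "d \<in> X"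
    "\<And>x. \<exists>m l. \<forall>q\<in>X. agree m d q \<longrightarrow> eventually (\<lambda>s. column (f q) x s = l) sequentially" by blast
  have "\<forall>x. \<exists>l m. \<forall>q\<in>X. agree m d q \<longrightarrow> eventually (\<lambda>s. column (f q) x s = l) sequentially"
    using d(2) by blast
  from choice[OF this] obtain g where g:
    "\<And>x. \<exists>m. \<forall>q\<in>X. agree m d q \<longrightarrow> eventually (\<lambda>s. column (f q) x s = g x) sequentially" by blast
  have "g \<in> sols LimP (f d)"
    using f(1) d(1) g agree_refl by (subst sols_LimP) blast+
  moreover have "\<exists>n. \<forall>q\<in>X. agree n d q \<longrightarrow> (\<exists>g'\<in>sols LimP (f q). agree u g g')" for u
  proof -
    have "\<exists>n. \<forall>q. agree n d q \<longrightarrow>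
        (\<forall>x<u. q \<in> X \<longrightarrow> eventually (\<lambda>s. column (f q) x s = g x) sequentially)"
      using g by (intro eventually_agree_all) blast
    then obtain n where n: "\<And>q x. agree n d q \<Longrightarrow> x < u \<Longrightarrow> q \<in> X \<Longrightarrow>
      eventually (\<lambda>s. column (f q) x s = g x) sequentially" by blast
    have "\<exists>g'\<in>sols LimP (f q). agree u g g'" if q: "q \<in> X" "agree n d q" for q
    proof -
      have fq: "f q \<in> insts LimP" using f(1) q(1) by blast
      have "\<forall>x. \<exists>l. eventually (\<lambda>s. column (f q) x s = l) sequentially" using lim[OF q(1)] by blast
      from choice[OF this] obtain h where h: "\<And>x. eventually (\<lambda>s. column (f q) x s = h x) sequentially"
        by blast
      have "g x = h x" if "x < u" for x
      proof -
        have "eventually (\<lambda>s. g x = h x) sequentially"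
          using n[OF q(2) that q(1)] h[of x] by eventually_elim simp
        then show ?thesis by simp
      qed
      then have "agree u g h" by (simp add: agree_def)
      moreover have "h \<in> sols LimP (f q)" using h sols_LimP[OF fq] by blast
      ultimately show ?thesis by blast
    qed
    then show ?thesis by blast
  qed
  ultimately show "\<exists>d\<in>X. \<exists>g\<in>sols LimP (f d). \<forall>u. \<exists>n. \<forall>q\<in>X. agree n d q \<longrightarrow>
      (\<exists>g'\<in>sols LimP (f q). agree u g g')" using d(1) by blast
qed

text \<open>Each diagonal computation can be decided: if it converges somewhere nearby, the use
  principle keeps its value on a neighbourhood; if not, it diverges throughout the
  neighbourhood.\<close>

lemma tame_DNR: "tame DNR"
  unfolding tame_def
proof (intro allI impI)
  fix X f assume X: "closed_set X" "X \<noteq> {}" and f: "continuous_map X f"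
  have "\<exists>p\<in>X. \<forall>e. \<exists>m j. \<forall>q\<in>X. agree m p q \<longrightarrow> Phi e (f q) e = j"
    using X
  proof (rule generic_point)
    fix e p n assume p: "p \<in> X"
    show "\<exists>p'\<in>X. agree n p p' \<and> (\<exists>m j. \<forall>q\<in>X. agree m p' q \<longrightarrow> Phi e (f q) e = j)"
    proof (cases "\<exists>p'\<in>X. agree n p p' \<and> Phi e (f p') e \<noteq> None")
      case True
      then obtain p' v where p': "p' \<in> X" "agree n p p'" "Phi e (f p') e = Some v" by blast
      from run_use[OF p'(3)[unfolded Phi_def]] obtain m where
        m: "\<And>q. agree m (f p') q \<Longrightarrow> Phi e q e = Some v" unfolding Phi_def by blast
      obtain m' where "\<forall>q\<in>X. agree m' p' q \<longrightarrow> agree m (f p') (f q)"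
        using f p'(1) unfolding continuous_map_def by blast
      then show ?thesis using p' m by blast
    next
      case False
      then have "\<forall>q\<in>X. agree n p q \<longrightarrow> Phi e (f q) e = None" by blast
      then show ?thesis using p agree_refl by blast
    qed
  qed
  then obtain d where d: "d \<in> X" "\<And>e. \<exists>m j. \<forall>q\<in>X. agree m d q \<longrightarrow> Phi e (f q) e = j" by blast
  have same: "\<exists>m. \<forall>q. agree m d q \<longrightarrow> q \<in> X \<longrightarrow> Phi e (f q) e = Phi e (f d) e" for e
    using d(2)[of e] d(1) agree_refl by metis
  \<comment> \<open>The successor avoids the value of a converging computation; 0 is the default for
    divergence.\<close>
  define g where "g p e = (case Phi e p e of None \<Rightarrow> 0 | Some v \<Rightarrow> Suc v)" for p e
  have g: "g p \<in> sols DNR p" for p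
    by (auto simp: sols_DNR g_def split: option.splits)
  have "\<exists>n. \<forall>q\<in>X. agree n d q \<longrightarrow> (\<exists>g'\<in>sols DNR (f q). agree u (g (f d)) g')" for u
  proof -
    have "\<exists>n. \<forall>q. agree n d q \<longrightarrow> (\<forall>e<u. q \<in> X \<longrightarrow> Phi e (f q) e = Phi e (f d) e)"
      using same by (rule eventually_agree_all)
    then obtain n where n: "\<And>q e. agree n d q \<Longrightarrow> e < u \<Longrightarrow> q \<in> X \<Longrightarrow> Phi e (f q) e = Phi e (f d) e"
      by blast
    have "agree u (g (f d)) (g (f q))" if "q \<in> X" "agree n d q" for q
      using n[OF that(2) _ that(1)] by (simp add: agree_def g_def)
    then show ?thesis using g by blast
  qed
  then show "\<exists>d\<in>X. \<exists>g\<in>sols DNR (f d). \<forall>u. \<exists>n. \<forall>q\<in>X. agree n d q \<longrightarrow>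
      (\<exists>g'\<in>sols DNR (f q). agree u g g')" using d(1) g by blast
qed

lemma sols_COH:
  "sols COH (code_sequence A) = indicator ` {C. infinite C \<and> (\<forall>i. finite (C - A i) \<or> finite (C \<inter> A i))}"
  by (simp add: COH_def sols_coded_problem[OF inj_code_sequence UNIV_I])

text \<open>Cohesiveness ignores finite changes, so any initial segment can be put in front of a
  solution of any other instance.\<close>

lemma tame_COH:
  assumes ex: "\<And>h. h \<in> insts COH \<Longrightarrow> sols COH h \<noteq> {}"
  shows "tame COH"
  unfolding tame_def
proof (intro allI impI)
  fix X :: "baire set" and f :: "baire \<Rightarrow> baire"
  assume X: "X \<noteq> {}" and f: "f ` X \<subseteq> insts COH"
  then obtain d where d: "d \<in> X" by blast
  then obtain g where g: "g \<in> sols COH (f d)" using f ex by blast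
  have code: "\<exists>A. h = code_sequence A" if "h \<in> insts COH" for h using that by (auto simp: COH_def)
  from code f d obtain A where "f d = code_sequence A" by blast
  then obtain C where C: "g = indicator C" using g by (auto simp: sols_COH)
  have "\<exists>g'\<in>sols COH (f q). agree u g g'" if "q \<in> X" for q u
  proof -
    have fq: "f q \<in> insts COH" using f that by blast
    from code[OF fq] obtain B where B: "f q = code_sequence B" by blast
    from ex[OF fq] obtain D where D: "infinite D" "\<And>i. finite (D - B i) \<or> finite (D \<inter> B i)"
      by (auto simp: B sols_COH)
    define D' where "D' = C \<inter> {..<u} \<union> (D - {..<u})"
    have "infinite D'" using D(1) by (simp add: D'_def)
    moreover have "finite (D' - B i) \<or> finite (D' \<inter> B i)" for i
    proof -
      have "D' - B i \<subseteq> (D - B i) \<union> {..<u}" "D' \<inter> B i \<subseteq> (D \<inter> B i) \<union> {..<u}" by (auto simp: D'_def)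
      then show ?thesis using D(2)[of i] by (meson finite_UnI finite_lessThan finite_subset)
    qed
    ultimately have "indicator D' \<in> sols COH (f q)" by (auto simp: B sols_COH)
    moreover have "agree u g (indicator D')" by (auto simp: C agree_indicator D'_def)
    ultimately show ?thesis by blast
  qed
  then show "\<exists>d\<in>X. \<exists>g\<in>sols COH (f d). \<forall>u. \<exists>n. \<forall>q\<in>X. agree n d q \<longrightarrow>
      (\<exists>g'\<in>sols COH (f q). agree u g g')" using d g by blast
qed

text \<open>At a generic point the side of the cut is decided for each element. The whole lower half
  is an ascending chain, and its initial segments are then locally constant.\<close>

lemma tame_SADC: "tame SADC"
  unfolding tame_def
proof (intro allI impI)
  fix X f assume X: "closed_set X" "X \<noteq> {}" and f: "f ` X \<subseteq> insts SADC" "continuous_map X f"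
  have "\<exists>LR. f p = code_order LR \<and> LR \<in> SADC_orders" if "p \<in> X" for p
  proof -
    have "f p \<in> code_order ` SADC_orders" using f(1) that by (auto simp: SADC_def)
    then show ?thesis by (metis imageE)
  qed
  then obtain LR where LR: "\<And>p. p \<in> X \<Longrightarrow> f p = code_order (LR p) \<and> LR p \<in> SADC_orders" by metis
  define L where "L p = fst (LR p)" for p
  define R where "R p = snd (LR p)" for p
  have fp: "f p = code_order (L p, R p)" "(L p, R p) \<in> SADC_orders" if "p \<in> X" for p
    using LR[OF that] by (simp_all add: L_def R_def)
  have ord: "infinite (L p)" "R p \<subseteq> L p \<times> L p" "total_on (L p) (R p)"
    "x \<in> L p \<Longrightarrow> finite {y \<in> L p. (y, x) \<in> R p} \<or> finite {y \<in> L p. (x, y) \<in> R p}"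
    "infinite {x \<in> L p. finite {y \<in> L p. (y, x) \<in> R p}}" if "p \<in> X" for p x
    using fp(2)[OF that] type_omega_omega_star_iff[of "L p" "R p"]
    by (auto simp: SADC_orders_def strict_linear_order_on_def)
  have in_L: "f p (2 * x) = of_bool (x \<in> L p)" if "p \<in> X" for p x
    using fp(1)[OF that] by (simp add: code_order_in)
  have in_R: "f p (Suc (2 * prod_encode (x, y))) = of_bool ((x, y) \<in> R p)" if "p \<in> X" for p x y
    using fp(1)[OF that] by (simp add: code_order_less)
  \<comment> \<open>The parity of \<open>j\<close> names the side of \<open>x\<close>;
    \<open>j div 2\<close> bounds the predecessors or the successors.\<close>
  define D where "D x j p \<longleftrightarrow> x \<notin> L p \<or>
    (if even j then \<forall>y\<ge>j div 2. (y, x) \<notin> R p else \<forall>y\<ge>j div 2. (x, y) \<notin> R p)" for x j p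
  have bounded: "\<exists>t :: nat. \<forall>y\<ge>t. \<not> Q y" if "finite {y. Q y}" for Q
    using that by (metis finite_nat_set_iff_bounded mem_Collect_eq not_le)
  have "\<exists>p\<in>X. \<forall>x. \<exists>m j. \<forall>q\<in>X. agree m p q \<longrightarrow> D x j q"
    using X
  proof (rule generic_cover)
    fix x p assume p: "p \<in> X"
    have eq: "{y. (y, x) \<in> R p} = {y \<in> L p. (y, x) \<in> R p}" "{y. (x, y) \<in> R p} = {y \<in> L p. (x, y) \<in> R p}"
      using ord(2)[OF p] by auto
    show "\<exists>j. D x j p"
    proof (cases "x \<in> L p")
      case True
      from ord(4)[OF p True] show ?thesis
      proof
        assume "finite {y \<in> L p. (y, x) \<in> R p}"
        then obtain t where "\<forall>y\<ge>t. (y, x) \<notin> R p" using bounded eq by metis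
        then have "D x (2 * t) p" by (simp add: D_def)
        then show ?thesis ..
      next
        assume "finite {y \<in> L p. (x, y) \<in> R p}"
        then obtain t where "\<forall>y\<ge>t. (x, y) \<notin> R p" using bounded eq by metis
        then have "D x (Suc (2 * t)) p" by (simp add: D_def)
        then show ?thesis ..
      qed
    qed (auto simp: D_def)
  next
    fix x j p assume p: "p \<in> X" and ex: "\<And>n. \<exists>q\<in>X. agree n p q \<and> D x j q"
    have near: "\<exists>q\<in>X. D x j q \<and> (x \<in> L q \<longleftrightarrow> x \<in> L p) \<and> ((y, x) \<in> R q \<longleftrightarrow> (y, x) \<in> R p) \<and>
        ((x, y) \<in> R q \<longleftrightarrow> (x, y) \<in> R p)" for y
    proof -
      define N where "N = Suc (max (2 * x) (max (Suc (2 * prod_encode (y, x))) (Suc (2 * prod_encode (x, y)))))"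
      obtain m where m: "\<forall>q\<in>X. agree m p q \<longrightarrow> agree N (f p) (f q)"
        using f(2) p unfolding continuous_map_def by blast
      obtain q where q: "q \<in> X" "agree m p q" "D x j q" using ex by blast
      then have agr: "agree N (f p) (f q)" using m by blast
      have "2 * x < N" "Suc (2 * prod_encode (y, x)) < N" "Suc (2 * prod_encode (x, y)) < N"
        by (auto simp: N_def)
      then show ?thesis
        using q agreeD[OF agr] in_L[OF p, of x] in_L[OF q(1), of x] in_R[OF p, of x y] in_R[OF p, of y x]
          in_R[OF q(1), of x y] in_R[OF q(1), of y x]
        by (intro bexI[of _ q]) (auto simp: of_bool_eq_iff)
    qed
    show "D x j p"
    proof (cases "x \<in> L p")
      case True
      have "(y, x) \<notin> R p" if "even j" "y \<ge> j div 2" for y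
        using near[of y] True that by (auto simp: D_def)
      moreover have "(x, y) \<notin> R p" if "odd j" "y \<ge> j div 2" for y
        using near[of y] True that by (auto simp: D_def)
      ultimately show ?thesis by (simp add: D_def)
    qed (simp add: D_def)
  qed
  then obtain d where d: "d \<in> X" "\<And>x. \<exists>m j. \<forall>q\<in>X. agree m d q \<longrightarrow> D x j q" by blast
  define A where "A p = {x \<in> L p. finite {y \<in> L p. (y, x) \<in> R p}}" for p
  have A_sol: "indicator (A p) \<in> sols SADC (f p)" if p: "p \<in> X" for p
  proof -
    have "finite {x \<in> A p. (x, y) \<in> R p}" if "y \<in> A p" for y
    proof (rule finite_subset)
      show "{x \<in> A p. (x, y) \<in> R p} \<subseteq> {x \<in> L p. (x, y) \<in> R p}" by (auto simp: A_def)
      show "finite {x \<in> L p. (x, y) \<in> R p}" using that by (simp add: A_def)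
    qed
    then have "ascending_chain (R p) (A p)" by (simp add: ascending_chain_def)
    moreover have "A p \<subseteq> L p" by (auto simp: A_def)
    ultimately show ?thesis
      using ord(5)[OF p] unfolding fp(1)[OF p] sols_SADC[OF fp(2)[OF p]] A_def[symmetric] by blast
  qed
  have A_dec: "x \<in> A p \<longleftrightarrow> even j" if p: "p \<in> X" and D: "D x j p" and x: "x \<in> L p" for p x j
  proof -
    have "L p \<subseteq> insert x ({y \<in> L p. (y, x) \<in> R p} \<union> {y \<in> L p. (x, y) \<in> R p})"
      using ord(3)[OF p] x by (auto simp: total_on_def)
    then have both: "\<not> (finite {y \<in> L p. (y, x) \<in> R p} \<and> finite {y \<in> L p. (x, y) \<in> R p})"
      using ord(1)[OF p] by (meson finite_UnI finite_insert finite_subset)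
    show ?thesis
    proof (cases "even j")
      case True
      then have "{y \<in> L p. (y, x) \<in> R p} \<subseteq> {..<j div 2}" using D x by (auto simp: D_def not_le[symmetric])
      then show ?thesis using True x finite_subset by (auto simp: A_def)
    next
      case False
      then have "{y \<in> L p. (x, y) \<in> R p} \<subseteq> {..<j div 2}" using D x by (auto simp: D_def not_le[symmetric])
      then have "finite {y \<in> L p. (x, y) \<in> R p}" using finite_subset by blast
      then show ?thesis using False both by (auto simp: A_def)
    qed
  qed
  have same: "\<exists>n. \<forall>q. agree n d q \<longrightarrow> q \<in> X \<longrightarrow> (x \<in> A q \<longleftrightarrow> x \<in> A d)" for x
  proof -
    obtain m j where m: "\<forall>q\<in>X. agree m d q \<longrightarrow> D x j q" using d(2) by blast
    obtain m' where m': "\<forall>q\<in>X. agree m' d q \<longrightarrow> agree (Suc (2 * x)) (f d) (f q)"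
      using f(2) d(1) unfolding continuous_map_def by blast
    have "x \<in> A q \<longleftrightarrow> x \<in> A d" if q: "agree (max m m') d q" "q \<in> X" for q
    proof -
      have "f d (2 * x) = f q (2 * x)" using m' q by (auto intro: agreeD)
      then have "x \<in> L q \<longleftrightarrow> x \<in> L d" by (auto simp: in_L d(1) q(2) of_bool_eq_iff)
      moreover have "D x j q" "D x j d" using m q d(1) by auto
      ultimately show ?thesis using A_dec[OF q(2)] A_dec[OF d(1)] by (auto simp: A_def)
    qed
    then show ?thesis by blast
  qed
  have "\<exists>n. \<forall>q\<in>X. agree n d q \<longrightarrow> (\<exists>g'\<in>sols SADC (f q). agree u (indicator (A d)) g')" for u
  proof -
    have "\<exists>n. \<forall>q. agree n d q \<longrightarrow> (\<forall>x<u. q \<in> X \<longrightarrow> (x \<in> A q \<longleftrightarrow> x \<in> A d))"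
      using same by (rule eventually_agree_all)
    then obtain n where n: "\<And>q x. agree n d q \<Longrightarrow> x < u \<Longrightarrow> q \<in> X \<Longrightarrow> (x \<in> A q \<longleftrightarrow> x \<in> A d)" by blast
    have "agree u (indicator (A d)) (indicator (A q))" if "q \<in> X" "agree n d q" for q
      using n[OF that(2) _ that(1)] by (simp add: agree_def indicator_def)
    then show ?thesis using A_sol by blast
  qed
  then show "\<exists>d\<in>X. \<exists>g\<in>sols SADC (f d). \<forall>u. \<exists>n. \<forall>q\<in>X. agree n d q \<longrightarrow>
      (\<exists>g'\<in>sols SADC (f q). agree u g g')" using d(1) A_sol by blast
qed

subsection \<open>Eliminating solution classes and colours\<close>

definition cylinder :: "baire \<Rightarrow> nat \<Rightarrow> nat set \<Rightarrow> baire set" where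
  "cylinder d n S = {q. agree n d q \<and> (\<forall>i\<ge>n. q i \<in> S)}"

lemma cylinder_mono: "e \<in> cylinder d n S \<Longrightarrow> n \<le> m \<Longrightarrow> S' \<subseteq> S \<Longrightarrow> cylinder e m S' \<subseteq> cylinder d n S"
proof
  fix q assume e: "e \<in> cylinder d n S" "n \<le> m" "S' \<subseteq> S" "q \<in> cylinder e m S'"
  then have q: "agree m e q" "\<And>i. i \<ge> m \<Longrightarrow> q i \<in> S'" by (auto simp: cylinder_def)
  have "agree n d q" using e(1,2) q(1) agree_mono agree_trans unfolding cylinder_def by blast
  moreover have "q i \<in> S" if "i \<ge> n" for i
  proof (cases "i < m")
    case True
    then have "q i = e i" using agreeD[OF q(1)] by simp
    then show ?thesis using e(1) that by (simp add: cylinder_def)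
  next
    case False
    then show ?thesis using q(2)[of i] e(3) by auto
  qed
  ultimately show "q \<in> cylinder d n S" by (simp add: cylinder_def)
qed

lemma closed_cylinder: "closed_set (cylinder d n S)"
  unfolding closed_set_def
proof (intro allI impI)
  fix p assume p: "\<forall>m. \<exists>q\<in>cylinder d n S. agree m p q"
  have "p i \<in> S" if "i \<ge> n" for i
  proof -
    obtain q where q: "q \<in> cylinder d n S" "agree (Suc i) p q" using p by blast
    then have "p i = q i" using agreeD by blast
    then show ?thesis using q(1) that by (simp add: cylinder_def)
  qed
  moreover have "agree n d p"
  proof -
    obtain q where "q \<in> cylinder d n S" "agree n p q" using p by blast
    then show ?thesis unfolding cylinder_def using agree_trans agree_sym by blast
  qed
  ultimately show "p \<in> cylinder d n S" by (simp add: cylinder_def)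
qed

lemma cylinder_nonempty: "s \<in> S \<Longrightarrow> (\<lambda>i. if i < n then d i else s) \<in> cylinder d n S"
  by (simp add: cylinder_def agree_def)

lemma cylinder_le:
  assumes q: "q \<in> cylinder d n S" and S: "S \<subseteq> {..K}" and d: "\<And>i. i < n \<Longrightarrow> d i \<le> K"
  shows "q i \<le> K"
proof (cases "i < n")
  case True
  then have "q i = d i" using q agreeD by (simp add: cylinder_def agree_def)
  then show ?thesis using d True by simp
next
  case False
  then have "q i \<in> S" using q by (simp add: cylinder_def)
  then show ?thesis using S by blast
qed

text \<open>Each step kills one class of solutions at the price of one colour; there is one colour more
  than there are classes.\<close>

lemma elimination:
  fixes K :: nat and Good :: "nat \<Rightarrow> baire \<Rightarrow> bool"
  assumes ex: "\<And>q. (\<And>i. q i \<le> K) \<Longrightarrow> \<exists>j<K. Good j q"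
    and step: "\<And>d n S. S \<noteq> {} \<Longrightarrow> S \<subseteq> {..K} \<Longrightarrow> (\<And>i. i < n \<Longrightarrow> d i \<le> K) \<Longrightarrow>
      \<exists>e\<in>cylinder d n S. \<forall>j<K. Good j e \<longrightarrow> (\<exists>m\<ge>n. \<exists>s\<in>S. \<forall>q\<in>cylinder e m (S - {s}). \<not> Good j q)"
  shows False
proof -
  \<comment> \<open>\<open>E\<close> collects the classes killed so far and \<open>S\<close> the
    colours still allowed. A kill moves one unit from \<open>S\<close> to \<open>E\<close>, so the
    sum stays above \<open>K\<close>; as \<open>E\<close> has at most \<open>K\<close> elements, a
    colour always remains.\<close>
  have False if "S \<subseteq> {..K}" "E \<subseteq> {..<K}" "K < card S + card E" "\<And>i. i < n \<Longrightarrow> d i \<le> K"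
    "\<And>q j. q \<in> cylinder d n S \<Longrightarrow> j \<in> E \<Longrightarrow> \<not> Good j q" for S E d n
    using that
  proof (induction "K - card E" arbitrary: S E d n rule: less_induct)
    case less
    have E: "finite E" "card E \<le> K" using less.prems(2) finite_subset[of E] card_mono[of "{..<K}" E] by auto
    then have S: "S \<noteq> {}" "finite S" using less.prems(1,3) finite_subset by auto
    obtain e where e: "e \<in> cylinder d n S"
      "\<And>j. j < K \<Longrightarrow> Good j e \<Longrightarrow> \<exists>m\<ge>n. \<exists>s\<in>S. \<forall>q\<in>cylinder e m (S - {s}). \<not> Good j q"
      using step[where d = d and n = n, OF S(1) less.prems(1,4)] by blast
    have e_le: "e i \<le> K" for i using cylinder_le[where d = d and n = n, OF e(1) less.prems(1,4)] .
    then obtain j where j: "j < K" "Good j e" using ex by blast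
    then have "j \<notin> E" using less.prems(5)[OF e(1)] by blast
    obtain m s where m: "m \<ge> n" "s \<in> S" "\<And>q. q \<in> cylinder e m (S - {s}) \<Longrightarrow> \<not> Good j q"
      using e(2)[OF j] by blast
    have sub: "cylinder e m (S - {s}) \<subseteq> cylinder d n S" using cylinder_mono[OF e(1) m(1)] by blast
    have card: "card (insert j E) = Suc (card E)" "Suc (card (S - {s})) = card S"
      using \<open>j \<notin> E\<close> E(1) card_Suc_Diff1[OF S(2) m(2)] by simp_all
    moreover have "card (insert j E) \<le> K"
      using less.prems(2) j(1) card_mono[of "{..<K}" "insert j E"] by auto
    ultimately have "K - card (insert j E) < K - card E" by linarith
    then show False
    proof (rule less.hyps)
      show "S - {s} \<subseteq> {..K}" "insert j E \<subseteq> {..<K}" using less.prems(1,2) j(1) by auto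
      show "K < card (S - {s}) + card (insert j E)" using card less.prems(3) by linarith
      show "e i \<le> K" for i by (rule e_le)
      show "\<not> Good j' q" if "q \<in> cylinder e m (S - {s})" "j' \<in> insert j E" for q j'
        using that m(3) sub less.prems(5) by blast
    qed
  qed
  from this[of "{..K}" "{}" 0 "\<lambda>_. 0"] show False by simp
qed

text \<open>Beyond some \<open>N\<close> all points of \<open>F\<close> have their limit colour
  \<open>j\<close>. A homogeneous subset of \<open>A\<close> taken beyond \<open>N\<close> has
  colour \<open>j\<close> too, because each of its points has limit colour \<open>j\<close>.\<close>

lemma extend_homogeneous:
  assumes p: "p \<in> insts SRT22"
    and A_def: "A = {x. eventually (\<lambda>s. column p x s = j) sequentially}" and A: "infinite A"
    and F: "F \<subseteq> A" "F \<subseteq> {..<u}" "\<And>x y. x \<in> F \<Longrightarrow> y \<in> F \<Longrightarrow> x \<noteq> y \<Longrightarrow> column p x y = j"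
  shows "\<exists>H\<subseteq>A. infinite H \<and> H \<inter> {..<u} = F \<and> (\<forall>x\<in>H. \<forall>y\<in>H. x \<noteq> y \<longrightarrow> column p x y = j)"
proof -
  have sym: "column p x y = column p y x" "column p x y \<le> 1" for x y
    using p unfolding insts_SRT22 by blast+
  have "eventually (\<lambda>s. \<forall>x\<in>F. column p x s = j) sequentially"
    using F(1,2) finite_subset[OF F(2)] by (intro eventually_ball_finite) (auto simp: A_def)
  then obtain N where N: "\<And>s x. s \<ge> N \<Longrightarrow> x \<in> F \<Longrightarrow> column p x s = j"
    unfolding eventually_sequentially by blast
  have "infinite (A - {..<max u N})" using A by simp
  then have "\<exists>Y t. Y \<subseteq> A - {..<max u N} \<and> infinite Y \<and> t < 2 \<and>
      (\<forall>x\<in>Y. \<forall>y\<in>Y. x \<noteq> y \<longrightarrow> column p (Min {x, y}) (Max {x, y}) = t)"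
  proof (rule Ramsey2)
    show "\<forall>x\<in>A - {..<max u N}. \<forall>y\<in>A - {..<max u N}. x \<noteq> y \<longrightarrow> column p (Min {x, y}) (Max {x, y}) < 2"
      using sym(2) by (auto simp: less_Suc_eq_le numeral_2_eq_2)
  qed
  then obtain Y t where Y: "Y \<subseteq> A - {..<max u N}" "infinite Y"
    "\<forall>x\<in>Y. \<forall>y\<in>Y. x \<noteq> y \<longrightarrow> column p (Min {x, y}) (Max {x, y}) = t" by (elim exE conjE)
  have Yt: "column p x y = t" if "x \<in> Y" "y \<in> Y" "x \<noteq> y" for x y
  proof -
    have "column p (Min {x, y}) (Max {x, y}) = t" using Y(3) that by blast
    then show ?thesis using sym(1)[of x y] by (cases "x \<le> y") (simp_all add: min_def max_def)
  qed
  obtain x where x: "x \<in> Y" using Y(2) infinite_nat_iff_unbounded by blast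
  then have "eventually (\<lambda>s. column p x s = j) sequentially" using Y(1) by (auto simp: A_def)
  then obtain M where M: "\<And>s. s \<ge> M \<Longrightarrow> column p x s = j" unfolding eventually_sequentially by blast
  obtain y where "y \<in> Y" "y > max x M" using Y(2) unfolding infinite_nat_iff_unbounded by blast
  then have t: "t = j" using M[of y] Yt[OF x] by force
  have FY: "column p x y = j" "column p y x = j" if "x \<in> F" "y \<in> Y" for x y
  proof -
    have "y \<in> A - {..<max u N}" using that(2) Y(1) by blast
    then have "y \<ge> N" by (simp add: not_less)
    then show "column p x y = j" using that(1) by (rule N)
    then show "column p y x = j" using sym(1) by simp
  qed
  show ?thesis
  proof (intro exI[of _ "F \<union> Y"] conjI)
    show "F \<union> Y \<subseteq> A" using F(1) Y(1) by blast
    show "infinite (F \<union> Y)" using Y(2) by simp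
    show "(F \<union> Y) \<inter> {..<u} = F" using F(2) Y(1) by auto
    show "\<forall>x\<in>F \<union> Y. \<forall>y\<in>F \<union> Y. x \<noteq> y \<longrightarrow> column p x y = j" using F(3) Yt FY t by blast
  qed
qed

theorem not_RT1_fin_le_SRT22: "\<not> RT1_fin \<le>\<^sub>W SRT22"
proof
  assume "RT1_fin \<le>\<^sub>W SRT22"
  then obtain \<Phi> \<Psi> where red: "reduction RT1_fin SRT22 \<Phi> \<Psi>" unfolding weihrauch_le_iff by blast
  define A where "A j q = {x. eventually (\<lambda>s. column (\<Phi> q) x s = j) sequentially}" for j q
  have fin: "finite (range q)" if "\<forall>i. q i \<le> 2" for q :: baire
    using that by (intro finite_subset[of "range q" "{..2}"]) auto
  have inst: "q \<in> insts RT1_fin" "\<Phi> q \<in> insts SRT22" if "\<forall>i. q i \<le> 2" for q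
    using fin[OF that] red by (auto simp: insts_RT1_fin reduction_def)
  show False
  proof (rule elimination[of 2 "\<lambda>j q. infinite (A j q)"])
    fix q :: baire assume "\<And>i. q i \<le> 2"
    then have q: "\<forall>i. q i \<le> 2" by blast
    have "x \<in> A 0 q \<union> A 1 q" for x
    proof -
      obtain i where i: "eventually (\<lambda>s. column (\<Phi> q) x s = i) sequentially"
        using inst(2)[OF q] unfolding insts_SRT22 by blast
      then obtain s where "column (\<Phi> q) x s = i" unfolding eventually_sequentially by blast
      then have "i \<le> 1" using inst(2)[OF q] unfolding insts_SRT22 by blast
      then have "i = 0 \<or> i = 1" by linarith
      then show ?thesis using i by (auto simp: A_def)
    qed
    then have "UNIV \<subseteq> A 0 q \<union> A 1 q" by blast
    then have "infinite (A 0 q) \<or> infinite (A 1 q)"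
      by (meson finite_UnI finite_subset infinite_UNIV_nat)
    then show "\<exists>j<2. infinite (A j q)" by (metis one_less_numeral_iff pos2 semiring_norm(76))
  next
    fix d :: baire and n and S :: "nat set"
    assume S: "S \<noteq> {}" "S \<subseteq> {..2}" and d: "\<And>i. i < n \<Longrightarrow> d i \<le> 2"
    let ?X = "cylinder d n S"
    have le2: "\<forall>i. q i \<le> 2" if "q \<in> ?X" for q
      using cylinder_le[where d = d and n = n, OF that S(2) d] by blast
    obtain s where "s \<in> S" using S(1) by blast
    then have ne: "?X \<noteq> {}" using cylinder_nonempty by blast
    have cont: "continuous_map ?X \<Phi>"
      using inst(1) le2 by (intro reduction_continuous_map[OF red]) blast
    have "\<exists>l. eventually (\<lambda>s. column (\<Phi> p) x s = l) sequentially" if "p \<in> ?X" for p x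
      using inst(2)[OF le2[OF that]] unfolding insts_SRT22 by blast
    from generic_limits[OF closed_cylinder ne cont this] obtain e where e: "e \<in> ?X"
      "\<And>x. \<exists>m l. \<forall>q\<in>?X. agree m e q \<longrightarrow> eventually (\<lambda>s. column (\<Phi> q) x s = l) sequentially"
      by blast
    have "\<exists>m\<ge>n. \<exists>s\<in>S. \<forall>q\<in>cylinder e m (S - {s}). \<not> infinite (A j q)" if A: "infinite (A j e)" for j
    proof -
      note ei = inst[OF le2[OF e(1)]]
      obtain H where H: "H \<subseteq> A j e" "infinite H"
        "\<And>x y. x \<in> H \<Longrightarrow> y \<in> H \<Longrightarrow> x \<noteq> y \<Longrightarrow> column (\<Phi> e) x y = j"
        using extend_homogeneous[OF ei(2) A_def A, of "{}" 0] by auto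
      have Hs: "indicator H \<in> sols SRT22 (\<Phi> e)"
        unfolding sols_SRT22[OF ei(2)] using H(2,3)
        by (intro exI[of _ H] conjI refl exI[of _ j]) simp_all
      then have "\<Psi> (join e (indicator H)) \<in> sols RT1_fin e" using red ei(1) by (simp add: reduction_def)
      then obtain Z s where Z: "\<Psi> (join e (indicator H)) = indicator Z" "infinite Z" "\<And>x. x \<in> Z \<Longrightarrow> e x = s"
        using ei(1) by (auto simp: insts_RT1_fin sols_RT1_fin)
      \<comment> \<open>Beyond the prefix only colours from \<open>S\<close> occur, so the colour
        \<open>s\<close> of the output can be struck from \<open>S\<close>.\<close>
      obtain y where y: "y \<in> Z" "y \<ge> n" using Z(2) unfolding infinite_nat_iff_unbounded_le by blast
      then have s: "s \<in> S" using Z(3)[OF y(1)] e(1) by (auto simp: cylinder_def)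
      from reduction_continuous_sol[OF red, OF ei(1), OF Hs, of "Suc y"] obtain u where u:
        "\<forall>q\<in>insts RT1_fin. \<forall>g'\<in>sols SRT22 (\<Phi> q). agree u e q \<longrightarrow> agree u (indicator H) g' \<longrightarrow>
          agree (Suc y) (\<Psi> (join e (indicator H))) (\<Psi> (join q g'))" ..
      define F where "F = H \<inter> {..<u}"
      \<comment> \<open>Genericity of \<open>e\<close> keeps the finitely many limit colours of
        \<open>F\<close> near \<open>e\<close>. If \<open>A j q\<close> is infinite,
        \<open>F\<close> therefore extends to a solution that still commits the output to
        \<open>y\<close>, whose colour has died out.\<close>
      have "\<exists>m. \<forall>q. agree m e q \<longrightarrow> (\<forall>x<u. x \<in> F \<longrightarrow> q \<in> ?X \<longrightarrow> x \<in> A j q)"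
      proof (rule eventually_agree_all)
        fix x
        obtain m l where m: "\<forall>q\<in>?X. agree m e q \<longrightarrow> eventually (\<lambda>s. column (\<Phi> q) x s = l) sequentially"
          using e(2) by blast
        have "l = j" if "x \<in> F"
        proof -
          have "eventually (\<lambda>s. column (\<Phi> e) x s = j) sequentially"
            using that H(1) by (auto simp: F_def A_def)
          moreover have "eventually (\<lambda>s. column (\<Phi> e) x s = l) sequentially" using m e(1) by simp
          ultimately have "eventually (\<lambda>s :: nat. l = j) sequentially" by eventually_elim simp
          then show ?thesis by simp
        qed
        then show "\<exists>m. \<forall>q. agree m e q \<longrightarrow> x \<in> F \<longrightarrow> q \<in> ?X \<longrightarrow> x \<in> A j q"
          using m by (auto simp: A_def)
      qed
      then obtain m1 where m1: "\<And>q x. agree m1 e q \<Longrightarrow> x < u \<Longrightarrow> x \<in> F \<Longrightarrow> q \<in> ?X \<Longrightarrow> x \<in> A j q" by blast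
      have "finite (prod_encode ` (F \<times> F))" by (simp add: F_def)
      then obtain N where N: "\<And>x y. x \<in> F \<Longrightarrow> y \<in> F \<Longrightarrow> prod_encode (x, y) < N"
        by (metis finite_nat_set_iff_bounded imageI mem_Sigma_iff)
      obtain m2 where m2: "\<forall>q\<in>?X. agree m2 e q \<longrightarrow> agree N (\<Phi> e) (\<Phi> q)"
        using cont e(1) unfolding continuous_map_def by blast
      define m where "m = max n (max u (max (Suc y) (max m1 m2)))"
      have "\<not> infinite (A j q)" if q: "q \<in> cylinder e m (S - {s})" for q
      proof
        assume inf: "infinite (A j q)"
        have "cylinder e m (S - {s}) \<subseteq> ?X" by (rule cylinder_mono[OF e(1)]) (auto simp: m_def)
        then have qX: "q \<in> ?X" using q by blast
        note qi = inst[OF le2[OF qX]]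
        have "agree m e q" using q by (simp add: cylinder_def)
        then have agr: "agree u e q" "agree (Suc y) e q" "agree m1 e q" "agree m2 e q"
          by (auto intro: agree_mono simp: m_def)
        have F: "F \<subseteq> A j q" "F \<subseteq> {..<u}" using m1[OF agr(3) _ _ qX] by (auto simp: F_def)
        have N': "agree N (\<Phi> e) (\<Phi> q)" using m2 qX agr(4) by blast
        have "column (\<Phi> q) x y = j" if "x \<in> F" "y \<in> F" "x \<noteq> y" for x y
          using agreeD[OF N' N[OF that(1,2)]] H(3)[of x y] that by (simp add: column_def F_def)
        then have "\<exists>H\<subseteq>A j q. infinite H \<and> H \<inter> {..<u} = F \<and>
            (\<forall>x\<in>H. \<forall>y\<in>H. x \<noteq> y \<longrightarrow> column (\<Phi> q) x y = j)"
          by (intro extend_homogeneous[OF qi(2) A_def inf F])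
        then obtain H' where H': "infinite H'" "H' \<inter> {..<u} = F"
          "\<forall>x\<in>H'. \<forall>y\<in>H'. x \<noteq> y \<longrightarrow> column (\<Phi> q) x y = j"
          by (elim exE conjE)
        have H's: "indicator H' \<in> sols SRT22 (\<Phi> q)"
          unfolding sols_SRT22[OF qi(2)] using H'(1,3)
          by (intro exI[of _ H'] conjI refl exI[of _ j]) simp_all
        then have "\<Psi> (join q (indicator H')) \<in> sols RT1_fin q"
          using red qi(1) by (simp add: reduction_def)
        then obtain Z' s' where Z': "\<Psi> (join q (indicator H')) = indicator Z'" "infinite Z'"
          "\<And>x. x \<in> Z' \<Longrightarrow> q x = s'"
          using qi(1) by (auto simp: insts_RT1_fin sols_RT1_fin)
        have "agree u (indicator H) (indicator H')" using H'(2) by (simp add: agree_indicator F_def)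
        then have "agree (Suc y) (indicator Z) (indicator Z')"
          using bspec[OF bspec[OF u qi(1)] H's] agr(1) by (simp add: Z(1) Z'(1))
        then have "y \<in> Z'" using y(1) indicator_agree_mem by blast
        then have "s' = s" using Z'(3) Z(3)[OF y(1)] agreeD[OF agr(2), of y] by simp
        moreover obtain x where "x \<in> Z'" "x \<ge> m" using Z'(2) unfolding infinite_nat_iff_unbounded_le by blast
        ultimately show False using Z'(3)[of x] q by (auto simp: cylinder_def)
      qed
      then show ?thesis using s by (intro exI[of _ m]) (auto simp: m_def)
    qed
    then show "\<exists>e\<in>?X. \<forall>j<2. infinite (A j e) \<longrightarrow>
        (\<exists>m\<ge>n. \<exists>s\<in>S. \<forall>q\<in>cylinder e m (S - {s}). \<not> infinite (A j q))" using e(1) by blast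
  qed
qed

subsection \<open>\<open>wRSg\<close> and \<open>RT1_fin\<close>\<close>

definition rsg_sol :: "nat set \<Rightarrow> nat set set \<Rightarrow> nat set \<Rightarrow> bool" where
  "rsg_sol V E H \<longleftrightarrow> H \<subseteq> V \<and> infinite H \<and>
    (\<forall>v\<in>H. infinite (H \<inter> nbh E v) \<or> (finite (H \<inter> nbh E v) \<and> card (H \<inter> nbh E v) \<le> 1))"

lemma sols_wRSg:
  assumes "(V, E) \<in> infinite_graphs"
  shows "sols wRSg (code_graph (V, E)) = indicator ` {H. rsg_sol V E H}"
  by (simp add: sols_coded_problem[OF inj_on_code_graph assms] wRSg_def rsg_sol_def)

text \<open>The definition of \<open>wRSg\<close> is exploited in this form: two neighbours inside a
  solution force infinitely many.\<close>

lemma two_neighbours: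
  assumes H: "rsg_sol V E H" "v \<in> H" and xy: "x \<in> H" "y \<in> H" "x \<noteq> y" "{v, x} \<in> E" "{v, y} \<in> E"
  shows "infinite (H \<inter> nbh E v)"
proof
  assume fin: "finite (H \<inter> nbh E v)"
  have "{x, y} \<subseteq> H \<inter> nbh E v" using xy by (simp add: nbh_def)
  then have "card {x, y} \<le> card (H \<inter> nbh E v)" using fin card_mono by blast
  moreover have "card (H \<inter> nbh E v) \<le> 1" using H fin by (auto simp: rsg_sol_def)
  ultimately show False using xy(3) by simp
qed

lemma code_graph_agreeI:
  assumes "\<And>x. x < n \<Longrightarrow> x \<in> V \<longleftrightarrow> x \<in> V'"
    and "\<And>x y. x < n \<Longrightarrow> y < n \<Longrightarrow> x \<noteq> y \<Longrightarrow> {x, y} \<in> E \<longleftrightarrow> {x, y} \<in> E'"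
  shows "agree n (code_graph (V, E)) (code_graph (V', E'))"
  using assms by (intro agree_even_odd)
    (simp_all add: code_graph_vertex code_graph_def code_pairfun_def indicator_def)

theorem not_wRSg_le_RT1_fin: "\<not> wRSg \<le>\<^sub>W RT1_fin"
proof
  assume "wRSg \<le>\<^sub>W RT1_fin"
  then obtain \<Phi> \<Psi> where red: "reduction wRSg RT1_fin \<Phi> \<Psi>" unfolding weihrauch_le_iff by blast
  define X where "X = {code_graph (UNIV, E) | E. E \<subseteq> nsets UNIV 2}"
  have sub: "X \<subseteq> insts wRSg" by (auto simp: X_def wRSg_def infinite_graphs_def)
  have fin: "finite (range (\<Phi> p))" if "p \<in> X" for p
    using red sub that by (auto simp: reduction_def insts_RT1_fin)
  have cont: "continuous_map X \<Phi>" by (rule reduction_continuous_map[OF red sub])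
  have "closed_set X"
    unfolding closed_set_def
  proof (intro allI impI)
    fix p assume p: "\<forall>n. \<exists>q\<in>X. agree n p q"
    have near: "\<exists>E. agree n p (code_graph (UNIV, E))" for n
    proof -
      obtain q where "q \<in> X" "agree n p q" using p by blast
      then show ?thesis unfolding X_def by blast
    qed
    \<comment> \<open>Each bit of the limit is shared with the code of some graph; comparing the
      bits for both orders of a pair shows that the limit is symmetric.\<close>
    define E where "E = {{x, y} | x y. x \<noteq> y \<and> p (Suc (2 * prod_encode (x, y))) \<noteq> 0}"
    have E: "E \<subseteq> nsets UNIV 2" by (auto simp: E_def nsets_def)
    have edge: "{x, y} \<in> E \<longleftrightarrow> p (Suc (2 * prod_encode (x, y))) \<noteq> 0" if "x \<noteq> y" for x y
    proof -
      define N where "N = Suc (Suc (2 * prod_encode (x, y)) + Suc (2 * prod_encode (y, x)))"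
      obtain E' where E': "agree N p (code_graph (UNIV, E'))" using near by blast
      have "p (Suc (2 * prod_encode (x, y))) = of_bool ({x, y} \<in> E')"
        "p (Suc (2 * prod_encode (y, x))) = of_bool ({y, x} \<in> E')"
        using that by (auto simp: agreeD[OF E'] N_def code_graph_edge)
      then have "p (Suc (2 * prod_encode (y, x))) = p (Suc (2 * prod_encode (x, y)))"
        by (simp add: insert_commute)
      then show ?thesis using that by (auto simp: E_def doubleton_eq_iff)
    qed
    have "agree n p (code_graph (UNIV, E))" for n
    proof (rule agree_even_odd)
      show "p (2 * x) = code_graph (UNIV, E) (2 * x)" for x
        using near[of "Suc (2 * x)"] by (auto simp: agree_def code_graph_vertex)
      fix x y
      obtain E' where "agree (Suc (Suc (2 * prod_encode (x, y)))) p (code_graph (UNIV, E'))" using near by blast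
      then have "p (Suc (2 * prod_encode (x, y))) = code_graph (UNIV, E') (Suc (2 * prod_encode (x, y)))"
        by (rule agreeD) simp
      then show "p (Suc (2 * prod_encode (x, y))) = code_graph (UNIV, E) (Suc (2 * prod_encode (x, y)))"
        using edge[of x y] by (cases "x = y") (simp_all add: code_graph_def code_pairfun_def indicator_def)
    qed
    then have "p i = code_graph (UNIV, E) i" for i using agreeD[of "Suc i" p] by blast
    then have "p = code_graph (UNIV, E)" by (rule ext)
    then show "p \<in> X" using E by (auto simp: X_def)
  qed
  moreover have empty: "code_graph (UNIV, {}) \<in> X" by (auto simp: X_def)
  moreover have "\<exists>k. \<forall>x. \<Phi> p x \<le> k" if "p \<in> X" for p
    using fin[OF that] by (metis finite_nat_set_iff_bounded_le rangeI)
  moreover have "\<forall>x. \<Phi> p x \<le> k" if p: "p \<in> X" "\<And>n. \<exists>q\<in>X. agree n p q \<and> (\<forall>x. \<Phi> q x \<le> k)" for k p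
  proof
    fix x
    show "\<Phi> p x \<le> k"
    proof (rule closed_value[OF cont p(1), where Q = "\<lambda>r. r x \<le> k" and n = "Suc x"])
      show "\<exists>q\<in>X. agree n p q \<and> \<Phi> q x \<le> k" for n using p(2) by blast
    qed (simp add: agree_def)
  qed
  ultimately have "\<exists>p\<in>X. agree 0 (code_graph (UNIV, {})) p \<and>
      (\<exists>m k. \<forall>q\<in>X. agree m p q \<longrightarrow> (\<forall>x. \<Phi> q x \<le> k))"
    by (rule baire_cover)
  then obtain p0 n0 k where p0: "p0 \<in> X" and k: "\<And>q x. q \<in> X \<Longrightarrow> agree n0 p0 q \<Longrightarrow> \<Phi> q x \<le> k"
    by blast
  from p0 obtain E0 where E0: "E0 \<subseteq> nsets UNIV 2" and p0_eq: "p0 = code_graph (UNIV, E0)"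
    by (auto simp: X_def)
  \<comment> \<open>The graph found by Baire's theorem is kept below \<open>n0\<close> and continued
    by disjoint cliques, the colour classes of \<open>d\<close>.\<close>
  define E where "E d = {e \<in> E0. e \<subseteq> {..<n0}} \<union> {{x, y} | x y. x \<noteq> y \<and> n0 \<le> x \<and> n0 \<le> y \<and> d x = d y}"
    for d :: baire
  define G where "G d = code_graph (UNIV, E d)" for d
  have E: "E d \<subseteq> nsets UNIV 2" for d using E0 by (auto simp: E_def nsets_def)
  have E_iff: "{x, y} \<in> E d \<longleftrightarrow> {x, y} \<in> E0 \<and> x < n0 \<and> y < n0 \<or> n0 \<le> x \<and> n0 \<le> y \<and> d x = d y"
    if "x \<noteq> y" for x y d
    using that by (auto simp: E_def doubleton_eq_iff)
  have GX: "G d \<in> X" for d using E by (auto simp: G_def X_def)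
  then have Gi: "G d \<in> insts wRSg" for d using sub by blast
  have "agree n0 (code_graph (UNIV, E0)) (G d)" for d
    unfolding G_def by (rule code_graph_agreeI) (auto simp: E_iff)
  then have bound: "\<Phi> (G d) x \<le> k" for d x using k[OF GX] by (simp add: p0_eq)
  have G_agree: "agree m (G d) (G d')" if "agree m d d'" for m d d'
    unfolding G_def by (rule code_graph_agreeI) (use agreeD[OF that] in \<open>auto simp: E_iff\<close>)
  define Good where "Good j d \<longleftrightarrow> infinite {x. \<Phi> (G d) x = j}" for j d
  show False
  \<comment> \<open>\<open>\<Phi> (G d)\<close> takes values up to \<open>k\<close>, giving
    \<open>Suc k\<close> classes of solutions; the cliques are labelled by the numbers up to
    \<open>Suc k\<close>, one more.\<close>
  proof (rule elimination[of "Suc k" Good])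
    fix q :: baire
    have "finite (range (\<Phi> (G q)))" using fin[OF GX] .
    then obtain x0 where "infinite {x \<in> UNIV. \<Phi> (G q) x = \<Phi> (G q) x0}"
      using pigeonhole_infinite[OF infinite_UNIV_nat] by blast
    then show "\<exists>j<Suc k. Good j q" using bound[of q x0] by (auto simp: Good_def less_Suc_eq_le)
  next
    fix d :: baire and n and S :: "nat set"
    assume "S \<noteq> {}"
    then obtain s where s: "s \<in> S" by blast
    \<comment> \<open>All later vertices join clique \<open>s\<close>, so every output for
      \<open>e\<close> must use this clique.\<close>
    define e where "e = (\<lambda>i. if i < n then d i else s)"
    have "\<exists>m\<ge>n. \<exists>s\<in>S. \<forall>q\<in>cylinder e m (S - {s}). \<not> Good j q" if good: "Good j e" for j
    proof -
      \<comment> \<open>Taking the full colour class as solution makes its initial segments depend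
        only on initial segments of \<open>\<Phi> (G q)\<close>.\<close>
      define H where "H q = {x. \<Phi> (G q) x = j}" for q
      have Hs: "indicator (H q) \<in> sols RT1_fin (\<Phi> (G q))" if "Good j q" for q
        using that by (auto simp: sols_RT1_fin[OF fin[OF GX]] H_def Good_def)
      have \<Psi>: "\<exists>Z. \<Psi> (join (G q) (indicator (H q))) = indicator Z \<and> rsg_sol UNIV (E q) Z"
        if "Good j q" for q
      proof -
        have "\<Psi> (join (G q) (indicator (H q))) \<in> sols wRSg (G q)"
          using red Gi Hs[OF that] by (simp add: reduction_def)
        moreover have "(UNIV, E q) \<in> infinite_graphs" using E by (simp add: infinite_graphs_def)
        ultimately show ?thesis unfolding G_def by (subst (asm) sols_wRSg) auto
      qed
      obtain Z where Z: "\<Psi> (join (G e) (indicator (H e))) = indicator Z" "infinite Z"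
        using \<Psi>[OF good] by (auto simp: rsg_sol_def)
      \<comment> \<open>Three vertices of clique \<open>s\<close> in the output give
        \<open>x\<close> two neighbours, which would force infinitely many; but clique
        \<open>s\<close> receives no vertices of \<open>q\<close> beyond \<open>m\<close>.\<close>
      obtain x where x: "x \<in> Z" "x \<ge> max n n0" using Z(2) unfolding infinite_nat_iff_unbounded_le by blast
      obtain y where y: "y \<in> Z" "y > x" using Z(2) unfolding infinite_nat_iff_unbounded by blast
      obtain z where z: "z \<in> Z" "z > y" using Z(2) unfolding infinite_nat_iff_unbounded by blast
      from reduction_continuous_sol[OF red, OF Gi, OF Hs[OF good], of "Suc z"] obtain u where u:
        "\<forall>q\<in>insts wRSg. \<forall>g'\<in>sols RT1_fin (\<Phi> q). agree u (G e) q \<longrightarrow> agree u (indicator (H e)) g' \<longrightarrow>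
          agree (Suc z) (\<Psi> (join (G e) (indicator (H e)))) (\<Psi> (join q g'))" ..
      from reduction_continuous_inst[OF red Gi, of e u] obtain m1 where
        m1: "\<forall>q\<in>insts wRSg. agree m1 (G e) q \<longrightarrow> agree u (\<Phi> (G e)) (\<Phi> q)" ..
      define m where "m = max n (max (Suc z) (max u m1))"
      have "\<not> Good j q" if q: "q \<in> cylinder e m (S - {s})" for q
      proof
        assume good': "Good j q"
        have agr: "agree m e q" using q by (simp add: cylinder_def)
        then have "agree m (G e) (G q)" by (rule G_agree)
        then have G: "agree u (G e) (G q)" "agree m1 (G e) (G q)" by (auto intro: agree_mono simp: m_def)
        then have "agree u (\<Phi> (G e)) (\<Phi> (G q))" using m1 Gi by blast
        then have "agree u (indicator (H e)) (indicator (H q))" by (simp add: agree_def H_def indicator_def)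
        then have agr': "agree (Suc z) (\<Psi> (join (G e) (indicator (H e)))) (\<Psi> (join (G q) (indicator (H q))))"
          using bspec[OF bspec[OF u Gi] Hs[OF good']] G(1) by simp
        obtain Z' where Z': "\<Psi> (join (G q) (indicator (H q))) = indicator Z'"
          "rsg_sol UNIV (E q) Z'"
          using \<Psi>[OF good'] by blast
        have mem: "v \<in> Z'" if "v \<in> Z" "v \<le> z" for v
          using indicator_agree_mem[OF agr'[unfolded Z(1) Z'(1)], of v] that by simp
        have col: "q v = s" if "n \<le> v" "v \<le> z" for v
          using agreeD[OF agr, of v] that by (simp add: e_def m_def)
        have "{x, y} \<in> E q" "{x, z} \<in> E q" using x y z by (auto simp: E_iff col)
        then have "infinite (Z' \<inter> nbh (E q) x)"
          using x y z by (intro two_neighbours[OF Z'(2), of _ y z] mem) auto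
        moreover have "nbh (E q) x \<subseteq> {..<m}"
        proof
          fix w assume "w \<in> nbh (E q) x"
          then have w: "{x, w} \<in> E q" by (simp add: nbh_def)
          then have "x \<noteq> w" using edge_neq[OF E] by blast
          then have "q w = s" using w x col[of x] y z by (auto simp: E_iff)
          then show "w \<in> {..<m}" using q by (auto simp: cylinder_def not_less[symmetric])
        qed
        ultimately show False using finite_subset by blast
      qed
      then show ?thesis using s by (intro exI[of _ m]) (auto simp: m_def)
    qed
    moreover have "e \<in> cylinder d n S" unfolding e_def using s by (rule cylinder_nonempty)
    ultimately show "\<exists>e\<in>cylinder d n S. \<forall>j<Suc k. Good j e \<longrightarrow>
        (\<exists>m\<ge>n. \<exists>s\<in>S. \<forall>q\<in>cylinder e m (S - {s}). \<not> Good j q)" by blast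
  qed
qed

section \<open>Reductions\<close>

lemma code_graph_cases:
  assumes "E \<subseteq> nsets V 2"
  shows "code_graph (V, E) n = (if even n then of_bool (n div 2 \<in> V)
    else of_bool ({fst (prod_decode (n div 2)), snd (prod_decode (n div 2))} \<in> E))"
  using edge_neq[OF assms, of "snd (prod_decode (n div 2))" "snd (prod_decode (n div 2))"]
  by (auto simp: code_graph_def join_def code_pairfun_def indicator_def split: prod.splits)

lemma sols_wRSgr_subset:
  assumes "(V, E) \<in> infinite_graphs"
  shows "sols wRSgr (code_graph (V, E)) \<subseteq> sols wRSg (code_graph (V, E))"
  unfolding sols_wRSg[OF assms] sols_wRSgr[OF assms]
  by (rule image_mono) (fastforce simp: rsgr_sol_def rsg_sol_def)

lemma wRSg_le_wRSgr: "wRSg \<le>\<^sub>W wRSgr"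
proof (rule weihrauch_le_mono)
  show "insts wRSg \<subseteq> insts wRSgr" by (simp add: wRSg_def wRSgr_def)
  show "sols wRSgr f \<subseteq> sols wRSg f" if "f \<in> insts wRSg" for f
    using that sols_wRSgr_subset by (auto simp: wRSg_def)
qed

lemma sols_RT22:
  assumes "g \<in> sols RT22 p"
  shows "\<exists>H i. g = indicator H \<and> infinite H \<and> (\<forall>x\<in>H. \<forall>y\<in>H. x \<noteq> y \<longrightarrow> column p x y = i)"
proof -
  from assms obtain H c where "g = indicator H" "code_pairfun c = p" "H \<in> homogeneous_sets c"
    by (auto simp: RT22_def coded_problem_def)
  then show ?thesis by (auto simp: homogeneous_sets_iff column_code_pairfun)
qed

lemma SRT22_le_RT22: "SRT22 \<le>\<^sub>W RT22"
proof (rule weihrauch_le_mono)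
  show "insts SRT22 \<subseteq> insts RT22" by (auto simp: SRT22_def RT22_def)
  show "sols RT22 p \<subseteq> sols SRT22 p" if "p \<in> insts SRT22" for p
  proof
    fix g assume "g \<in> sols RT22 p"
    from sols_RT22[OF this] show "g \<in> sols SRT22 p" unfolding sols_SRT22[OF that] by (elim exE) blast
  qed
qed

text \<open>The vertex set may be a proper subset of the natural numbers, so each number stands for
  the next vertex. The image of a homogeneous set is a clique or independent, and it is infinite
  because \<open>nx\<close> never decreases its argument.\<close>

lemma wRSgr_le_RT22: "wRSgr \<le>\<^sub>W RT22"
proof -
  define nx where "nx p x = (LEAST v. x \<le> v \<and> p (2 * v) \<noteq> 0)" for p :: baire and x
  define \<Phi> where "\<Phi> p n = (if fst (prod_decode n) = snd (prod_decode n) then 0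
    else p (Suc (2 * prod_encode (nx p (fst (prod_decode n)), nx p (snd (prod_decode n))))))"
    for p :: baire and n
  \<comment> \<open>The image of the homogeneous set is decidable: a preimage \<open>x\<close> of
    \<open>v\<close> is at most \<open>v\<close>, and \<open>v\<close> is its next vertex when no
    vertex lies in between.\<close>
  define \<Psi> :: "baire \<Rightarrow> baire" where "\<Psi> q v = of_bool (left q (2 * v) \<noteq> 0 \<and>
    (\<exists>x<Suc v. right q x \<noteq> 0 \<and> (\<forall>w<v. x \<le> w \<longrightarrow> left q (2 * w) = 0)))" for q v
  have VE: "\<exists>V E. f = code_graph (V, E) \<and> infinite V \<and> E \<subseteq> nsets V 2" if "f \<in> insts wRSgr" for f
    using that by (auto simp: wRSgr_def infinite_graphs_def)
  have ex: "\<exists>v. x \<le> v \<and> f (2 * v) \<noteq> 0" if f: "f \<in> insts wRSgr" for f x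
  proof -
    obtain V E where V: "f = code_graph (V, E)" "infinite V" using VE[OF f] by blast
    obtain v where "v \<in> V" "x \<le> v" using V(2) unfolding infinite_nat_iff_unbounded_le by blast
    then show ?thesis by (auto simp: V(1) code_graph_vertex)
  qed
  have col: "column (\<Phi> f) x y = (if x = y then 0 else of_bool ({nx f x, nx f y} \<in> E))"
    if "f = code_graph (V, E)" "E \<subseteq> nsets V 2" for f V E x y
    using that by (simp add: column_def \<Phi>_def code_graph_cases)
  have nx: "nx f x \<in> V \<and> x \<le> nx f x" "w < nx f x \<Longrightarrow> x \<le> w \<Longrightarrow> w \<notin> V"
    if "f \<in> insts wRSgr" "f = code_graph (V, E)" for f V E x w
  proof -
    show "nx f x \<in> V \<and> x \<le> nx f x"
      using LeastI_ex[OF ex[OF that(1), of x]] by (simp add: nx_def that(2) code_graph_vertex)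
    show "w < nx f x \<Longrightarrow> x \<le> w \<Longrightarrow> w \<notin> V"
      unfolding nx_def by (drule not_less_Least) (simp add: that(2) code_graph_vertex)
  qed
  show ?thesis
  proof (rule weihrauch_leI[of _ \<Phi> _ \<Psi>])
    show "comp_on (insts wRSgr) \<Phi>"
      unfolding \<Phi>_def nx_def by (intro comp_intros ex)
    show "comp_on {join f g | f g. f \<in> insts wRSgr \<and> g \<in> sols RT22 (\<Phi> f)} \<Psi>"
      unfolding \<Psi>_def left_def right_def by (intro comp_intros)
  next
    fix f assume f: "f \<in> insts wRSgr"
    obtain V E where V: "f = code_graph (V, E)" "E \<subseteq> nsets V 2" using VE[OF f] by blast
    define c where "c X = (of_bool (nx f ` X \<in> E) :: nat)" for X
    have "column (\<Phi> f) = column (code_pairfun c)"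
      by (auto simp: col[OF V] column_code_pairfun c_def fun_eq_iff)
    then have "\<Phi> f = code_pairfun c" by (simp add: column_inject)
    moreover have "c \<in> colourings" by (simp add: colourings_def c_def)
    ultimately show "\<Phi> f \<in> insts RT22" by (auto simp: RT22_def)
  next
    fix f g assume f: "f \<in> insts wRSgr" and g: "g \<in> sols RT22 (\<Phi> f)"
    obtain V E where V: "f = code_graph (V, E)" "E \<subseteq> nsets V 2" "infinite V" using VE[OF f] by blast
    from sols_RT22[OF g] obtain H i where H: "g = indicator H" "infinite H"
      "\<forall>x\<in>H. \<forall>y\<in>H. x \<noteq> y \<longrightarrow> column (\<Phi> f) x y = i" by (elim exE conjE)
    note nx = nx[OF f V(1)]
    have uniq: "v = nx f x" if "v \<in> V" "x \<le> v" "\<And>w. w < v \<Longrightarrow> x \<le> w \<Longrightarrow> w \<notin> V" for v x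
      using that nx(1)[of x] nx(2)[of v x] by (metis nat_neq_iff)
    have "v \<in> nx f ` H \<longleftrightarrow> v \<in> V \<and> (\<exists>x<Suc v. x \<in> H \<and> (\<forall>w<v. x \<le> w \<longrightarrow> w \<notin> V))" for v
    proof
      assume "v \<in> nx f ` H"
      then obtain x where x: "x \<in> H" "v = nx f x" by blast
      then have "x < Suc v \<and> x \<in> H \<and> (\<forall>w<v. x \<le> w \<longrightarrow> w \<notin> V)"
        using nx(1)[of x] nx(2)[of _ x] by auto
      then show "v \<in> V \<and> (\<exists>x<Suc v. x \<in> H \<and> (\<forall>w<v. x \<le> w \<longrightarrow> w \<notin> V))"
        using nx(1)[of x] x(2) by blast
    next
      assume "v \<in> V \<and> (\<exists>x<Suc v. x \<in> H \<and> (\<forall>w<v. x \<le> w \<longrightarrow> w \<notin> V))"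
      then obtain x where "v \<in> V" "x \<le> v" "x \<in> H" "\<And>w. w < v \<Longrightarrow> x \<le> w \<Longrightarrow> w \<notin> V"
        by (auto simp: less_Suc_eq_le)
      then show "v \<in> nx f ` H" using uniq[of v x] by blast
    qed
    then have "\<Psi> (join f g) = indicator (nx f ` H)"
      by (auto simp: fun_eq_iff \<Psi>_def V(1) code_graph_vertex H(1) indicator_def)
    moreover have "rsgr_sol V E (nx f ` H)"
    proof -
      have sub: "nx f ` H \<subseteq> V" using nx by blast
      have "infinite (nx f ` H)"
        unfolding infinite_nat_iff_unbounded_le
      proof
        fix m
        obtain x where "x \<in> H" "m \<le> x" using H(2) unfolding infinite_nat_iff_unbounded_le by blast
        then have "nx f x \<in> nx f ` H" "m \<le> nx f x" using nx(1)[of x] by auto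
        then show "\<exists>n\<ge>m. n \<in> nx f ` H" by blast
      qed
      moreover have "clique E (nx f ` H) \<or> indep E (nx f ` H)"
      proof (cases "i = 0")
        case True
        have "{nx f x, nx f y} \<notin> E" if "x \<in> H" "y \<in> H" for x y
          using bspec[OF bspec[OF H(3) that(1)] that(2)] edge_neq[OF V(2), of "nx f y" "nx f y"]
          by (cases "x = y") (auto simp: col[OF V(1,2)] True)
        then show ?thesis by (auto simp: indep_def)
      next
        case False
        have "{nx f x, nx f y} \<in> E" if "x \<in> H" "y \<in> H" "x \<noteq> y" for x y
          using bspec[OF bspec[OF H(3) that(1)] that(2)] False that(3) by (auto simp: col[OF V(1,2)] split: if_splits)
        then show ?thesis unfolding clique_def by blast
      qed
      ultimately show ?thesis using sub rsgr_sol_clique rsgr_sol_indep by blast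
    qed
    moreover have "(V, E) \<in> infinite_graphs" using V by (simp add: infinite_graphs_def)
    ultimately show "\<Psi> (join f g) \<in> sols wRSgr f" by (auto simp: V(1) sols_wRSgr)
  qed
qed

text \<open>The graph is the disjoint union of cliques on the colour classes. By pigeonhole a
  solution contains three points of one colour; such a triple can be searched for, and by
  \<open>two_neighbours\<close> its colour occurs infinitely often in the solution.\<close>

lemma RT1_fin_le_wRSg: "RT1_fin \<le>\<^sub>W wRSg"
proof -
  define \<Phi> :: "baire \<Rightarrow> baire" where "\<Phi> c n = (if even n then 1 else
    of_bool (fst (prod_decode (n div 2)) \<noteq> snd (prod_decode (n div 2)) \<and>
      c (fst (prod_decode (n div 2))) = c (snd (prod_decode (n div 2)))))" for c n
  define E where "E c = {{x, y} | x y. x \<noteq> y \<and> c x = c y}" for c :: baire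
  have E: "E c \<subseteq> nsets UNIV 2" for c by (auto simp: E_def nsets_def)
  have E_iff: "{x, y} \<in> E c \<longleftrightarrow> x \<noteq> y \<and> c x = c y" for x y c
    by (auto simp: E_def doubleton_eq_iff)
  have \<Phi>: "\<Phi> c = code_graph (UNIV, E c)" for c
    by (simp add: fun_eq_iff \<Phi>_def code_graph_cases[OF E] E_iff)
  have G: "(UNIV, E c) \<in> infinite_graphs" for c using E by (simp add: infinite_graphs_def)
  define u where "u t = fst (prod_decode t)" for t
  define v where "v t = fst (prod_decode (snd (prod_decode t)))" for t
  define w where "w t = snd (prod_decode (snd (prod_decode t)))" for t
  \<comment> \<open>In the oracle, even positions hold the colouring and odd positions the solution;
    \<open>t\<close> codes the triple.\<close>
  define Q where "Q q t \<longleftrightarrow> u t < v t \<and> v t < w t \<and> q (Suc (2 * u t)) \<noteq> 0 \<and> q (Suc (2 * v t)) \<noteq> 0 \<and>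
    q (Suc (2 * w t)) \<noteq> 0 \<and> q (2 * u t) = q (2 * v t) \<and> q (2 * u t) = q (2 * w t)" for q :: baire and t
  define \<Psi> :: "baire \<Rightarrow> baire" where
    "\<Psi> q x = of_bool (q (Suc (2 * x)) \<noteq> 0 \<and> q (2 * x) = q (2 * u (LEAST t. Q q t)))" for q x
  have sol: "\<exists>H. g = indicator H \<and> infinite H \<and> rsg_sol UNIV (E c) H"
    if "g \<in> sols wRSg (\<Phi> c)" for g c
    using that unfolding \<Phi> sols_wRSg[OF G] by (auto simp: rsg_sol_def)
  have ex: "\<exists>t. Q (join c g) t" if c: "c \<in> insts RT1_fin" and g: "g \<in> sols wRSg (\<Phi> c)" for c g
  proof -
    obtain H where H: "g = indicator H" "infinite H" using sol[OF g] by blast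
    have "finite (c ` H)" using c finite_subset[of "c ` H" "range c"] by (auto simp: insts_RT1_fin)
    then obtain x0 where x0: "infinite {x \<in> H. c x = c x0}"
      using pigeonhole_infinite[OF H(2)] by blast
    obtain x where x: "x \<in> H" "c x = c x0" using x0 unfolding infinite_nat_iff_unbounded by blast
    obtain y where y: "x < y" "y \<in> H" "c y = c x0" using x0 unfolding infinite_nat_iff_unbounded by blast
    obtain z where z: "y < z" "z \<in> H" "c z = c x0" using x0 unfolding infinite_nat_iff_unbounded by blast
    show ?thesis
      using x y z
      by (intro exI[of _ "prod_encode (x, prod_encode (y, z))"]) (simp add: Q_def u_def v_def w_def H(1))
  qed
  show ?thesis
  proof (rule weihrauch_leI[of _ \<Phi> _ \<Psi>])
    show "comp_on (insts RT1_fin) \<Phi>" unfolding \<Phi>_def by (intro comp_intros)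
    show "\<Phi> c \<in> insts wRSg" for c using G by (auto simp: \<Phi> wRSg_def)
    show "comp_on {join f g | f g. f \<in> insts RT1_fin \<and> g \<in> sols wRSg (\<Phi> f)} \<Psi>"
      unfolding \<Psi>_def Q_def u_def v_def w_def
      by (intro comp_intros) (use ex in \<open>auto simp: Q_def u_def v_def w_def\<close>)
  next
    fix c g assume c: "c \<in> insts RT1_fin" and g: "g \<in> sols wRSg (\<Phi> c)"
    from sol[OF g] obtain H where H: "g = indicator H" "infinite H"
      "rsg_sol UNIV (E c) H" by blast
    define t where "t = (LEAST t. Q (join c g) t)"
    have "Q (join c g) t" unfolding t_def by (rule LeastI_ex[OF ex[OF c g]])
    then have t: "u t < v t" "v t < w t" "u t \<in> H" "v t \<in> H" "w t \<in> H" "c (u t) = c (v t)" "c (u t) = c (w t)"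
      by (auto simp: Q_def H(1) indicator_def split: if_splits)
    have "infinite (H \<inter> nbh (E c) (u t))"
      using t by (intro two_neighbours[OF H(3), of _ "v t" "w t"]) (auto simp: E_iff)
    moreover have "H \<inter> nbh (E c) (u t) \<subseteq> {x \<in> H. c x = c (u t)}" by (auto simp: nbh_def E_iff)
    ultimately have "infinite {x \<in> H. c x = c (u t)}" using finite_subset by blast
    moreover have "\<Psi> (join c g) = indicator {x \<in> H. c x = c (u t)}"
      by (auto simp: fun_eq_iff \<Psi>_def t_def H(1) indicator_def)
    moreover have "finite (range c)" using c by (simp add: insts_RT1_fin)
    ultimately show "\<Psi> (join c g) \<in> sols RT1_fin c" by (auto simp: sols_RT1_fin)
  qed
qed

subsection \<open>Cohesiveness\<close>

text \<open>The search for the first difference stops at index \<open>x\<close>, which makes the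
  relation decidable. For a fixed coordinate the cut-off matters only for finitely many
  \<open>x\<close>.\<close>

definition lex_less :: "baire \<Rightarrow> nat \<Rightarrow> nat \<Rightarrow> bool" where
  "lex_less p x y \<longleftrightarrow> (\<exists>i<Suc x. p (prod_encode (i, x)) < p (prod_encode (i, y)) \<and>
     (\<forall>j<i. p (prod_encode (j, x)) = p (prod_encode (j, y))))"

text \<open>The outer sequences first differ at the smaller of the two first differences, and this
  stays within the cut-off because the cut-off belongs to the first argument.\<close>

lemma lex_less_trans:
  assumes "lex_less p u v" "lex_less p v t" shows "lex_less p u t"
proof -
  from assms(1) obtain i where i: "i \<le> u" "p (prod_encode (i, u)) < p (prod_encode (i, v))"
    "\<And>j. j < i \<Longrightarrow> p (prod_encode (j, u)) = p (prod_encode (j, v))"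
    by (auto simp: lex_less_def less_Suc_eq_le)
  from assms(2) obtain k where k: "p (prod_encode (k, v)) < p (prod_encode (k, t))"
    "\<And>j. j < k \<Longrightarrow> p (prod_encode (j, v)) = p (prod_encode (j, t))"
    by (auto simp: lex_less_def)
  show ?thesis unfolding lex_less_def
  proof (intro exI[of _ "min i k"] conjI allI impI)
    show "p (prod_encode (min i k, u)) < p (prod_encode (min i k, t))"
      using i(2) i(3)[of k] k(1) k(2)[of i] by (cases i k rule: linorder_cases) auto
  qed (use i k in auto)
qed

lemma comp_pred_lex_less:
  assumes "comp_on D F" "comp_on D G"
  shows "comp_pred D (\<lambda>p x. lex_less p (F p x) (G p x))"
proof -
  have "comp_pred D (\<lambda>p z. lex_less p (fst (prod_decode z)) (snd (prod_decode z)))"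
    unfolding lex_less_def by (intro comp_intros)
  from comp_on_comp[OF this comp_on_pair[OF assms]] show ?thesis by simp
qed

lemma comp_pred_lex_less_left:
  assumes "comp_on D F" "comp_on D G"
  shows "comp_pred D (\<lambda>p x. lex_less (left p) (F p x) (G p x))"
proof -
  have "comp_pred D (\<lambda>p z. lex_less (left p) (fst (prod_decode z)) (snd (prod_decode z)))"
    unfolding lex_less_def left_def by (intro comp_intros)
  from comp_on_comp[OF this comp_on_pair[OF assms]] show ?thesis by simp
qed

definition lex_graph :: "baire \<Rightarrow> nat set set" where
  "lex_graph p = {{x, y} | x y. x < y \<and> lex_less p x y}"

lemma lex_graph: "lex_graph p \<subseteq> nsets UNIV 2" "x < y \<Longrightarrow> {x, y} \<in> lex_graph p \<longleftrightarrow> lex_less p x y"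
  by (auto simp: lex_graph_def nsets_def doubleton_eq_iff)

text \<open>A solution \<open>H\<close> of the graph \<open>lex_graph p\<close> is copied until an increasing path with two edges
  has been seen. From its end point on, a path of edges is followed greedily: every vertex met has two
  neighbours in \<open>H\<close>, hence infinitely many. The state \<open>s\<close> is the successor of the last element of
  \<open>H\<close> that was kept.\<close>

definition path_below :: "baire \<Rightarrow> nat set \<Rightarrow> nat \<Rightarrow> bool" where
  "path_below p H n \<longleftrightarrow> (\<exists>u<n. \<exists>v<n. \<exists>t<n. u < v \<and> v < t \<and> u \<in> H \<and> v \<in> H \<and> t \<in> H \<and>
     lex_less p u v \<and> lex_less p v t)"

definition keep :: "baire \<Rightarrow> nat set \<Rightarrow> nat \<Rightarrow> nat \<Rightarrow> bool" where
  "keep p H n s \<longleftrightarrow> n \<in> H \<and> (path_below p H n \<longrightarrow> lex_less p (s - 1) n)"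

definition state :: "baire \<Rightarrow> nat set \<Rightarrow> nat \<Rightarrow> nat" where
  "state p H n = rec_nat 0 (\<lambda>k s. if keep p H k s then Suc k else s) n"

definition kept :: "baire \<Rightarrow> nat set \<Rightarrow> nat set" where
  "kept p H = {n. keep p H n (state p H n)}"

lemma state_Suc: "state p H (Suc n) = (if n \<in> kept p H then Suc n else state p H n)"
  by (simp add: state_def kept_def)

lemma path_below_mono: "path_below p H n \<Longrightarrow> n \<le> m \<Longrightarrow> path_below p H m"
  unfolding path_below_def by (meson less_le_trans)

text \<open>By strong induction the sets before \<open>i\<close> are already decided, so beyond a
  common bound the elements of \<open>C\<close> can first differ at coordinate \<open>i\<close>. The
  bound is at least \<open>i\<close> to get past the cut-off of \<open>lex_less\<close>.\<close>

lemma cohesive_if: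
  fixes C :: "nat set"
  assumes step: "\<And>i N. infinite (C - A i) \<Longrightarrow> infinite (C \<inter> A i) \<Longrightarrow> i \<le> N \<Longrightarrow>
    (\<And>x y j. x \<in> C \<Longrightarrow> y \<in> C \<Longrightarrow> N \<le> x \<Longrightarrow> N \<le> y \<Longrightarrow> j < i \<Longrightarrow> x \<in> A j \<longleftrightarrow> y \<in> A j) \<Longrightarrow> False"
  shows "finite (C - A k) \<or> finite (C \<inter> A k)"
proof (induction k rule: less_induct)
  case (less i)
  have "\<exists>N. \<forall>x\<in>C. \<forall>y\<in>C. N \<le> x \<longrightarrow> N \<le> y \<longrightarrow> (x \<in> A j \<longleftrightarrow> y \<in> A j)" if j: "j < i" for j
  proof -
    have "\<exists>B\<in>{C - A j, C \<inter> A j}. finite B" using less[OF j] by blast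
    then obtain B N where B: "B \<in> {C - A j, C \<inter> A j}" "\<forall>b\<in>B. b < N"
      using finite_nat_set_iff_bounded by meson
    then show ?thesis by (intro exI[of _ N]) (auto simp: not_less[symmetric])
  qed
  then obtain N where N: "\<And>j x y. j < i \<Longrightarrow> x \<in> C \<Longrightarrow> y \<in> C \<Longrightarrow> N j \<le> x \<Longrightarrow> N j \<le> y \<Longrightarrow> x \<in> A j \<longleftrightarrow> y \<in> A j"
    by metis
  define M where "M = Max (insert i (N ` {..<i}))"
  have M: "i \<le> M" "\<And>j. j < i \<Longrightarrow> N j \<le> M" by (auto simp: M_def)
  show ?case
    using step[of i M] M N le_trans by (metis (no_types, lifting))
qed

text \<open>From the end of the path on, the kept elements increase lexicographically, so each bit
  settles once the earlier bits have settled. If there is no path, a set splitting the solution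
  would create one.\<close>

lemma kept_cohesive:
  fixes A :: "nat \<Rightarrow> nat set"
  defines "p \<equiv> code_sequence A"
  assumes sol: "rsg_sol UNIV (lex_graph p) H"
  shows "infinite (kept p H)" and "finite (kept p H - A i) \<or> finite (kept p H \<inter> A i)"
proof -
  have p: "p (prod_encode (i, x)) = of_bool (x \<in> A i)" for i x
    by (simp add: p_def code_sequence_def code_relation_def indicator_def inj_image_mem_iff[OF inj_prod_encode])
  have lexI: "lex_less p x y"
    if "i \<le> x" "x \<notin> A i" "y \<in> A i" "\<And>j. j < i \<Longrightarrow> x \<in> A j \<longleftrightarrow> y \<in> A j" for i x y
    unfolding lex_less_def using that by (intro exI[of _ i]) (auto simp: p)
  \<comment> \<open>Two earlier neighbours force infinitely many, and a later one \<open>w\<close>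
    is reached by an edge going upwards.\<close>
  have next_nbh: "\<exists>w\<ge>n. w \<in> H \<and> lex_less p v w"
    if v: "v \<in> H" and xy: "x \<in> H" "y \<in> H" "x < y" "y < v" "lex_less p x v" "lex_less p y v" for v x y n
  proof -
    have "infinite (H \<inter> nbh (lex_graph p) v)"
      using xy lex_graph(2)[of x v p] lex_graph(2)[of y v p]
      by (intro two_neighbours[OF sol v, of x y]) (auto simp: insert_commute)
    then obtain w where w: "w > max n v" "w \<in> H" "{v, w} \<in> lex_graph p"
      unfolding infinite_nat_iff_unbounded nbh_def by blast
    then show ?thesis using lex_graph(2)[of v w p] by (intro exI[of _ w]) auto
  qed
  have "infinite (kept p H) \<and> (\<forall>i. finite (kept p H - A i) \<or> finite (kept p H \<inter> A i))"
  proof (cases "\<exists>n. path_below p H n")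
    case False
    then have kept: "kept p H = H" by (auto simp: kept_def keep_def)
    have "finite (H - A i) \<or> finite (H \<inter> A i)" for i
    proof (rule cohesive_if)
      fix i N assume i: "infinite (H - A i)" "infinite (H \<inter> A i)" "i \<le> N"
        and const: "\<And>x y j. x \<in> H \<Longrightarrow> y \<in> H \<Longrightarrow> N \<le> x \<Longrightarrow> N \<le> y \<Longrightarrow> j < i \<Longrightarrow> x \<in> A j \<longleftrightarrow> y \<in> A j"
      \<comment> \<open>Two elements outside \<open>A i\<close> are taken before one inside, so that
        the latter has two neighbours and hence a successor; this completes a path.\<close>
      obtain x where x: "x \<in> H - A i" "x \<ge> N" using i(1) unfolding infinite_nat_iff_unbounded_le by blast
      obtain y where y: "y \<in> H - A i" "y > x" using i(1) unfolding infinite_nat_iff_unbounded by blast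
      obtain v where v: "v \<in> H \<inter> A i" "v > y" using i(2) unfolding infinite_nat_iff_unbounded by blast
      have "lex_less p x v" "lex_less p y v"
        using x y v i(3) const[of x v] const[of y v] by (auto intro!: lexI[of i])
      then obtain w where w: "w \<ge> Suc v" "w \<in> H" "lex_less p v w"
        using next_nbh[of v x y "Suc v"] x y v by blast
      then have "path_below p H (Suc w)"
        unfolding path_below_def using x y v \<open>lex_less p x v\<close>
        by (intro exI[of _ x] exI[of _ v] exI[of _ w] conjI) auto
      then show False using False by blast
    qed
    then show ?thesis using sol kept by (simp add: rsg_sol_def)
  next
    case True
    define n0 where "n0 = (LEAST n. path_below p H n)"
    have n0: "path_below p H n0" "\<And>n. n < n0 \<Longrightarrow> \<not> path_below p H n"
      unfolding n0_def using True LeastI_ex not_less_Least by blast+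
    have below: "path_below p H n" if "n \<ge> n0" for n using path_below_mono[OF n0(1) that] .
    from n0(1) obtain u v t where uvt: "u < v" "v < t" "t < n0" "u \<in> H" "v \<in> H" "t \<in> H"
      "lex_less p u v" "lex_less p v t" by (auto simp: path_below_def)
    have "path_below p H (Suc t)" unfolding path_below_def
      using uvt by (intro exI[of _ u] exI[of _ v] exI[of _ t] conjI) auto
    \<comment> \<open>\<open>path_below\<close> has strict bounds, so the first path is noticed
      right after its end \<open>t\<close>; at \<open>t\<close> the set is still copied and
      \<open>t\<close> itself is kept.\<close>
    then have n0_eq: "n0 = Suc t" using n0(2)[of "Suc t"] uvt(3) by (metis Suc_lessI)
    have "t \<in> kept p H" using uvt(6) n0(2)[of t] n0_eq by (simp add: kept_def keep_def)
    \<comment> \<open>Invariant at stage \<open>n\<close>: \<open>l\<close> is the last kept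
      element, two elements of \<open>H\<close> are joined to it from below, and all elements kept
      from \<open>t\<close> on lie lexicographically below it.\<close>
    define good where "good l n \<longleftrightarrow> state p H n = Suc l \<and> l < n \<and> l \<in> kept p H \<and> l \<in> H \<and>
      (\<exists>x y. x \<in> H \<and> y \<in> H \<and> x < y \<and> y < l \<and> lex_less p x l \<and> lex_less p y l) \<and>
      (\<forall>c\<in>kept p H. t \<le> c \<longrightarrow> c < n \<longrightarrow> c = l \<or> c < l \<and> lex_less p c l)" for l n
    have good: "\<exists>l. good l n" if "n \<ge> n0" for n
      using that
    proof (induction n rule: dec_induct)
      case base
      have "good t n0"
        using uvt \<open>t \<in> kept p H\<close> lex_less_trans[OF uvt(7,8)]
        by (auto simp: good_def n0_eq state_Suc)
      then show ?case ..
    next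
      case (step n)
      then obtain l where l: "good l n" by blast
      then obtain x y where xy: "x \<in> H" "y \<in> H" "x < y" "y < l" "lex_less p x l" "lex_less p y l"
        by (auto simp: good_def)
      show ?case
      proof (cases "n \<in> kept p H")
        case True
        then have n: "n \<in> H" "lex_less p l n"
          using below[OF step(1)] l by (auto simp: kept_def keep_def good_def)
        have "lex_less p y n" using lex_less_trans[OF xy(6) n(2)] .
        moreover have "c = n \<or> c < n \<and> lex_less p c n" if "c \<in> kept p H" "t \<le> c" "c < Suc n" for c
          using that l n(2) lex_less_trans[of p c l n] unfolding good_def by (metis less_Suc_eq)
        moreover have "y < l" "l < n" "l \<in> H" using l xy by (auto simp: good_def)
        ultimately have "good n (Suc n)"
          unfolding good_def using True n xy(2) by (auto simp: state_Suc)
        then show ?thesis ..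
      next
        case False
        then have "good l (Suc n)" using l unfolding good_def by (auto simp: state_Suc less_Suc_eq)
        then show ?thesis ..
      qed
    qed
    have inf: "infinite (kept p H)"
      unfolding infinite_nat_iff_unbounded_le
    proof
      fix m
      define n where "n = max m n0"
      obtain l where l: "good l n" using good[of n] by (auto simp: n_def)
      then obtain x y where "x \<in> H" "y \<in> H" "x < y" "y < l" "lex_less p x l" "lex_less p y l" "l \<in> H"
        by (auto simp: good_def)
      then obtain w where w: "w \<ge> n" "w \<in> H" "lex_less p l w" using next_nbh[of l x y n] by blast
      \<comment> \<open>If nothing were kept from \<open>n\<close> on, the state would still point
        to \<open>l\<close> when its neighbour \<open>w\<close> is reached, and \<open>w\<close>
        would be kept.\<close>
      have "\<exists>c\<in>kept p H. n \<le> c"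
      proof (rule ccontr)
        assume neg: "\<not> ?thesis"
        have "state p H k = Suc l" if "n \<le> k" for k
          using that
        proof (induction k rule: dec_induct)
          case base
          then show ?case using l by (simp add: good_def)
        next
          case (step k)
          then show ?case using neg by (auto simp: state_Suc)
        qed
        then have "w \<in> kept p H" using w by (simp add: kept_def keep_def)
        then show False using neg w(1) by blast
      qed
      then show "\<exists>c\<ge>m. c \<in> kept p H" by (auto simp: n_def)
    qed
    have "finite (kept p H - A i) \<or> finite (kept p H \<inter> A i)" for i
    proof (rule cohesive_if)
      fix i N assume i: "infinite (kept p H - A i)" "infinite (kept p H \<inter> A i)" "i \<le> N"
        and const: "\<And>x y j. x \<in> kept p H \<Longrightarrow> y \<in> kept p H \<Longrightarrow> N \<le> x \<Longrightarrow> N \<le> y \<Longrightarrow> j < i \<Longrightarrow>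
          x \<in> A j \<longleftrightarrow> y \<in> A j"
      obtain x where x: "x \<in> kept p H \<inter> A i" "x \<ge> max N n0"
        using i(2) unfolding infinite_nat_iff_unbounded_le by blast
      obtain y where y: "y \<in> kept p H - A i" "y > x" using i(1) unfolding infinite_nat_iff_unbounded by blast
      obtain l where l: "good l (Suc y)" using good[of "Suc y"] x y by auto
      have "l = y" using l y(1) by (simp add: good_def state_Suc)
      then have "lex_less p x y" using l x y n0_eq by (auto simp: good_def)
      then obtain j where j: "j \<le> x" "x \<notin> A j" "y \<in> A j" "\<And>k. k < j \<Longrightarrow> x \<in> A k \<longleftrightarrow> y \<in> A k"
        by (auto simp: lex_less_def p less_Suc_eq_le of_bool_eq_iff split: if_splits)
      \<comment> \<open>The first difference \<open>j\<close> is not before \<open>i\<close>, where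
        all bits have settled; not \<open>i\<close>, where \<open>x\<close> has bit 1; and not after
        \<open>i\<close>, since \<open>x\<close> and \<open>y\<close> differ at
        \<open>i\<close>.\<close>
      have "\<not> j < i" using const[of x y j] j x y by auto
      moreover have "j \<noteq> i" using j(2) x(1) by blast
      moreover have "\<not> i < j" using j(4)[of i] x(1) y(1) by blast
      ultimately show False by linarith
    qed
    then show ?thesis using inf by blast
  qed
  then show "infinite (kept p H)" "finite (kept p H - A i) \<or> finite (kept p H \<inter> A i)" by blast+
qed

lemma COH_le_wRSg: "COH \<le>\<^sub>W wRSg"
proof -
  define \<Phi> :: "baire \<Rightarrow> baire" where "\<Phi> p n = (if even n then 1 else
    of_bool (fst (prod_decode (n div 2)) < snd (prod_decode (n div 2)) \<and>
        lex_less p (fst (prod_decode (n div 2))) (snd (prod_decode (n div 2))) \<or>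
      snd (prod_decode (n div 2)) < fst (prod_decode (n div 2)) \<and>
        lex_less p (snd (prod_decode (n div 2))) (fst (prod_decode (n div 2)))))" for p n
  have "{x, y} \<in> lex_graph p \<longleftrightarrow> x < y \<and> lex_less p x y \<or> y < x \<and> lex_less p y x" for x y p
    by (auto simp: lex_graph_def doubleton_eq_iff)
  then have \<Phi>: "\<Phi> p = code_graph (UNIV, lex_graph p)" for p
    by (simp add: fun_eq_iff \<Phi>_def code_graph_cases[OF lex_graph(1)])
  have G: "(UNIV, lex_graph p) \<in> infinite_graphs" for p
    using lex_graph(1) by (simp add: infinite_graphs_def)
  define \<Psi> :: "baire \<Rightarrow> baire" where "\<Psi> q = indicator (kept (left q) {n. q (Suc (2 * n)) \<noteq> 0})" for q
  have path: "comp_pred D (\<lambda>q n. path_below (left q) {n. q (Suc (2 * n)) \<noteq> 0} n)" for D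
    unfolding path_below_def mem_Collect_eq by (intro comp_intros comp_pred_lex_less_left)
  have keep_z: "comp_pred D (\<lambda>q z. keep (left q) {n. q (Suc (2 * n)) \<noteq> 0} (fst (prod_decode z)) (snd (prod_decode z)))"
    for D
    unfolding keep_def mem_Collect_eq
    by (intro comp_intros comp_pred_lex_less_left comp_on_comp[OF path])
  have keep: "comp_pred D (\<lambda>q x. keep (left q) {n. q (Suc (2 * n)) \<noteq> 0} (F q x) (S q x))"
    if "comp_on D F" "comp_on D S" for D F S
    using comp_on_comp[OF keep_z comp_on_pair[OF that]] by simp
  have state: "comp_on D (\<lambda>q n. state (left q) {n. q (Suc (2 * n)) \<noteq> 0} n)" for D
    unfolding state_def by (intro comp_intros keep)
  have "comp_pred D (\<lambda>q n. n \<in> kept (left q) {n. q (Suc (2 * n)) \<noteq> 0})" for D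
    unfolding kept_def mem_Collect_eq by (intro keep state comp_intros)
  then have \<Psi>: "comp_on D \<Psi>" for D
    by (rule comp_on_cong) (simp add: \<Psi>_def indicator_def)
  show ?thesis
  proof (rule weihrauch_leI[of _ \<Phi> _ \<Psi>])
    show "comp_on (insts COH) \<Phi>" unfolding \<Phi>_def by (intro comp_intros comp_pred_lex_less)
    show "\<Phi> p \<in> insts wRSg" for p using G by (auto simp: \<Phi> wRSg_def)
    show "comp_on {join f g | f g. f \<in> insts COH \<and> g \<in> sols wRSg (\<Phi> f)} \<Psi>" by (rule \<Psi>)
  next
    fix p g assume "p \<in> insts COH" and g: "g \<in> sols wRSg (\<Phi> p)"
    then obtain A where A: "p = code_sequence A" by (auto simp: COH_def)
    from g obtain H where H: "g = indicator H" "rsg_sol UNIV (lex_graph p) H"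
      unfolding \<Phi> sols_wRSg[OF G] by blast
    have "\<Psi> (join p g) = indicator (kept p H)" by (simp add: \<Psi>_def H(1) indicator_def)
    then show "\<Psi> (join p g) \<in> sols COH p"
      using kept_cohesive[of A H] H(2) unfolding A sols_COH by blast
  qed
qed

text \<open>Existence of cohesive sets is read off the reduction: Ramsey's theorem solves the graph,
  and the backward map turns its solution into a cohesive set.\<close>

lemma sols_COH_nonempty:
  assumes "h \<in> insts COH" shows "sols COH h \<noteq> {}"
proof -
  obtain \<Phi> \<Psi> where red: "reduction COH wRSg \<Phi> \<Psi>" using COH_le_wRSg unfolding weihrauch_le_iff by blast
  then have "\<Phi> h \<in> insts wRSg" using assms by (simp add: reduction_def)
  then obtain V E where VE: "\<Phi> h = code_graph (V, E)" "(V, E) \<in> infinite_graphs" by (auto simp: wRSg_def)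
  then have "infinite V" "E \<subseteq> nsets V 2" by (auto simp: infinite_graphs_def)
  then obtain H where "H \<subseteq> V" "infinite H" "clique E H \<or> indep E H"
    using infinite_clique_or_indep by blast
  then have "rsgr_sol V E H" using rsgr_sol_clique rsgr_sol_indep by blast
  then have "indicator H \<in> sols wRSg (\<Phi> h)"
    unfolding VE(1) using sols_wRSgr_subset[OF VE(2)] sols_wRSgr[OF VE(2)] by blast
  then have "\<Psi> (join h (indicator H)) \<in> sols COH h" using red assms by (simp add: reduction_def)
  then show ?thesis by blast
qed

theorem theorem6p11:
  shows "\<forall>P\<in>{wRSg, wRSgr}.
           P <\<^sub>W RT22 \<and> COH <\<^sub>W P \<and> RT1_fin <\<^sub>W P \<and>
           P \<parallel>\<^sub>W LimP \<and> P \<parallel>\<^sub>W SRT22 \<and> P \<parallel>\<^sub>W SADC \<and> P \<parallel>\<^sub>W DNR"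
proof
  fix P assume "P \<in> {wRSg, wRSgr}"
  then have P: "wRSg \<le>\<^sub>W P" "P \<le>\<^sub>W wRSgr"
    using wRSg_le_wRSgr weihrauch_le_mono[of wRSg wRSg] weihrauch_le_mono[of wRSgr wRSgr] by auto
  have not_below: "\<not> P \<le>\<^sub>W Q" if "\<not> RT1_fin \<le>\<^sub>W Q" for Q
    using that weihrauch_le_trans[OF RT1_fin_le_wRSg weihrauch_le_trans[OF P(1)]] by blast
  have not_above: "\<not> Q \<le>\<^sub>W P" if "\<not> Q \<le>\<^sub>W wRSgr" for Q
    using that weihrauch_le_trans[OF _ P(2)] by blast
  have "\<not> RT22 \<le>\<^sub>W wRSgr" using not_SRT22_le_wRSgr weihrauch_le_trans[OF SRT22_le_RT22] by blast
  then have "P <\<^sub>W RT22"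
    using not_above weihrauch_le_trans[OF P(2) wRSgr_le_RT22] by (simp add: weihrauch_less_def)
  moreover have "COH <\<^sub>W P"
    using weihrauch_le_trans[OF COH_le_wRSg P(1)]
      not_below[OF not_RT1_fin_le_tame[OF tame_COH[OF sols_COH_nonempty]]]
    by (simp add: weihrauch_less_def)
  moreover have "RT1_fin <\<^sub>W P"
    using weihrauch_le_trans[OF RT1_fin_le_wRSg P(1)] weihrauch_le_trans[OF P(1)] not_wRSg_le_RT1_fin
    by (auto simp: weihrauch_less_def)
  moreover have "P \<parallel>\<^sub>W LimP" "P \<parallel>\<^sub>W SADC" "P \<parallel>\<^sub>W DNR" "P \<parallel>\<^sub>W SRT22"
    unfolding weihrauch_incomparable_def
    using not_below[OF not_RT1_fin_le_tame[OF tame_LimP]] not_below[OF not_RT1_fin_le_tame[OF tame_SADC]]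
      not_below[OF not_RT1_fin_le_tame[OF tame_DNR]] not_below[OF not_RT1_fin_le_SRT22]
      not_above[OF not_LimP_le_wRSgr] not_above[OF not_SADC_le_wRSgr]
      not_above[OF not_DNR_le_wRSgr] not_above[OF not_SRT22_le_wRSgr]
    by blast+
  ultimately show "P <\<^sub>W RT22 \<and> COH <\<^sub>W P \<and> RT1_fin <\<^sub>W P \<and>
      P \<parallel>\<^sub>W LimP \<and> P \<parallel>\<^sub>W SRT22 \<and> P \<parallel>\<^sub>W SADC \<and> P \<parallel>\<^sub>W DNR" by blast
qed

end
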